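(* Let $d\ge 1$ be an integer, let $p>d$ and let $V\in L^1(\mathbb{R}^d)$ be real-valued with $\int_{\mathbb{R}^d}V(x)\,dx>0$. For $\alpha>0$ let $u_\alpha\in W^{1,p}(\mathbb{R}^d)$ be a non-negative minimizer of $Q_{\alpha V}[\cdot]$ with $\|u_\alpha\|_p=1$ (that is, $Q_{\alpha V}[u_\alpha]=\lambda(\alpha V)$), and define $$f_\alpha(x)=\alpha^{-\frac{d}{p(p-d)}}\,u_\alpha\!\left(\alpha^{-\frac{1}{p-d}}x\right),\qquad x\in\mathbb{R}^d.$$ Then for any sequence $(\alpha_n)\subset(0,\infty)$ converging to zero there are a subsequence $(\alpha_{n_k})$ and a function $f_0\in W^{1,p}(\mathbb{R}^d)$ such that $f_{\alpha_{n_k}}\to f_0$ in $W^{1,p}(\mathbb{R}^d)$. Moreover, $f_0$ is a minimizer of the problem $$E(v)=\inf_{u\in W^{1,p}(\mathbb{R}^d),\ \|u\|_p=1}\left(\|\nabla u\|_p^p-v|u(0)|^p\right)\qquad\text{with } v=\int_{\mathbb{R}^d}V\,dx.$$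
   Context: For a real-valued function $V$ on $\mathbb{R}^d$ and $u\in W^{1,p}(\mathbb{R}^d)$ set $$Q_V[u]=\int_{\mathbb{R}^d}\left(|\nabla u|^p-V|u|^p\right)dx,\qquad \lambda(V)=\inf_{0\ne u\in W^{1,p}(\mathbb{R}^d)}\frac{Q_V[u]}{\int_{\mathbb{R}^d}|u|^p\,dx}.$$ $\|\cdot\|_p$ denotes the $L^p(\mathbb{R}^d)$ norm. Since $p>d$, every $u\in W^{1,p}(\mathbb{R}^d)$ has a continuous representative, and $u(0)$ denotes its value at the origin. *)

theory Defs
  imports "HOL-Analysis.Analysis"
begin

text \<open>
  The space R^d is an arbitrary Euclidean space \<open>'a\<close> with d = \<open>DIM('a)\<close>. Functions are
  representatives of Lebesgue-measurable classes: elements of \<open>Lp p\<close> and \<open>W1p p\<close> are identified when they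
  agree almost everywhere, and all notions below are invariant under this identification.
\<close>

subsection \<open>Test functions and weak gradients\<close>

primrec Ck :: "nat \<Rightarrow> ('a::euclidean_space \<Rightarrow> real) \<Rightarrow> bool" where
  "Ck 0 \<phi> \<longleftrightarrow> continuous_on UNIV \<phi>"
| "Ck (Suc k) \<phi> \<longleftrightarrow> (\<forall>x. \<phi> differentiable (at x)) \<and>
     (\<forall>i\<in>Basis. Ck k (\<lambda>x. frechet_derivative \<phi> (at x) i))"

definition test_function :: "('a::euclidean_space \<Rightarrow> real) \<Rightarrow> bool" where
  "test_function \<phi> \<longleftrightarrow> (\<forall>k. Ck k \<phi>) \<and> compact (closure (support_on UNIV \<phi>))"

definition locally_integrable :: "('a::euclidean_space \<Rightarrow> 'b::euclidean_space) \<Rightarrow> bool" where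
  "locally_integrable f \<longleftrightarrow> (\<forall>K. compact K \<longrightarrow> set_integrable lebesgue K f)"

definition is_weak_gradient :: "('a::euclidean_space \<Rightarrow> real) \<Rightarrow> ('a \<Rightarrow> 'a) \<Rightarrow> bool" where
  "is_weak_gradient u g \<longleftrightarrow> locally_integrable u \<and> locally_integrable g \<and>
     (\<forall>\<phi>. test_function \<phi> \<longrightarrow> (\<forall>i\<in>Basis.
        (LINT x|lebesgue. u x * frechet_derivative \<phi> (at x) i) =
        - (LINT x|lebesgue. (g x \<bullet> i) * \<phi> x)))"

text \<open>A weak gradient is unique up to null sets, so the choice below is immaterial.\<close>

definition weak_grad :: "('a::euclidean_space \<Rightarrow> real) \<Rightarrow> 'a \<Rightarrow> 'a" where
  "weak_grad u = (SOME g. is_weak_gradient u g)"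

subsection \<open>Lebesgue and Sobolev spaces\<close>

definition Lp :: "real \<Rightarrow> ('a::euclidean_space \<Rightarrow> 'b::euclidean_space) set" where
  "Lp p = {f \<in> borel_measurable lebesgue. integrable lebesgue (\<lambda>x. norm (f x) powr p)}"

definition Lp_norm :: "real \<Rightarrow> ('a::euclidean_space \<Rightarrow> 'b::euclidean_space) \<Rightarrow> real" where
  "Lp_norm p f = (LINT x|lebesgue. norm (f x) powr p) powr (1 / p)"

definition W1p :: "real \<Rightarrow> ('a::euclidean_space \<Rightarrow> real) set" where
  "W1p p = {u \<in> Lp p. \<exists>g \<in> Lp p. is_weak_gradient u g}"

definition W1p_norm :: "real \<Rightarrow> ('a::euclidean_space \<Rightarrow> real) \<Rightarrow> real" where
  "W1p_norm p u = (Lp_norm p u powr p + Lp_norm p (weak_grad u) powr p) powr (1 / p)"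

text \<open>
  The continuous representative is unique if it exists, since nonempty open sets are not null;
  for p > d it exists for every \<open>u \<in> W1p p\<close>.
\<close>

definition continuous_rep :: "('a::euclidean_space \<Rightarrow> real) \<Rightarrow> 'a \<Rightarrow> real" where
  "continuous_rep u = (THE w. continuous_on UNIV w \<and> (AE x in lebesgue. u x = w x))"

subsection \<open>The functionals\<close>

text \<open>
  For p > d, \<open>V\<close> integrable and \<open>u \<in> W1p p\<close> the integrand of \<open>Q\<close> is integrable, because \<open>u\<close> is
  essentially bounded. The infima are taken in the extended reals, so that
  no boundedness from below is built into the definitions.
\<close>

definition Q :: "real \<Rightarrow> ('a::euclidean_space \<Rightarrow> real) \<Rightarrow> ('a \<Rightarrow> real) \<Rightarrow> real" where
  "Q p V u = (LINT x|lebesgue. norm (weak_grad u x) powr p - V x * \<bar>u x\<bar> powr p)"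

definition ground_energy :: "real \<Rightarrow> ('a::euclidean_space \<Rightarrow> real) \<Rightarrow> ereal" where
  "ground_energy p V =
     (INF u \<in> {u \<in> W1p p. \<not> (AE x in lebesgue. u x = 0)}.
        ereal (Q p V u / (LINT x|lebesgue. \<bar>u x\<bar> powr p)))"

definition nonneg_normalized_minimizer ::
    "real \<Rightarrow> ('a::euclidean_space \<Rightarrow> real) \<Rightarrow> ('a \<Rightarrow> real) \<Rightarrow> bool" where
  "nonneg_normalized_minimizer p V u \<longleftrightarrow>
     u \<in> W1p p \<and> (AE x in lebesgue. 0 \<le> u x) \<and> Lp_norm p u = 1 \<and>
     ereal (Q p V u) = ground_energy p V"

definition delta_functional :: "real \<Rightarrow> real \<Rightarrow> ('a::euclidean_space \<Rightarrow> real) \<Rightarrow> real" where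
  "delta_functional p v u = Lp_norm p (weak_grad u) powr p - v * \<bar>continuous_rep u 0\<bar> powr p"

definition delta_energy :: "'a::euclidean_space itself \<Rightarrow> real \<Rightarrow> real \<Rightarrow> ereal" where
  "delta_energy _ p v =
     (INF u \<in> {u :: 'a \<Rightarrow> real. u \<in> W1p p \<and> Lp_norm p u = 1}. ereal (delta_functional p v u))"

definition delta_minimizer :: "real \<Rightarrow> real \<Rightarrow> ('a::euclidean_space \<Rightarrow> real) \<Rightarrow> bool" where
  "delta_minimizer p v u \<longleftrightarrow>
     u \<in> W1p p \<and> Lp_norm p u = 1 \<and>
     ereal (delta_functional p v u) = delta_energy TYPE('a) p v"

definition rescaled :: "real \<Rightarrow> real \<Rightarrow> ('a::euclidean_space \<Rightarrow> real) \<Rightarrow> 'a \<Rightarrow> real" where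
  "rescaled p \<alpha> u x =
     \<alpha> powr (- (real DIM('a) / (p * (p - real DIM('a))))) *
     u ((\<alpha> powr (- (1 / (p - real DIM('a))))) *\<^sub>R x)"

end

theory Submission
  imports Defs "HOL-Computational_Algebra.Polynomial"
begin

text \<open>
  Write \<open>d\<close> for the dimension, \<open>v\<close> for the integral of \<open>V\<close> and \<open>\<epsilon> = \<alpha> powr (1 / (p - d))\<close>. The rescaling in
  the theorem turns the functional with potential \<open>\<alpha> V\<close> into \<open>\<epsilon> powr p\<close> times
  \<open>\<parallel>\<nabla>w\<parallel>^p - \<integral> V(y) |w(\<epsilon> y)|^p dy\<close> (\<open>rescaled_W1p\<close>), so that the rescaled functions \<open>f\<^sub>\<alpha>\<close> minimize this
  functional among normalized \<open>w\<close> (\<open>rescaled_minimizer\<close>). Since \<open>p > d\<close>, Morrey's inequality bounds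
  \<open>sup |w|^p\<close> by a small multiple of \<open>\<parallel>\<nabla>w\<parallel>^p\<close> plus a large multiple of \<open>\<parallel>w\<parallel>^p\<close>, which makes the \<open>f\<^sub>\<alpha>\<close>
  bounded in the Sobolev space (\<open>scaled_energy_lower_bound\<close>); it also makes bounded sets equicontinuous,
  so that the functional converges, uniformly on bounded sets, to \<open>\<parallel>\<nabla>w\<parallel>^p - v |w(0)|^p\<close> as \<open>\<epsilon>\<close> tends to
  0 (\<open>scaled_energy_tendsto\<close>).

  Strong convergence comes from uniform convexity. Choose a subsequence along which the numbers \<open>f\<^sub>\<alpha>(0)\<close> and
  \<open>\<parallel>\<nabla>f\<^sub>\<alpha>\<parallel>^p\<close> converge, let \<open>c\<close> be the limit of the former and \<open>E\<close> the limit of the energies. Comparison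
  with fixed competitors shows that \<open>E\<close> is a lower bound of the limit problem, and flat bumps show that
  \<open>E < 0\<close> (\<open>delta_energy_negative\<close>). By homogeneity the convex functional
  \<open>H(w) = \<parallel>\<nabla>w\<parallel>^p + |E| \<parallel>w\<parallel>^p\<close> satisfies \<open>H(w) \<ge> v |w(0)|^p\<close> for all \<open>w\<close>, while \<open>H(f\<^sub>\<alpha>)\<close> tends to
  \<open>v |c|^p\<close>. Midpoints of two late members of the subsequence still take values close to \<open>c\<close> at the
  origin, so \<open>H\<close> of the midpoint cannot be much smaller than the average of the two values of \<open>H\<close>.
  By uniform convexity of \<open>L\<^sup>p\<close> (\<open>Lp_uniform_convexity\<close>) the functions and their gradients are
  Cauchy, and \<open>E < 0\<close> is what gives \<open>\<parallel>w\<parallel>^p\<close> a positive weight in \<open>H\<close>, so that no mass escapes. The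
  limit has norm 1 and energy \<open>E\<close> (\<open>minimizing_sequence_converges\<close>).

  Morrey's inequality is obtained directly from the weak gradient. The averages
  \<open>A(x, t) = \<integral> u(x + t y) \<phi>(y) dy\<close> satisfy \<open>\<partial>A/\<partial>t = \<integral> \<nabla>u(x + t y) \<bullet> y \<phi>(y) dy\<close>, which is the definition of
  the weak gradient tested with the functions \<open>y\<^sub>i \<phi>(y)\<close> (\<open>mollify_DERIV\<close>). Hoelder's inequality bounds
  the right-hand side by a multiple of \<open>t powr (- d / p) \<parallel>\<nabla>u\<parallel>\<close>, which is integrable at 0, so the averages
  converge uniformly as \<open>t\<close> tends to 0, and the limit is the continuous representative.
\<close>

section \<open>Smooth functions and test functions\<close>

lemma frechet_derivativeI:
  "(f has_derivative f') (at x) \<Longrightarrow> frechet_derivative f (at x) = f'"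
  by (metis frechet_derivative_at)

lemma Ck_SucI:
  assumes "\<And>x. (f has_derivative f' x) (at x)" "\<And>i. i \<in> Basis \<Longrightarrow> Ck k (\<lambda>x. f' x i)"
  shows "Ck (Suc k) f"
proof -
  have "frechet_derivative f (at x) = f' x" for x by (rule frechet_derivativeI[OF assms(1)])
  then show ?thesis using assms by (auto simp: differentiable_def)
qed

lemma Ck_has_derivative:
  "Ck (Suc k) f \<Longrightarrow> (f has_derivative frechet_derivative f (at x)) (at x)"
  by (simp add: frechet_derivative_works[symmetric])

lemma Ck_Suc_imp: "Ck (Suc k) f \<Longrightarrow> Ck k f"
proof (induction k arbitrary: f)
  case 0
  then show ?case by (auto simp: differentiable_on_def intro!: differentiable_imp_continuous_on)
qed simp

lemma Ck_const: "Ck k (\<lambda>x. c)"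
  by (induction k arbitrary: c) simp_all

lemma Ck_add: "Ck k f \<Longrightarrow> Ck k g \<Longrightarrow> Ck k (\<lambda>x. f x + g x)"
proof (induction k arbitrary: f g)
  case 0
  then show ?case by (auto intro!: continuous_intros)
next
  case (Suc k)
  show ?case
    by (rule Ck_SucI[OF has_derivative_add[OF Ck_has_derivative[OF Suc.prems(1)] Ck_has_derivative[OF Suc.prems(2)]]])
      (use Suc in \<open>auto intro!: Suc.IH\<close>)
qed

lemma Ck_mult: "Ck k f \<Longrightarrow> Ck k g \<Longrightarrow> Ck k (\<lambda>x. f x * g x)"
proof (induction k arbitrary: f g)
  case 0
  then show ?case by (auto intro!: continuous_intros)
next
  case (Suc k)
  have "Ck k f" "Ck k g" using Suc.prems by (auto intro: Ck_Suc_imp simp del: Ck.simps)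
  then show ?case
    by (intro Ck_SucI[OF has_derivative_mult[OF Ck_has_derivative[OF Suc.prems(1)] Ck_has_derivative[OF Suc.prems(2)]]])
      (use Suc in \<open>auto intro!: Suc.IH Ck_add\<close>)
qed

lemma Ck_prod: "(\<And>i. i \<in> I \<Longrightarrow> Ck k (f i)) \<Longrightarrow> Ck k (\<lambda>x. \<Prod>i\<in>I. f i x)"
  by (induction I rule: infinite_finite_induct) (auto intro!: Ck_const Ck_mult)

lemma Ck_inner: "Ck k (\<lambda>x::'a::euclidean_space. x \<bullet> c)"
proof (cases k)
  case (Suc m)
  show ?thesis unfolding Suc
    by (rule Ck_SucI[where f' = "\<lambda>_ y. y \<bullet> c"]) (auto intro!: derivative_eq_intros Ck_const)
qed (auto intro!: continuous_intros)

lemma has_derivative_affine: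
  assumes "(f has_derivative f') (at (a + s *\<^sub>R x))"
  shows "((\<lambda>x. f (a + s *\<^sub>R x)) has_derivative (\<lambda>y. f' (s *\<^sub>R y))) (at x)"
proof -
  have "((\<lambda>x. a + s *\<^sub>R x) has_derivative (\<lambda>y. s *\<^sub>R y)) (at x)"
    by (auto intro!: derivative_eq_intros)
  from has_derivative_compose[OF this assms] show ?thesis .
qed

lemma Ck_affine:
  fixes f :: "'a::euclidean_space \<Rightarrow> real"
  shows "Ck k f \<Longrightarrow> Ck k (\<lambda>x. f (a + s *\<^sub>R x))"
proof (induction k arbitrary: f)
  case 0
  then show ?case by (auto intro!: continuous_intros continuous_on_compose2[of UNIV f])
next
  case (Suc k)
  have "frechet_derivative f (at y) (s *\<^sub>R i) = s * frechet_derivative f (at y) i" for y i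
    using linear_frechet_derivative[of f "at y"] Suc.prems by (simp add: linear_scale)
  then show ?case
    by (intro Ck_SucI[OF has_derivative_affine[OF Ck_has_derivative[OF Suc.prems]]])
      (use Suc.prems Suc.IH[of "\<lambda>x. frechet_derivative f (at x) i" for i] in \<open>auto intro!: Ck_mult Ck_const\<close>)
qed

section \<open>A smooth function that is flat on a half-line\<close>

text \<open>
  For \<open>P = 1\<close> this is the classical function \<open>exp (- 1 / t)\<close>, extended by 0. The polynomial factor in
  \<open>1 / t\<close> makes the family closed under differentiation, so that smoothness is a single induction.
\<close>

definition flat :: "real poly \<Rightarrow> real \<Rightarrow> real" where
  "flat P t = (if t \<le> 0 then 0 else poly P (1 / t) * exp (- (1 / t)))"

text \<open>
  The coefficient polynomial of the derivative: both \<open>exp (- 1 / t)\<close> and \<open>P (1 / t)\<close> contribute a factor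
  \<open>1 / t^2\<close>.
\<close>

definition flat_deriv :: "real poly \<Rightarrow> real poly" where
  "flat_deriv P = (P - pderiv P) * [:0, 0, 1:]"

lemma poly_times_exp_tendsto_0: "((\<lambda>y::real. poly P y * exp (- y)) \<longlongrightarrow> 0) at_top"
proof -
  have "((\<lambda>y. \<Sum>i\<le>degree P. coeff P i * (y ^ i / exp y)) \<longlongrightarrow> (\<Sum>i\<le>degree P. coeff P i * 0)) at_top"
    by (intro tendsto_sum tendsto_mult tendsto_const tendsto_power_div_exp_0)
  then show ?thesis
    by (simp add: poly_altdef exp_minus sum_distrib_left divide_inverse mult_ac)
qed

text \<open>
  With \<open>y = 1 / t\<close> this is the decay of \<open>exp (- y)\<close> against polynomials.
\<close>

lemma flat_tendsto_0: "(flat P \<longlongrightarrow> 0) (at 0)"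
proof (rule filterlim_split_at)
  show "(flat P \<longlongrightarrow> 0) (at_left 0)"
    by (rule tendsto_eventually) (auto simp: flat_def eventually_at_filter)
  have "((\<lambda>t. poly P (inverse t) * exp (- inverse t)) \<longlongrightarrow> 0) (at_right 0)"
    by (rule filterlim_compose[OF poly_times_exp_tendsto_0 filterlim_inverse_at_top_right])
  moreover have "\<forall>\<^sub>F t in at_right 0. poly P (inverse t) * exp (- inverse t) = flat P t"
    by (auto simp: flat_def eventually_at_filter divide_inverse)
  ultimately show "(flat P \<longlongrightarrow> 0) (at_right 0)" by (rule Lim_transform_eventually)
qed

text \<open>
  Only the origin is delicate: there the difference quotient of \<open>flat P\<close> is the family member with
  polynomial \<open>y P(y)\<close>, which tends to 0.
\<close>

lemma DERIV_flat: "(flat P has_field_derivative flat (flat_deriv P) t) (at t)"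
proof -
  consider "t < 0" | "t = 0" | "t > 0" by linarith
  then show ?thesis
  proof cases
    case 1
    have "((\<lambda>_. 0) has_field_derivative 0) (at t)" by simp
    then have "(flat P has_field_derivative 0) (at t)"
      by (rule DERIV_cong_ev[THEN iffD1, rotated -1])
        (use 1 eventually_nhds_in_open[of "{..<0}" t] in \<open>auto simp: flat_def elim!: eventually_mono\<close>)
    then show ?thesis using 1 by (simp add: flat_def)
  next
    case 2
    have *: "(\<lambda>h. (flat P h - flat P 0) / (h - 0)) = flat (P * [:0, 1:])"
      by (auto simp: flat_def fun_eq_iff)
    have "(flat P has_field_derivative 0) (at 0)"
      unfolding has_field_derivative_iff * by (rule flat_tendsto_0)
    then show ?thesis using 2 by (simp add: flat_def)
  next
    case 3
    have "((\<lambda>t. poly P (1 / t) * exp (- (1 / t))) has_field_derivative flat (flat_deriv P) t) (at t)"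
      using 3 by (auto intro!: derivative_eq_intros DERIV_chain2[OF poly_DERIV]
          simp: flat_def flat_deriv_def field_simps power2_eq_square)
    then show ?thesis
      by (rule DERIV_cong_ev[THEN iffD1, rotated -1])
        (use 3 eventually_nhds_in_open[of "{0<..}" t] in \<open>auto simp: flat_def elim!: eventually_mono\<close>)
  qed
qed

lemma continuous_on_flat: "continuous_on S (flat P)"
  using DERIV_flat DERIV_isCont continuous_at_imp_continuous_on by blast

lemma Ck_flat: "Ck k (\<lambda>x::'a::euclidean_space. flat P (s * (x \<bullet> c) + e))"
proof (induction k arbitrary: P)
  case 0
  show ?case by (auto intro!: continuous_intros continuous_on_compose2[OF continuous_on_flat[of UNIV]])
next
  case (Suc k)
  have "((\<lambda>x::'a. flat P (s * (x \<bullet> c) + e)) has_derivative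
      (\<lambda>y. flat (flat_deriv P) (s * (x \<bullet> c) + e) * (s * (y \<bullet> c)))) (at x)" for x
    by (rule has_derivative_compose[of "\<lambda>x. s * (x \<bullet> c) + e", OF _ DERIV_flat[unfolded has_field_derivative_def]])
      (auto intro!: derivative_eq_intros)
  then show ?case
    by (rule Ck_SucI) (auto intro!: Ck_mult Ck_const Suc)
qed

text \<open>
  The parameter \<open>s\<close> is the steepness of the walls: since \<open>exp (- 1 / (s t))\<close> tends to 1 for every
  \<open>t > 0\<close>, these functions increase to the indicator of the box.
\<close>

definition box_bump :: "'a::euclidean_space \<Rightarrow> 'a \<Rightarrow> real \<Rightarrow> 'a \<Rightarrow> real" where
  "box_bump a b s x = (\<Prod>i\<in>Basis. flat 1 (s * (x \<bullet> i) + s * - (a \<bullet> i)) * flat 1 (- s * (x \<bullet> i) + s * (b \<bullet> i)))"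

lemma flat_one: "flat 1 t = (if t \<le> 0 then 0 else exp (- (1 / t)))"
  by (simp add: flat_def)

lemma flat_one_bounds: "0 \<le> flat 1 t" "flat 1 t \<le> 1"
  by (auto simp: flat_one)

lemma box_bump_bounds: "0 \<le> box_bump a b s x" "box_bump a b s x \<le> 1"
  by (auto simp: box_bump_def flat_one_bounds intro!: prod_nonneg prod_le_1 mult_le_one)

lemma box_bump_eq_0_iff: "s > 0 \<Longrightarrow> box_bump a b s x = 0 \<longleftrightarrow> x \<notin> box a b"
proof -
  assume s: "s > 0"
  have "flat 1 (s * (x \<bullet> i) + s * - (a \<bullet> i)) * flat 1 (- s * (x \<bullet> i) + s * (b \<bullet> i)) = 0 \<longleftrightarrow>
      \<not> (a \<bullet> i < x \<bullet> i \<and> x \<bullet> i < b \<bullet> i)" for i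
    using s by (auto simp: flat_one not_le)
  then show ?thesis by (auto simp: box_bump_def mem_box)
qed

lemma test_functionI:
  assumes "\<And>k. Ck k \<phi>" "compact K" "\<And>x. x \<notin> K \<Longrightarrow> \<phi> x = 0"
  shows "test_function \<phi>"
proof -
  have "closure (support_on UNIV \<phi>) \<subseteq> K"
    using assms by (intro closure_minimal) (auto simp: support_on_def compact_imp_closed)
  then have "compact (closure (support_on UNIV \<phi>))"
    using assms(2) by (metis closed_closure compact_Int_closed inf.absorb2)
  with assms show ?thesis unfolding test_function_def by blast
qed

lemma test_function_obtain:
  assumes "test_function \<phi>"
  obtains K where "compact K" "\<And>x. x \<notin> K \<Longrightarrow> \<phi> x = 0" "K \<noteq> {}"
proof 
  let ?K = "insert undefined (closure (support_on UNIV \<phi>))"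
  show "compact ?K" "?K \<noteq> {}" using assms by (auto simp: test_function_def)
  show "\<phi> x = 0" if "x \<notin> ?K" for x
    using that closure_subset[of "support_on UNIV \<phi>"] by (auto simp: support_on_def)
qed

lemma test_function_box_bump: 
  assumes "s > 0" shows "test_function (box_bump a b s)"
proof (rule test_functionI)
  show "Ck k (box_bump a b s)" for k
    unfolding box_bump_def[abs_def] by (intro Ck_prod Ck_mult Ck_flat)
  show "compact (cbox a b)" by simp
  show "box_bump a b s x = 0" if "x \<notin> cbox a b" for x
    using that box_subset_cbox[of a b] by (subst box_bump_eq_0_iff[OF assms]) auto
qed

lemma box_bump_tendsto: "(\<lambda>n. box_bump a b (real (Suc n)) x) \<longlonglongrightarrow> indicator (box a b) x"
proof -
  have *: "(\<lambda>n. flat 1 (real (Suc n) * t)) \<longlonglongrightarrow> 1" if "t > 0" for t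
  proof -
    have "(\<lambda>n. exp (- ((1 / t) * inverse (real (Suc n))))) \<longlonglongrightarrow> exp (- ((1 / t) * 0))"
      by (intro tendsto_intros LIMSEQ_inverse_real_of_nat)
    moreover have "flat 1 (real (Suc n) * t) = exp (- ((1 / t) * inverse (real (Suc n))))" for n
      using that mult_pos_pos[of "real (Suc n)" t] by (auto simp: flat_one field_simps)
    ultimately show ?thesis by simp
  qed
  show ?thesis
  proof (cases "x \<in> box a b")
    case True
    have "(\<lambda>n. box_bump a b (real (Suc n)) x) \<longlonglongrightarrow> (\<Prod>i\<in>(Basis::'a set). 1 * 1)"
      unfolding box_bump_def
    proof (intro tendsto_prod tendsto_mult)
      fix i :: 'a assume "i \<in> Basis"
      then show "(\<lambda>n. flat 1 (real (Suc n) * (x \<bullet> i) + real (Suc n) * - (a \<bullet> i))) \<longlonglongrightarrow> 1"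
        "(\<lambda>n. flat 1 (- real (Suc n) * (x \<bullet> i) + real (Suc n) * (b \<bullet> i))) \<longlonglongrightarrow> 1"
        using *[of "x \<bullet> i - a \<bullet> i"] *[of "b \<bullet> i - x \<bullet> i"] True 
        by (simp_all add: mem_box algebra_simps)
    qed
    with True show ?thesis by simp
  next
    case False
    then have "box_bump a b (real (Suc n)) x = 0" for n by (subst box_bump_eq_0_iff) auto
    with False show ?thesis by (simp del: of_nat_Suc)
  qed
qed

section \<open>Properties of test functions\<close>

lemma test_function_Ck: "test_function \<phi> \<Longrightarrow> Ck k \<phi>"
  by (simp add: test_function_def)

lemma test_function_continuous: "test_function \<phi> \<Longrightarrow> continuous_on S \<phi>"
  using test_function_Ck[of \<phi> 0] continuous_on_subset by auto

lemma test_function_has_derivative: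
  "test_function \<phi> \<Longrightarrow> (\<phi> has_derivative frechet_derivative \<phi> (at x)) (at x)"
  using test_function_Ck[of \<phi> 1] Ck_has_derivative[of 0 \<phi>] by simp

lemma test_function_mult:
  assumes "test_function \<phi>" "\<And>k. Ck k f"
  shows "test_function (\<lambda>x. f x * \<phi> x)"
proof -
  obtain K where K: "compact K" "\<And>x. x \<notin> K \<Longrightarrow> \<phi> x = 0" using test_function_obtain[OF assms(1)] by metis
  show ?thesis
    by (rule test_functionI[OF _ K(1)]) (simp_all add: K(2) Ck_mult assms(2) test_function_Ck[OF assms(1)])
qed

lemma test_function_affine:
  assumes "test_function \<phi>" "s \<noteq> 0"
  shows "test_function (\<lambda>x. \<phi> (a + s *\<^sub>R x))"
proof -
  obtain K where K: "compact K" "\<And>x. x \<notin> K \<Longrightarrow> \<phi> x = 0" using test_function_obtain[OF assms(1)] by metis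
  show ?thesis
  proof (rule test_functionI)
    show "compact ((\<lambda>y. (1 / s) *\<^sub>R (y - a)) ` K)"
      by (intro compact_continuous_image continuous_intros K)
    show "\<phi> (a + s *\<^sub>R x) = 0" if "x \<notin> (\<lambda>y. (1 / s) *\<^sub>R (y - a)) ` K" for x
    proof (rule K, rule)
      assume "a + s *\<^sub>R x \<in> K"
      then have "(1 / s) *\<^sub>R ((a + s *\<^sub>R x) - a) \<in> (\<lambda>y. (1 / s) *\<^sub>R (y - a)) ` K" by (rule imageI)
      with that assms(2) show False by simp
    qed
  qed (intro Ck_affine test_function_Ck assms)
qed

lemma frechet_derivative_zero_outside:
  assumes "compact K" "\<And>x. x \<notin> K \<Longrightarrow> \<phi> x = 0" "x \<notin> K"
  shows "frechet_derivative \<phi> (at x) = (\<lambda>_. 0)"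
proof (rule frechet_derivativeI)
  show "(\<phi> has_derivative (\<lambda>_. 0)) (at x)"
    by (rule has_derivative_transform_within_open[where f = "\<lambda>_. 0" and s = "- K"])
      (use assms compact_imp_closed in \<open>auto simp: open_Compl\<close>)
qed

lemma test_function_partial:
  assumes "test_function \<phi>" "i \<in> Basis"
  shows "test_function (\<lambda>x. frechet_derivative \<phi> (at x) i)"
proof -
  obtain K where K: "compact K" "\<And>x. x \<notin> K \<Longrightarrow> \<phi> x = 0" using test_function_obtain[OF assms(1)] by metis
  show ?thesis
  proof (rule test_functionI)
    show "Ck k (\<lambda>x. frechet_derivative \<phi> (at x) i)" for k
      using test_function_Ck[OF assms(1), of "Suc k"] assms(2) by simp
    show "frechet_derivative \<phi> (at x) i = 0" if "x \<notin> K" for x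
      using frechet_derivative_zero_outside[OF K that] by simp
  qed (rule K)
qed

lemma test_function_bounded:
  assumes "test_function \<phi>"
  obtains C where "C > 0" "\<And>x. \<bar>\<phi> x\<bar> \<le> C"
proof -
  obtain K where K: "compact K" "\<And>x. x \<notin> K \<Longrightarrow> \<phi> x = 0" using test_function_obtain[OF assms] by metis
  have "bounded (\<phi> ` K)"
    by (intro compact_imp_bounded compact_continuous_image test_function_continuous assms K)
  then obtain C where "C > 0" "\<And>x. x \<in> K \<Longrightarrow> \<bar>\<phi> x\<bar> \<le> C" by (auto simp: bounded_pos)
  with K have "\<bar>\<phi> x\<bar> \<le> C" for x by (cases "x \<in> K") auto
  with \<open>C > 0\<close> show ?thesis using that by blast
qed

lemma integrable_continuous_compact_support:
  fixes f :: "'a::euclidean_space \<Rightarrow> 'b::euclidean_space"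
  assumes "continuous_on UNIV f" "compact K" "\<And>x. x \<notin> K \<Longrightarrow> f x = 0"
  shows "integrable lebesgue f"
proof -
  have "integrable lborel (\<lambda>x. indicator K x *\<^sub>R f x)"
    by (intro borel_integrable_compact assms continuous_on_subset[OF assms(1)]) simp
  moreover have "(\<lambda>x. indicator K x *\<^sub>R f x) = f"
    using assms(3) by (force simp: fun_eq_iff indicator_def)
  ultimately have "integrable lborel f" by simp
  then show ?thesis by (simp add: integrable_completion borel_measurable_integrable)
qed

lemma test_function_integrable: "test_function \<phi> \<Longrightarrow> integrable lebesgue \<phi>"
  by (metis integrable_continuous_compact_support test_function_continuous test_function_obtain)

lemma test_function_measurable: "test_function \<phi> \<Longrightarrow> \<phi> \<in> borel_measurable borel"
  by (simp add: borel_measurable_continuous_onI test_function_continuous)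

lemma test_function_measurable_lebesgue: "test_function \<phi> \<Longrightarrow> \<phi> \<in> borel_measurable lebesgue"
  using test_function_integrable borel_measurable_integrable by blast

text \<open>
  The partial derivatives are again test functions and hence bounded; the mean value inequality
  does the rest.
\<close>

lemma test_function_lipschitz:
  assumes "test_function (\<phi> :: 'a::euclidean_space \<Rightarrow> real)"
  obtains L where "L > 0" "\<And>x v. \<bar>frechet_derivative \<phi> (at x) v\<bar> \<le> L * norm v"
    "\<And>x y. \<bar>\<phi> x - \<phi> y\<bar> \<le> L * norm (x - y)"
proof -
  have "\<forall>i\<in>Basis. \<exists>C. \<forall>x. \<bar>frechet_derivative \<phi> (at x) i\<bar> \<le> C"
    using test_function_bounded[OF test_function_partial[OF assms]] by metis
  then obtain C where C: "\<And>i x. i \<in> Basis \<Longrightarrow> \<bar>frechet_derivative \<phi> (at x) i\<bar> \<le> C i" by metis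
  define L where "L = 1 + (\<Sum>i\<in>Basis. C i)"
  have C0: "C i \<ge> 0" if "i \<in> Basis" for i using C[OF that, of 0] by linarith
  then have L: "L > 0" unfolding L_def by (intro add_pos_nonneg sum_nonneg) auto
  have *: "\<bar>frechet_derivative \<phi> (at x) v\<bar> \<le> L * norm v" for x v
  proof -
    have lin: "linear (frechet_derivative \<phi> (at x))"
      using has_derivative_linear[OF test_function_has_derivative[OF assms]] .
    have "frechet_derivative \<phi> (at x) v = frechet_derivative \<phi> (at x) (\<Sum>i\<in>Basis. (v \<bullet> i) *\<^sub>R i)"
      by (simp add: euclidean_representation)
    also have "\<dots> = (\<Sum>i\<in>Basis. (v \<bullet> i) * frechet_derivative \<phi> (at x) i)"
      using lin by (simp add: linear_sum linear_scale)
    also have "\<bar>\<dots>\<bar> \<le> (\<Sum>i\<in>Basis. norm v * C i)"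
      by (intro order_trans[OF sum_abs] sum_mono) 
        (auto simp: abs_mult Basis_le_norm intro!: mult_mono C)
    also have "\<dots> \<le> L * norm v" by (simp add: L_def algebra_simps sum_distrib_left)
    finally show ?thesis .
  qed
  have "\<bar>\<phi> x - \<phi> y\<bar> \<le> L * norm (x - y)" for x y
  proof -
    have "norm (\<phi> x - \<phi> y) \<le> L * norm (x - y)"
    proof (rule differentiable_bound[of UNIV \<phi> "\<lambda>x. frechet_derivative \<phi> (at x)"])
      show "onorm (frechet_derivative \<phi> (at x)) \<le> L" for x
        by (rule onorm_bound) (use * L in \<open>auto\<close>)
    qed (auto intro: test_function_has_derivative assms)
    then show ?thesis by simp
  qed
  with L * that show ?thesis by blast
qed

section \<open>Affine changes of variables\<close>

lemma lebesgue_scaleR_affine: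
  fixes a :: "'a::euclidean_space"
  assumes "s \<noteq> 0"
  shows "lebesgue = density (distr lebesgue lebesgue (\<lambda>x. a + s *\<^sub>R x)) (\<lambda>_. ennreal (\<bar>s\<bar> ^ DIM('a)))"
    and measurable_scaleR_affine: "(\<lambda>x. a + s *\<^sub>R x) \<in> lebesgue \<rightarrow>\<^sub>M lebesgue"
proof -
  have *: "(\<lambda>x. a + (\<Sum>j\<in>Basis. (s * (x \<bullet> j)) *\<^sub>R j)) = (\<lambda>x. a + s *\<^sub>R x)"
    unfolding scaleR_scaleR[symmetric] scaleR_sum_right[symmetric] by (simp add: euclidean_representation)
  show "lebesgue = density (distr lebesgue lebesgue (\<lambda>x. a + s *\<^sub>R x)) (\<lambda>_. ennreal (\<bar>s\<bar> ^ DIM('a)))"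
    using lebesgue_affine_euclidean[of "\<lambda>_. s" a] assms unfolding * by simp
  show "(\<lambda>x. a + s *\<^sub>R x) \<in> lebesgue \<rightarrow>\<^sub>M lebesgue"
    using lebesgue_affine_measurable[of "\<lambda>_. s" a] assms unfolding * by simp
qed

lemma borel_measurable_affine:
  "s \<noteq> 0 \<Longrightarrow> f \<in> borel_measurable lebesgue \<Longrightarrow> (\<lambda>x. f (a + s *\<^sub>R x)) \<in> borel_measurable lebesgue"
  using measurable_compose[OF measurable_scaleR_affine] by blast

lemma
  fixes f :: "'a::euclidean_space \<Rightarrow> 'b::{banach, second_countable_topology}"
  assumes "s \<noteq> 0" and [measurable]: "f \<in> borel_measurable lebesgue"
  shows integrable_affine_iff: "integrable lebesgue (\<lambda>x. f (a + s *\<^sub>R x)) \<longleftrightarrow> integrable lebesgue f"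
    and integral_affine: "(LINT x|lebesgue. f (a + s *\<^sub>R x)) = (LINT x|lebesgue. f x) /\<^sub>R \<bar>s\<bar> ^ DIM('a)"
proof -
  note [measurable] = measurable_scaleR_affine[OF assms(1)]
  have s: "\<bar>s\<bar> ^ DIM('a) \<noteq> 0" using assms(1) by simp
  have "integrable lebesgue f \<longleftrightarrow>
      integrable (density (distr lebesgue lebesgue (\<lambda>x. a + s *\<^sub>R x)) (\<lambda>_. ennreal (\<bar>s\<bar> ^ DIM('a)))) f"
    by (subst lebesgue_scaleR_affine(1)[OF assms(1)]) (rule refl)
  also have "\<dots> \<longleftrightarrow> integrable lebesgue (\<lambda>x. \<bar>s\<bar> ^ DIM('a) *\<^sub>R f (a + s *\<^sub>R x))"
    by (subst integrable_density) (simp_all add: integrable_distr_eq)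
  also have "\<dots> \<longleftrightarrow> integrable lebesgue (\<lambda>x. f (a + s *\<^sub>R x))"
    using s integrable_scaleR_right[of "1 / \<bar>s\<bar> ^ DIM('a)" lebesgue "\<lambda>x. \<bar>s\<bar> ^ DIM('a) *\<^sub>R f (a + s *\<^sub>R x)"]
    by auto
  finally show "integrable lebesgue (\<lambda>x. f (a + s *\<^sub>R x)) \<longleftrightarrow> integrable lebesgue f" by simp
  have "(LINT x|lebesgue. f x) =
      integral\<^sup>L (density (distr lebesgue lebesgue (\<lambda>x. a + s *\<^sub>R x)) (\<lambda>_. ennreal (\<bar>s\<bar> ^ DIM('a)))) f"
    by (subst lebesgue_scaleR_affine(1)[OF assms(1)]) (rule refl)
  also have "\<dots> = \<bar>s\<bar> ^ DIM('a) *\<^sub>R (LINT x|lebesgue. f (a + s *\<^sub>R x))"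
    by (subst integral_density) (simp_all add: integral_distr)
  finally show "(LINT x|lebesgue. f (a + s *\<^sub>R x)) = (LINT x|lebesgue. f x) /\<^sub>R \<bar>s\<bar> ^ DIM('a)"
    using s by simp
qed

lemma AE_affine:
  fixes a :: "'a::euclidean_space"
  assumes "s \<noteq> 0" "AE x in lebesgue. P x"
  shows "AE x in lebesgue. P (a + s *\<^sub>R x)"
proof -
  have "AE x in density (distr lebesgue lebesgue (\<lambda>x. a + s *\<^sub>R x)) (\<lambda>_. ennreal (\<bar>s\<bar> ^ DIM('a))). P x"
    using assms(2) by (subst (asm) lebesgue_scaleR_affine(1)[OF assms(1), of a])
  then have "AE x in distr lebesgue lebesgue (\<lambda>x. a + s *\<^sub>R x). P x"
    using assms(1) by (subst (asm) AE_density) auto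
  then show ?thesis by (rule AE_distrD[OF measurable_scaleR_affine[OF assms(1)]])
qed

section \<open>Locally integrable functions\<close>

lemma locally_integrable_measurable:
  assumes "locally_integrable f"
  shows "f \<in> borel_measurable lebesgue"
proof (rule borel_measurable_LIMSEQ_metric)
  show "(\<lambda>x. indicator (cball 0 (real n)) x *\<^sub>R f x) \<in> borel_measurable lebesgue" for n
    using assms by (intro borel_measurable_integrable) (auto simp: locally_integrable_def set_integrable_def)
  show "(\<lambda>n. indicator (cball 0 (real n)) x *\<^sub>R f x) \<longlonglongrightarrow> f x" for x
  proof (rule tendsto_eventually, rule eventually_sequentiallyI)
    fix n assume "nat \<lceil>norm x\<rceil> \<le> n"
    then have "norm x \<le> real n" by linarith
    then show "indicator (cball 0 (real n)) x *\<^sub>R f x = f x" by simp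
  qed
qed

lemma integrable_mult_locally_integrable:
  fixes f :: "'a::euclidean_space \<Rightarrow> 'b::euclidean_space"
  assumes f: "locally_integrable f" and \<phi>: "\<phi> \<in> borel_measurable lebesgue" "\<And>x. \<bar>\<phi> x\<bar> \<le> C"
    and K: "compact K" "\<And>x. x \<notin> K \<Longrightarrow> \<phi> x = 0"
  shows "integrable lebesgue (\<lambda>x. \<phi> x *\<^sub>R f x)"
proof (rule Bochner_Integration.integrable_bound)
  show "integrable lebesgue (\<lambda>x. C * norm (indicator K x *\<^sub>R f x))"
    using f K unfolding locally_integrable_def set_integrable_def by (intro integrable_mult_right integrable_norm) auto
  show "(\<lambda>x. \<phi> x *\<^sub>R f x) \<in> borel_measurable lebesgue"
    using \<phi>(1) locally_integrable_measurable[OF f] by measurable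
  show "AE x in lebesgue. norm (\<phi> x *\<^sub>R f x) \<le> norm (C * norm (indicator K x *\<^sub>R f x))"
  proof (rule AE_I2)
    fix x
    have "C \<ge> 0" using \<phi>(2)[of undefined] by linarith
    then show "norm (\<phi> x *\<^sub>R f x) \<le> norm (C * norm (indicator K x *\<^sub>R f x))"
      using \<phi>(2)[of x] K(2)[of x] by (cases "x \<in> K") (auto intro: mult_right_mono)
  qed
qed

lemma integrable_mult_test_function:
  fixes f :: "'a::euclidean_space \<Rightarrow> 'b::euclidean_space"
  assumes f: "locally_integrable f" and \<phi>: "test_function \<phi>"
  shows "integrable lebesgue (\<lambda>x. \<phi> x *\<^sub>R f x)"
proof -
  obtain K where K: "compact K" "\<And>x. x \<notin> K \<Longrightarrow> \<phi> x = 0" using test_function_obtain[OF \<phi>] by metis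
  obtain C where "C > 0" "\<And>x. \<bar>\<phi> x\<bar> \<le> C" using test_function_bounded[OF \<phi>] by metis
  with K show ?thesis
    using integrable_mult_locally_integrable[OF f test_function_measurable_lebesgue[OF \<phi>]] by metis
qed

lemma integrable_test_mult:
  "locally_integrable f \<Longrightarrow> test_function \<phi> \<Longrightarrow> integrable lebesgue (\<lambda>x. f x * \<phi> x)"
  for f :: "'a::euclidean_space \<Rightarrow> real"
  using integrable_mult_test_function[of f \<phi>] by (simp add: mult.commute)

lemma integrable_test_inner:
  "locally_integrable f \<Longrightarrow> test_function \<phi> \<Longrightarrow> integrable lebesgue (\<lambda>x. (f x \<bullet> i) * \<phi> x)"
  using integrable_inner_left[of i lebesgue "\<lambda>x. \<phi> x *\<^sub>R f x"] integrable_mult_test_function[of f \<phi>] 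
  by (simp add: mult.commute)

lemma locally_integrable_lincomb:
  fixes f g :: "'a::euclidean_space \<Rightarrow> 'b::euclidean_space"
  assumes "locally_integrable f" "locally_integrable g"
  shows "locally_integrable (\<lambda>x. a *\<^sub>R f x + b *\<^sub>R g x)"
  using assms unfolding locally_integrable_def by (auto intro!: set_integral_add)

lemma locally_integrable_inner:
  fixes f :: "'a::euclidean_space \<Rightarrow> 'b::euclidean_space"
  assumes "locally_integrable f"
  shows "locally_integrable (\<lambda>x. f x \<bullet> i)"
  unfolding locally_integrable_def set_integrable_def
proof (intro allI impI)
  fix K :: "'a set" assume "compact K"
  then have "integrable lebesgue (\<lambda>x. (indicator K x *\<^sub>R f x) \<bullet> i)"
    using assms by (intro integrable_inner_left) (auto simp: locally_integrable_def set_integrable_def)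
  then show "integrable lebesgue (\<lambda>x. indicat_real K x *\<^sub>R (f x \<bullet> i))" by simp
qed

lemma locally_integrable_affine:
  fixes f :: "'a::euclidean_space \<Rightarrow> 'b::euclidean_space"
  assumes "locally_integrable f" "s \<noteq> 0"
  shows "locally_integrable (\<lambda>x. f (a + s *\<^sub>R x))"
  unfolding locally_integrable_def set_integrable_def
proof (intro allI impI)
  fix K :: "'a set" assume "compact K"
  define K' where "K' = (\<lambda>x. a + s *\<^sub>R x) ` K"
  have "compact K'" unfolding K'_def by (intro compact_continuous_image continuous_intros \<open>compact K\<close>)
  then have i: "integrable lebesgue (\<lambda>x. indicator K' x *\<^sub>R f x)"
    using assms(1) by (auto simp: locally_integrable_def set_integrable_def)
  have "indicator K x = (indicator K' (a + s *\<^sub>R x) :: real)" for x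
    using assms(2) by (auto simp: K'_def indicator_def)
  then show "integrable lebesgue (\<lambda>x. indicat_real K x *\<^sub>R f (a + s *\<^sub>R x))"
    using integrable_affine_iff[OF assms(2) borel_measurable_integrable[OF i], of a] i by simp
qed

section \<open>The fundamental lemma of the calculus of variations\<close>

text \<open>
  The measures with densities \<open>h\<^sup>+\<close> and \<open>h\<^sup>-\<close> agree on boxes, which are stable under intersection and
  generate the Borel sets; hence they are equal, and so are their densities. A Borel representative
  of \<open>h\<close> stands in for \<open>h\<close>, which is only Lebesgue measurable.
\<close>

lemma AE_eq_0_if_box_integrals_0:
  fixes h :: "'a::euclidean_space \<Rightarrow> real"
  assumes h: "integrable lebesgue h"
    and 0: "\<And>a b. (LINT x|lebesgue. indicator (box a b) x * h x) = 0"
  shows "AE x in lebesgue. h x = 0"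
proof -
  obtain g where g[measurable]: "g \<in> borel_measurable lborel" and hg: "AE x in lborel. h x = g x"
    using completion_ex_borel_measurable_real[OF borel_measurable_integrable[OF h]] by blast
  have hg': "AE x in lebesgue. h x = g x" by (rule AE_completion[OF hg])
  have gi: "integrable lborel g"
    using integrable_cong_AE_imp[OF h _ hg'] g by (simp add: integrable_completion measurable_completion)
  define M where "M = density lborel (\<lambda>x. ennreal (g x))"
  define N where "N = density lborel (\<lambda>x. ennreal (- g x))"
  have box: "emeasure M X = emeasure N X \<and> emeasure M X \<noteq> \<infinity>" if X: "X = box a b" for X and a b :: 'a
  proof -
    have [measurable]: "X \<in> sets borel" unfolding X by simp
    define f where "f x = indicator X x * g x" for x
    have f: "integrable lborel f" 
      using integrable_real_mult_indicator[OF _ gi, of X] by (simp add: f_def[abs_def] mult.commute)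
    have "integral\<^sup>L lborel f = integral\<^sup>L lebesgue f"
      by (rule integral_completion[symmetric]) (simp add: f_def[abs_def])
    also have "\<dots> = (LINT x|lebesgue. indicator (box a b) x * h x)"
    proof (rule integral_cong_AE)
      have "f \<in> borel_measurable borel" by (simp add: f_def[abs_def])
      then show "f \<in> borel_measurable lebesgue" by (simp add: measurable_completion)
      show "(\<lambda>x. indicator (box a b) x * h x) \<in> borel_measurable lebesgue"
        using borel_measurable_integrable[OF h] by (intro borel_measurable_times borel_measurable_indicator) auto
      show "AE x in lebesgue. f x = indicator (box a b) x * h x"
        using hg' by (rule AE_mp) (simp add: f_def X)
    qed
    finally have "integral\<^sup>L lborel f = 0" using 0 by simp
    then have eq: "enn2real (\<integral>\<^sup>+ x. ennreal (f x) \<partial>lborel) = enn2real (\<integral>\<^sup>+ x. ennreal (- f x) \<partial>lborel)"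
      unfolding real_lebesgue_integral_def[OF f] by simp
    moreover have "(\<integral>\<^sup>+ x. ennreal (f x) \<partial>lborel) \<noteq> \<infinity>" "(\<integral>\<^sup>+ x. ennreal (- f x) \<partial>lborel) \<noteq> \<infinity>"
      using f by (auto simp: real_integrable_def)
    moreover have "emeasure M X = (\<integral>\<^sup>+ x. ennreal (f x) \<partial>lborel)"
      unfolding M_def f_def by (subst emeasure_density) (auto intro!: nn_integral_cong simp: indicator_def)
    moreover have "emeasure N X = (\<integral>\<^sup>+ x. ennreal (- f x) \<partial>lborel)"
      unfolding N_def f_def by (subst emeasure_density) (auto intro!: nn_integral_cong simp: indicator_def)
    ultimately show ?thesis by (metis ennreal_enn2real_if infinity_ennreal_def)
  qed
  have "M = N"
  proof (rule measure_eqI_generator_eq[where \<Omega> = UNIV])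
    let ?E = "range (\<lambda>(a, b). box a b::'a set)"
    let ?A = "\<lambda>n::nat. box (- (real n *\<^sub>R One)) (real n *\<^sub>R One) :: 'a set"
    show "Int_stable ?E" by (auto simp: Int_stable_def box_Int_box)
    show "?E \<subseteq> Pow UNIV" by simp
    show "emeasure M X = emeasure N X" if "X \<in> ?E" for X using box that by auto
    show "sets M = sigma_sets UNIV ?E" "sets N = sigma_sets UNIV ?E"
      by (simp_all add: borel_eq_box M_def N_def)
    show "range ?A \<subseteq> ?E" "(\<Union>i. ?A i) = UNIV"
      unfolding UN_box_eq_UNIV by auto
    show "emeasure M (?A i) \<noteq> \<infinity>" for i using box by blast
  qed
  then have "AE x in lborel. ennreal (g x) = ennreal (- g x)"
    unfolding M_def N_def by (intro sigma_finite_measure.density_unique[OF sigma_finite_lborel]) auto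
  moreover have "y = 0" if "ennreal y = ennreal (- y)" for y
    using that by (cases "y \<ge> 0") (simp_all add: ennreal_neg)
  ultimately have "AE x in lborel. g x = 0" by auto
  with hg have "AE x in lborel. h x = 0" by auto
  then show ?thesis by (rule AE_completion)
qed

text \<open>
  Test functions converge boundedly to indicators of boxes, so all integrals over boxes vanish.
  Cutting \<open>h\<close> off outside a large box makes it integrable.
\<close>

lemma fundamental_lemma:
  fixes h :: "'a::euclidean_space \<Rightarrow> real"
  assumes h: "locally_integrable h"
    and 0: "\<And>\<phi>. test_function \<phi> \<Longrightarrow> (LINT x|lebesgue. h x * \<phi> x) = 0"
  shows "AE x in lebesgue. h x = 0"
proof -
  have hi: "integrable lebesgue (\<lambda>x. indicator (cbox a b) x * h x)" for a b
    using h by (auto simp: locally_integrable_def set_integrable_def)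
  note [measurable] = locally_integrable_measurable[OF h]
  have box: "(LINT x|lebesgue. indicator (box a b) x * h x) = 0" for a b
  proof -
    have "(\<lambda>n. LINT x|lebesgue. h x * box_bump a b (real (Suc n)) x) \<longlonglongrightarrow> (LINT x|lebesgue. h x * indicator (box a b) x)"
    proof (rule integral_dominated_convergence)
      show "integrable lebesgue (\<lambda>x. norm (indicator (cbox a b) x * h x))" using hi by (intro integrable_norm)
      have "box_bump a b (real (Suc n)) \<in> borel_measurable lebesgue" for n
        by (rule test_function_measurable_lebesgue[OF test_function_box_bump]) simp
      then show "(\<lambda>x. h x * box_bump a b (real (Suc n)) x) \<in> borel_measurable lebesgue" for n by measurable
      show "AE x in lebesgue. (\<lambda>n. h x * box_bump a b (real (Suc n)) x) \<longlonglongrightarrow> h x * indicator (box a b) x"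
        by (intro AE_I2 tendsto_mult tendsto_const box_bump_tendsto)
      show "AE x in lebesgue. norm (h x * box_bump a b (real (Suc n)) x) \<le> norm (indicator (cbox a b) x * h x)" for n
      proof (rule AE_I2)
        fix x
        show "norm (h x * box_bump a b (real (Suc n)) x) \<le> norm (indicator (cbox a b) x * h x)"
        proof (cases "x \<in> cbox a b")
          case True
          then show ?thesis using box_bump_bounds[of a b "real (Suc n)" x]
            by (simp add: abs_mult mult_left_le del: of_nat_Suc)
        next
          case False
          then have "x \<notin> box a b" using box_subset_cbox by blast
          then have "box_bump a b (real (Suc n)) x = 0" by (subst box_bump_eq_0_iff) auto
          then show ?thesis by simp
        qed
      qed
    qed (intro borel_measurable_times borel_measurable_indicator locally_integrable_measurable[OF h]; simp)
    moreover have "(LINT x|lebesgue. h x * box_bump a b (real (Suc n)) x) = 0" for n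
      by (rule 0[OF test_function_box_bump]) simp
    ultimately show ?thesis by (simp add: LIMSEQ_const_iff mult.commute)
  qed
  let ?A = "\<lambda>n::nat. box (- (real n *\<^sub>R One)) (real n *\<^sub>R One) :: 'a set"
  have "AE x in lebesgue. indicator (?A n) x * h x = 0" for n
  proof (rule AE_eq_0_if_box_integrals_0)
    show "integrable lebesgue (\<lambda>x. indicator (?A n) x * h x)"
    proof (rule Bochner_Integration.integrable_bound[OF hi])
      show "AE x in lebesgue. norm (indicator (?A n) x * h x) \<le> norm (indicator (cbox (- (real n *\<^sub>R One)) (real n *\<^sub>R One)) x * h x)"
        using box_subset_cbox by (intro AE_I2) (auto simp: indicator_def)
    qed (intro borel_measurable_times borel_measurable_indicator locally_integrable_measurable[OF h]; simp)
    show "(LINT x|lebesgue. indicator (box a b) x * (indicator (?A n) x * h x)) = 0" for a b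
    proof -
      obtain c d where cd: "box a b \<inter> ?A n = box c d" using box_Int_box by blast
      have "indicator (box a b) x * (indicator (?A n) x * h x) = indicator (box c d) x * h x" for x
        by (simp add: cd[symmetric] indicator_inter_arith mult.assoc)
      then show ?thesis by (simp only: box)
    qed
  qed
  then have AE: "AE x in lebesgue. \<forall>n. indicator (?A n) x * h x = 0" unfolding AE_all_countable by blast
  have "\<exists>n. x \<in> ?A n" for x :: 'a using UN_box_eq_UNIV by blast
  then have *: "h x = 0" if "\<forall>n. indicator (?A n) x * h x = 0" for x
    using that by (metis indicator_simps(1) mult_1)
  show ?thesis using AE by (rule AE_mp) (rule AE_I2, blast intro: *)
qed

section \<open>Weak gradients\<close>

lemma is_weak_gradientD:
  assumes "is_weak_gradient u g"
  shows "locally_integrable u" "locally_integrable g"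
    "\<And>\<phi> i. test_function \<phi> \<Longrightarrow> i \<in> Basis \<Longrightarrow>
      (LINT x|lebesgue. u x * frechet_derivative \<phi> (at x) i) = - (LINT x|lebesgue. (g x \<bullet> i) * \<phi> x)"
  using assms by (auto simp: is_weak_gradient_def)

lemma is_weak_gradient_unique:
  fixes g h :: "'a::euclidean_space \<Rightarrow> 'a"
  assumes "is_weak_gradient u g" "is_weak_gradient u h"
  shows "AE x in lebesgue. g x = h x"
proof -
  note g = is_weak_gradientD[OF assms(1)] and h = is_weak_gradientD[OF assms(2)]
  have "AE x in lebesgue. (1 *\<^sub>R g x + (-1) *\<^sub>R h x) \<bullet> i = 0" if i: "i \<in> Basis" for i
  proof (rule fundamental_lemma)
    show "locally_integrable (\<lambda>x. (1 *\<^sub>R g x + (-1) *\<^sub>R h x) \<bullet> i)"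
      by (intro locally_integrable_inner locally_integrable_lincomb g h)
    fix \<phi> :: "'a \<Rightarrow> real" assume \<phi>: "test_function \<phi>"
    have "(LINT x|lebesgue. (1 *\<^sub>R g x + (-1) *\<^sub>R h x) \<bullet> i * \<phi> x)
        = (LINT x|lebesgue. (g x \<bullet> i) * \<phi> x - (h x \<bullet> i) * \<phi> x)"
      by (simp add: inner_diff_left left_diff_distrib)
    also have "\<dots> = (LINT x|lebesgue. (g x \<bullet> i) * \<phi> x) - (LINT x|lebesgue. (h x \<bullet> i) * \<phi> x)"
      by (intro Bochner_Integration.integral_diff integrable_test_inner g h \<phi>)
    also have "\<dots> = 0" using g(3)[OF \<phi> i] h(3)[OF \<phi> i] by simp
    finally show "(LINT x|lebesgue. (1 *\<^sub>R g x + (-1) *\<^sub>R h x) \<bullet> i * \<phi> x) = 0" .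
  qed
  then have "AE x in lebesgue. \<forall>i\<in>Basis. (1 *\<^sub>R g x + (-1) *\<^sub>R h x) \<bullet> i = 0"
    by (intro AE_finite_allI) auto
  then show ?thesis
    by (rule AE_mp[OF _ AE_I2]) (simp add: inner_diff_left euclidean_eq_iff[where 'a = 'a])
qed

lemma weak_grad_AE_eq:
  assumes "is_weak_gradient u g"
  shows "AE x in lebesgue. weak_grad u x = g x"
proof (rule is_weak_gradient_unique[OF _ assms])
  show "is_weak_gradient u (weak_grad u)" unfolding weak_grad_def using someI_ex[of "is_weak_gradient u"] assms by blast
qed

lemma is_weak_gradient_lincomb:
  fixes u v :: "'a::euclidean_space \<Rightarrow> real"
  assumes "is_weak_gradient u g" "is_weak_gradient v h"
  shows "is_weak_gradient (\<lambda>x. a * u x + b * v x) (\<lambda>x. a *\<^sub>R g x + b *\<^sub>R h x)"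
proof -
  note g = is_weak_gradientD[OF assms(1)] and h = is_weak_gradientD[OF assms(2)]
  show ?thesis unfolding is_weak_gradient_def
  proof (intro conjI allI impI ballI)
    show "locally_integrable (\<lambda>x. a * u x + b * v x)"
      using locally_integrable_lincomb[OF g(1) h(1), of a b] by simp
    show "locally_integrable (\<lambda>x. a *\<^sub>R g x + b *\<^sub>R h x)"
      by (intro locally_integrable_lincomb g h)
    fix \<phi> :: "'a \<Rightarrow> real" and i :: 'a assume \<phi>: "test_function \<phi>" and i: "i \<in> Basis"
    note \<phi>i = test_function_partial[OF \<phi> i]
    have "(LINT x|lebesgue. (a * u x + b * v x) * frechet_derivative \<phi> (at x) i)
      = (LINT x|lebesgue. a * (u x * frechet_derivative \<phi> (at x) i) + b * (v x * frechet_derivative \<phi> (at x) i))"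
      by (simp add: distrib_right mult.assoc)
    also have "\<dots> = a * (LINT x|lebesgue. u x * frechet_derivative \<phi> (at x) i) + b * (LINT x|lebesgue. v x * frechet_derivative \<phi> (at x) i)"
      using integrable_test_mult[OF g(1) \<phi>i] integrable_test_mult[OF h(1) \<phi>i] by simp
    also have "\<dots> = - (a * (LINT x|lebesgue. (g x \<bullet> i) * \<phi> x) + b * (LINT x|lebesgue. (h x \<bullet> i) * \<phi> x))"
      using g(3)[OF \<phi> i] h(3)[OF \<phi> i] by simp
    also have "a * (LINT x|lebesgue. (g x \<bullet> i) * \<phi> x) + b * (LINT x|lebesgue. (h x \<bullet> i) * \<phi> x)
      = (LINT x|lebesgue. a * ((g x \<bullet> i) * \<phi> x) + b * ((h x \<bullet> i) * \<phi> x))"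
      using integrable_test_inner[OF g(2) \<phi>, of i] integrable_test_inner[OF h(2) \<phi>, of i] by simp
    also have "\<dots> = (LINT x|lebesgue. (a *\<^sub>R g x + b *\<^sub>R h x) \<bullet> i * \<phi> x)"
      by (simp add: inner_add_left distrib_right mult.assoc)
    finally show "(LINT x|lebesgue. (a * u x + b * v x) * frechet_derivative \<phi> (at x) i)
      = - (LINT x|lebesgue. (a *\<^sub>R g x + b *\<^sub>R h x) \<bullet> i * \<phi> x)" .
  qed
qed

text \<open>
  The factor \<open>s\<close> of the chain rule is moved onto the test function by substituting in both integrals
  with the inverse affine map.
\<close>

lemma is_weak_gradient_affine:
  fixes u :: "'a::euclidean_space \<Rightarrow> real"
  assumes "is_weak_gradient u g" "s \<noteq> 0"
  shows "is_weak_gradient (\<lambda>x. u (a + s *\<^sub>R x)) (\<lambda>x. s *\<^sub>R g (a + s *\<^sub>R x))"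
proof -
  note g = is_weak_gradientD[OF assms(1)]
  show ?thesis unfolding is_weak_gradient_def
  proof (intro conjI allI impI ballI)
    show "locally_integrable (\<lambda>x. u (a + s *\<^sub>R x))"
      by (intro locally_integrable_affine g assms)
    show "locally_integrable (\<lambda>x. s *\<^sub>R g (a + s *\<^sub>R x))"
      using locally_integrable_lincomb[OF locally_integrable_affine[OF g(2) assms(2)] locally_integrable_affine[OF g(2) assms(2)], of s a 0 a]
      by simp
    fix \<phi> :: "'a \<Rightarrow> real" and i :: 'a assume \<phi>: "test_function \<phi>" and i: "i \<in> Basis"
    define b where "b = - (1 / s) *\<^sub>R a"
    define t where "t = 1 / s"
    have t: "t \<noteq> 0" and inv: "b + t *\<^sub>R (a + s *\<^sub>R x) = x" for x
      using assms(2) by (auto simp: b_def t_def algebra_simps)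
    define \<psi> where "\<psi> x = \<phi> (b + t *\<^sub>R x)" for x
    have \<psi>: "test_function \<psi>" unfolding \<psi>_def[abs_def] by (rule test_function_affine[OF \<phi> t])
    have d\<psi>: "frechet_derivative \<psi> (at x) i = t * frechet_derivative \<phi> (at (b + t *\<^sub>R x)) i" for x
    proof -
      have "frechet_derivative \<psi> (at x) = (\<lambda>y. frechet_derivative \<phi> (at (b + t *\<^sub>R x)) (t *\<^sub>R y))"
        unfolding \<psi>_def[abs_def]
        by (intro frechet_derivativeI has_derivative_affine test_function_has_derivative \<phi>)
      then show ?thesis
        using has_derivative_linear[OF test_function_has_derivative[OF \<phi>, of "b + t *\<^sub>R x"]] by (simp add: linear_scale)
    qed
    have "(LINT x|lebesgue. u (a + s *\<^sub>R x) * frechet_derivative \<phi> (at x) i)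
      = (LINT x|lebesgue. s * (\<lambda>y. u y * frechet_derivative \<psi> (at y) i) (a + s *\<^sub>R x))"
      using assms(2) by (simp add: d\<psi> inv) (simp add: t_def)
    also have "\<dots> = s * ((LINT y|lebesgue. u y * frechet_derivative \<psi> (at y) i) /\<^sub>R \<bar>s\<bar> ^ DIM('a))"
      using integral_affine[OF assms(2) borel_measurable_integrable[OF integrable_test_mult[OF g(1) test_function_partial[OF \<psi> i]]], of a]
      by simp
    also have "\<dots> = - (s * ((LINT y|lebesgue. (g y \<bullet> i) * \<psi> y) /\<^sub>R \<bar>s\<bar> ^ DIM('a)))"
      by (simp add: g(3)[OF \<psi> i])
    also have "\<dots> = - (LINT x|lebesgue. s * (\<lambda>y. (g y \<bullet> i) * \<psi> y) (a + s *\<^sub>R x))"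
      using integral_affine[OF assms(2) borel_measurable_integrable[OF integrable_test_inner[OF g(2) \<psi>, of i]], of a]
      by simp
    finally show "(LINT x|lebesgue. u (a + s *\<^sub>R x) * frechet_derivative \<phi> (at x) i)
      = - (LINT x|lebesgue. (s *\<^sub>R g (a + s *\<^sub>R x)) \<bullet> i * \<phi> x)"
      by (simp add: \<psi>_def inv mult.assoc)
  qed
qed

section \<open>Lebesgue spaces\<close>

text \<open>
  The \<open>p\<close>-th power of the norm: an integral, so that energies can be added and compared without
  taking roots.
\<close>

definition Lp_power :: "real \<Rightarrow> ('a::euclidean_space \<Rightarrow> 'b::euclidean_space) \<Rightarrow> real" where
  "Lp_power p f = (LINT x|lebesgue. norm (f x) powr p)"

lemma Lp_power_nonneg: "Lp_power p f \<ge> 0"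
  by (simp add: Lp_power_def)

lemma Lp_norm_nonneg: "Lp_norm p f \<ge> 0"
  by (simp add: Lp_norm_def)

lemma Lp_norm_eq: "Lp_norm p f = Lp_power p f powr (1 / p)"
  by (simp add: Lp_norm_def Lp_power_def)

lemma Lp_norm_powr: "p > 0 \<Longrightarrow> Lp_norm p f powr p = Lp_power p f"
  by (simp add: Lp_norm_eq powr_powr Lp_power_nonneg)

lemma Lp_measurable: "f \<in> Lp p \<Longrightarrow> f \<in> borel_measurable lebesgue"
  by (simp add: Lp_def)

lemma Lp_integrable: "f \<in> Lp p \<Longrightarrow> integrable lebesgue (\<lambda>x. norm (f x) powr p)"
  by (simp add: Lp_def)

lemma Lp_cong_AE:
  assumes "f \<in> Lp p" "g \<in> borel_measurable lebesgue" "AE x in lebesgue. g x = f x"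
  shows "g \<in> Lp p" "Lp_power p g = Lp_power p f"
proof -
  have [measurable]: "f \<in> borel_measurable lebesgue" "g \<in> borel_measurable lebesgue"
    using assms by (auto simp: Lp_def)
  have AE: "AE x in lebesgue. norm (f x) powr p = norm (g x) powr p" using assms(3) by (rule AE_mp) simp
  have "integrable lebesgue (\<lambda>x. norm (g x) powr p)"
    by (rule integrable_cong_AE_imp[OF Lp_integrable[OF assms(1)] _ AE]) measurable
  then show "g \<in> Lp p" by (simp add: Lp_def)
  show "Lp_power p g = Lp_power p f"
    unfolding Lp_power_def by (rule integral_cong_AE) (use AE in auto)
qed

lemma powr_add_le: 
  assumes "(x::real) \<ge> 0" "y \<ge> 0" "p \<ge> 0"
  shows "(x + y) powr p \<le> 2 powr p * (x powr p + y powr p)"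
proof -
  have "(x + y) powr p \<le> (2 * max x y) powr p" by (intro powr_mono2) (use assms in auto)
  also have "\<dots> = 2 powr p * max x y powr p" using assms by (simp add: powr_mult)
  also have "\<dots> \<le> 2 powr p * (x powr p + y powr p)"
    by (intro mult_left_mono) (auto simp: max_def)
  finally show ?thesis .
qed

lemma Lp_scale:
  assumes "f \<in> Lp p"
  shows "(\<lambda>x. c *\<^sub>R f x) \<in> Lp p" "Lp_power p (\<lambda>x. c *\<^sub>R f x) = \<bar>c\<bar> powr p * Lp_power p f"
  using assms by (auto simp: Lp_def Lp_power_def powr_mult)

lemma Lp_add:
  fixes f g :: "'a::euclidean_space \<Rightarrow> 'b::euclidean_space"
  assumes "f \<in> Lp p" "g \<in> Lp p" "p \<ge> 0"
  shows "(\<lambda>x. f x + g x) \<in> Lp p"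
    "Lp_power p (\<lambda>x. f x + g x) \<le> 2 powr p * (Lp_power p f + Lp_power p g)"
proof -
  have [measurable]: "f \<in> borel_measurable lebesgue" "g \<in> borel_measurable lebesgue"
    using assms by (auto simp: Lp_def)
  have le: "norm (f x + g x) powr p \<le> 2 powr p * (norm (f x) powr p + norm (g x) powr p)" for x
    by (rule order_trans[OF powr_mono2[OF assms(3) _ norm_triangle_ineq] powr_add_le]) (use assms in auto)
  have j: "integrable lebesgue (\<lambda>x. 2 powr p * (norm (f x) powr p + norm (g x) powr p))"
    by (intro integrable_mult_right Bochner_Integration.integrable_add Lp_integrable assms)
  have i: "integrable lebesgue (\<lambda>x. norm (f x + g x) powr p)"
    by (rule Bochner_Integration.integrable_bound[OF j]) (use le in \<open>auto simp: abs_of_nonneg\<close>)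
  then show "(\<lambda>x. f x + g x) \<in> Lp p" by (simp add: Lp_def)
  have "Lp_power p (\<lambda>x. f x + g x) \<le> (LINT x|lebesgue. 2 powr p * (norm (f x) powr p + norm (g x) powr p))"
    unfolding Lp_power_def by (intro integral_mono i j le)
  also have "\<dots> = 2 powr p * (Lp_power p f + Lp_power p g)"
    using Lp_integrable[OF assms(1)] Lp_integrable[OF assms(2)] by (simp add: Lp_power_def)
  finally show "Lp_power p (\<lambda>x. f x + g x) \<le> 2 powr p * (Lp_power p f + Lp_power p g)" .
qed

lemma Lp_lincomb:
  fixes f g :: "'a::euclidean_space \<Rightarrow> 'b::euclidean_space"
  assumes "f \<in> Lp p" "g \<in> Lp p" "p \<ge> 0"
  shows "(\<lambda>x. a *\<^sub>R f x + b *\<^sub>R g x) \<in> Lp p"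
  by (intro Lp_add Lp_scale assms)

lemma Lp_diff:
  fixes f g :: "'a::euclidean_space \<Rightarrow> 'b::euclidean_space"
  assumes "f \<in> Lp p" "g \<in> Lp p" "p \<ge> 0"
  shows "(\<lambda>x. f x - g x) \<in> Lp p"
  using Lp_lincomb[OF assms, of 1 "-1"] by simp

lemma Lp_affine:
  fixes f :: "'a::euclidean_space \<Rightarrow> 'b::euclidean_space"
  assumes "f \<in> Lp p" "s \<noteq> 0"
  shows "(\<lambda>x. f (a + s *\<^sub>R x)) \<in> Lp p"
    "Lp_power p (\<lambda>x. f (a + s *\<^sub>R x)) = Lp_power p f / \<bar>s\<bar> ^ DIM('a)"
proof -
  have [measurable]: "f \<in> borel_measurable lebesgue" using assms by (auto simp: Lp_def)
  have m: "(\<lambda>x. norm (f x) powr p) \<in> borel_measurable lebesgue" by measurable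
  show "(\<lambda>x. f (a + s *\<^sub>R x)) \<in> Lp p"
    using integrable_affine_iff[OF assms(2) m, of a] borel_measurable_affine[OF assms(2) Lp_measurable[OF assms(1)]] assms(1)
    by (simp add: Lp_def)
  show "Lp_power p (\<lambda>x. f (a + s *\<^sub>R x)) = Lp_power p f / \<bar>s\<bar> ^ DIM('a)"
    using integral_affine[OF assms(2) m, of a] by (simp add: Lp_power_def divide_inverse mult.commute)
qed

text \<open>
  A weak form of Young's inequality in which the small constant is free: either \<open>t \<le> \<eta>\<close>, or
  \<open>t = t powr (1 - p) * t powr p\<close> and the first factor is at most \<open>\<eta> powr (1 - p)\<close>.
\<close>

lemma le_eta_powr:
  assumes "(t::real) \<ge> 0" "\<eta> > 0" "p \<ge> 1"
  shows "t \<le> \<eta> + \<eta> powr (1 - p) * t powr p"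
proof (cases "t \<le> \<eta>")
  case False
  have "t = t powr (1 - p) * t powr p" using False assms by (simp flip: powr_add)
  also have "\<dots> \<le> \<eta> powr (1 - p) * t powr p"
    by (intro mult_right_mono powr_mono2') (use False assms in auto)
  finally show ?thesis using assms by simp
qed (use assms in \<open>auto intro: add_increasing2\<close>)

lemma Lp_locally_integrable:
  fixes f :: "'a::euclidean_space \<Rightarrow> 'b::euclidean_space"
  assumes "f \<in> Lp p" "p \<ge> 1"
  shows "locally_integrable f"
  unfolding locally_integrable_def set_integrable_def
proof (intro allI impI)
  fix K :: "'a set" assume K: "compact K"
  have [measurable]: "f \<in> borel_measurable lebesgue" "K \<in> sets lebesgue"
    using assms K by (auto simp: Lp_def lmeasurable_compact fmeasurableD)
  have "integrable lebesgue (indicator K :: 'a \<Rightarrow> real)"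
    using lmeasurable_compact[OF K] by (simp add: lmeasurable_iff_integrable)
  then have i: "integrable lebesgue (\<lambda>x. indicator K x + norm (f x) powr p)"
    by (intro Bochner_Integration.integrable_add Lp_integrable assms)
  show "integrable lebesgue (\<lambda>x. indicat_real K x *\<^sub>R f x)"
  proof (rule Bochner_Integration.integrable_bound[OF i])
    show "AE x in lebesgue. norm (indicat_real K x *\<^sub>R f x) \<le> norm (indicat_real K x + norm (f x) powr p)"
      using le_eta_powr[of "norm (f _)" 1 p] assms(2) by (intro AE_I2) (auto simp: indicator_def)
  qed (intro borel_measurable_scaleR borel_measurable_indicator; measurable)
qed

text \<open>
  Hoelder's inequality against a bounded integrable function, with a constant that is not sharp but
  linear in the common bound \<open>B\<close> of \<open>sup |\<phi>|\<close> and \<open>\<integral> |\<phi>|\<close>. The choice \<open>\<eta> = \<parallel>f\<parallel>\<close> in \<open>le_eta_powr\<close> balances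
  both terms; if the norm vanishes, let \<open>\<eta>\<close> tend to 0.
\<close>

lemma Hoelder_bounded:
  fixes f :: "'a::euclidean_space \<Rightarrow> 'b::euclidean_space"
  assumes f: "f \<in> Lp p" and p: "p \<ge> 1"
    and \<phi>: "integrable lebesgue \<phi>" "\<And>x. \<bar>\<phi> x\<bar> \<le> B" "(LINT x|lebesgue. \<bar>\<phi> x\<bar>) \<le> B"
  shows "integrable lebesgue (\<lambda>x. norm (f x) * \<bar>\<phi> x\<bar>)"
    and "(LINT x|lebesgue. norm (f x) * \<bar>\<phi> x\<bar>) \<le> 2 * B * Lp_norm p f"
proof -
  have [measurable]: "f \<in> borel_measurable lebesgue" "\<phi> \<in> borel_measurable lebesgue"
    using f \<phi> by (auto simp: Lp_def)
  have B: "B \<ge> 0" using \<phi>(2)[of undefined] by linarith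
  have le: "norm (f x) * \<bar>\<phi> x\<bar> \<le> \<eta> * \<bar>\<phi> x\<bar> + \<eta> powr (1 - p) * B * norm (f x) powr p" if "\<eta> > 0" for \<eta> x
  proof -
    have "norm (f x) * \<bar>\<phi> x\<bar> \<le> (\<eta> + \<eta> powr (1 - p) * norm (f x) powr p) * \<bar>\<phi> x\<bar>"
      by (intro mult_right_mono le_eta_powr) (use that p in auto)
    also have "\<dots> \<le> \<eta> * \<bar>\<phi> x\<bar> + \<eta> powr (1 - p) * norm (f x) powr p * B"
      using \<phi>(2)[of x] by (simp add: distrib_right mult_left_mono)
    finally show ?thesis by (simp add: mult_ac)
  qed
  have j: "integrable lebesgue (\<lambda>x. \<eta> * \<bar>\<phi> x\<bar> + \<eta> powr (1 - p) * B * norm (f x) powr p)" for \<eta>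
    by (intro Bochner_Integration.integrable_add integrable_mult_right integrable_abs \<phi> Lp_integrable f)
  show i: "integrable lebesgue (\<lambda>x. norm (f x) * \<bar>\<phi> x\<bar>)"
    by (rule Bochner_Integration.integrable_bound[OF j[of 1]]) (use le[of 1] B in \<open>auto simp: abs_of_nonneg\<close>)
  define I where "I = Lp_power p f"
  have bound: "(LINT x|lebesgue. norm (f x) * \<bar>\<phi> x\<bar>) \<le> B * (\<eta> + \<eta> powr (1 - p) * I)" if "\<eta> > 0" for \<eta>
  proof -
    have "(LINT x|lebesgue. norm (f x) * \<bar>\<phi> x\<bar>) \<le> (LINT x|lebesgue. \<eta> * \<bar>\<phi> x\<bar> + \<eta> powr (1 - p) * B * norm (f x) powr p)"
      by (intro integral_mono i j le that)
    also have "\<dots> = \<eta> * (LINT x|lebesgue. \<bar>\<phi> x\<bar>) + \<eta> powr (1 - p) * B * I"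
      unfolding I_def Lp_power_def using Lp_integrable[OF f] \<phi>(1) by (subst Bochner_Integration.integral_add) auto
    also have "\<dots> \<le> \<eta> * B + \<eta> powr (1 - p) * B * I" using \<phi>(3) that by (intro add_mono mult_left_mono) (auto simp: B)
    finally show ?thesis by (simp add: algebra_simps)
  qed
  show "(LINT x|lebesgue. norm (f x) * \<bar>\<phi> x\<bar>) \<le> 2 * B * Lp_norm p f"
  proof (cases "I = 0")
    case True
    have "(LINT x|lebesgue. norm (f x) * \<bar>\<phi> x\<bar>) \<le> 0 + e" if "e > 0" for e
    proof -
      have "(LINT x|lebesgue. norm (f x) * \<bar>\<phi> x\<bar>) \<le> B * (e / (B + 1))"
        using bound[of "e / (B + 1)"] True that B by simp
      also have "\<dots> \<le> e" using B that by (simp add: field_simps)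
      finally show ?thesis by simp
    qed
    then have "(LINT x|lebesgue. norm (f x) * \<bar>\<phi> x\<bar>) \<le> 0" by (rule field_le_epsilon)
    then show ?thesis using B Lp_norm_nonneg[of p f] by (meson mult_nonneg_nonneg order_trans zero_le_numeral)
  next
    case False
    then have I: "I > 0" using Lp_power_nonneg[of p f] by (simp add: I_def)
    have n: "Lp_norm p f = I powr (1 / p)" by (simp add: Lp_norm_eq I_def)
    have "(I powr (1 / p)) powr (1 - p) * I = I powr ((1 / p) * (1 - p) + 1)"
      using I by (simp only: powr_powr powr_add powr_one)
    also have "(1 / p) * (1 - p) + 1 = 1 / p" using p by (simp add: field_simps)
    finally show ?thesis using bound[of "I powr (1 / p)"] I by (simp add: n algebra_simps)
  qed
qed

section \<open>The triangle inequality\<close>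

text \<open>
  Convexity of the power function at \<open>x + y = (1 - l) (x / (1 - l)) + l (y / l)\<close> with
  \<open>l = G / (F + G)\<close>. These weights are optimal if \<open>F\<close> and \<open>G\<close> are the sizes of \<open>x\<close> and \<open>y\<close>.
\<close>

lemma powr_add_convex:
  fixes x y :: real
  assumes "x \<ge> 0" "y \<ge> 0" "p \<ge> 1" "F > 0" "G > 0"
  shows "(x + y) powr p \<le> ((F + G) / F) powr (p - 1) * x powr p + ((F + G) / G) powr (p - 1) * y powr p"
proof -
  have F: "((F + G) / F) powr (p - 1) \<ge> 1" and G: "((F + G) / G) powr (p - 1) \<ge> 1"
    using assms by (auto intro!: ge_one_powr_ge_zero)
  consider "x = 0" | "y = 0" | "x > 0" "y > 0" using assms by linarith
  then show ?thesis
  proof cases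
    case 1 
    then show ?thesis using mult_right_mono[OF G, of "y powr p"] assms(3) by simp
  next
    case 2
    then show ?thesis using mult_right_mono[OF F, of "x powr p"] assms(3) by simp
  next
    case 3
    define l where "l = G / (F + G)"
    have l: "l > 0" "1 - l > 0" "1 - l = F / (F + G)" using assms by (auto simp: l_def field_simps)
    have e: "(1 - l) * (x / (1 - l)) = x" "l * (y / l) = y" using l by auto
    have "((1 - l) * (x / (1 - l)) + l * (y / l)) powr p
        \<le> (1 - l) * (x / (1 - l)) powr p + l * (y / l) powr p"
    proof -
      have "0 \<le> l" "l \<le> 1" "x / (1 - l) \<in> {0<..}" "y / l \<in> {0<..}" using l(1,2) 3 by auto
      from convex_onD[OF powr_convex[OF assms(3)] this] show ?thesis unfolding real_scaleR_def .
    qed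
    moreover have *: "t * (z / t) powr p = (1 / t) powr (p - 1) * z powr p" if "t > 0" "z > 0" for t z :: real
      using that by (simp add: powr_divide powr_diff)
    have "(1 - l) * (x / (1 - l)) powr p = ((F + G) / F) powr (p - 1) * x powr p"
      using *[OF l(2) 3(1)] l(3) by simp
    moreover have "l * (y / l) powr p = ((F + G) / G) powr (p - 1) * y powr p"
      using *[OF l(1) 3(2)] by (simp add: l_def)
    ultimately show ?thesis unfolding e by simp
  qed
qed

text \<open>
  Integrating \<open>powr_add_convex\<close> with \<open>F\<close> and \<open>G\<close> slightly larger than the two norms gives the bound
  \<open>(F + G) powr p\<close>; the strict inequalities keep the denominators positive.
\<close>

lemma Lp_norm_triangle:
  fixes f g :: "'a::euclidean_space \<Rightarrow> 'b::euclidean_space"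
  assumes f: "f \<in> Lp p" and g: "g \<in> Lp p" and p: "p \<ge> 1"
  shows "Lp_norm p (\<lambda>x. f x + g x) \<le> Lp_norm p f + Lp_norm p g"
proof -
  have *: "Lp_norm p (\<lambda>x. f x + g x) \<le> F + G" if F: "F > Lp_norm p f" and G: "G > Lp_norm p g" for F G
  proof -
    have FG: "F > 0" "G > 0" using Lp_norm_nonneg[of p f] Lp_norm_nonneg[of p g] F G by linarith+
    define a b where "a = ((F + G) / F) powr (p - 1)" and "b = ((F + G) / G) powr (p - 1)"
    have le: "norm (f x + g x) powr p \<le> a * norm (f x) powr p + b * norm (g x) powr p" for x
      unfolding a_def b_def using p FG
      by (intro order_trans[OF powr_mono2[OF _ _ norm_triangle_ineq] powr_add_convex]) auto
    have j: "integrable lebesgue (\<lambda>x. a * norm (f x) powr p + b * norm (g x) powr p)"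
      by (intro integrable_mult_right Bochner_Integration.integrable_add Lp_integrable f g)
    have "Lp_power p (\<lambda>x. f x + g x) \<le> (LINT x|lebesgue. a * norm (f x) powr p + b * norm (g x) powr p)"
      unfolding Lp_power_def by (intro integral_mono j le Lp_integrable Lp_add f g) (use p in auto)
    also have "\<dots> = a * Lp_power p f + b * Lp_power p g"
      using Lp_integrable[OF f] Lp_integrable[OF g] by (simp add: Lp_power_def)
    also have "\<dots> \<le> a * F powr p + b * G powr p"
      using p F G Lp_norm_nonneg[of p f] Lp_norm_nonneg[of p g]
      by (intro add_mono mult_left_mono) (auto simp: a_def b_def simp flip: Lp_norm_powr intro!: powr_mono2)
    also have "\<dots> = (F + G) powr (p - 1) * (F powr p / F powr (p - 1) + G powr p / G powr (p - 1))"
      using FG by (simp add: a_def b_def powr_divide field_simps)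
    also have "F powr p / F powr (p - 1) + G powr p / G powr (p - 1) = F + G"
      using FG by (simp flip: powr_diff)
    also have "(F + G) powr (p - 1) * (F + G) = (F + G) powr p"
      using FG by (simp add: powr_diff)
    finally have "Lp_power p (\<lambda>x. f x + g x) powr (1 / p) \<le> ((F + G) powr p) powr (1 / p)"
      using p Lp_power_nonneg by (intro powr_mono2) auto
    then show ?thesis using p FG by (simp add: Lp_norm_eq powr_powr)
  qed
  show ?thesis
  proof (rule field_le_epsilon)
    fix e :: real assume "e > 0"
    then show "Lp_norm p (\<lambda>x. f x + g x) \<le> Lp_norm p f + Lp_norm p g + e"
      using *[of "Lp_norm p f + e / 2" "Lp_norm p g + e / 2"] by simp
  qed
qed

lemma Lp_power_tendsto:
  fixes f :: "nat \<Rightarrow> 'a::euclidean_space \<Rightarrow> 'b::euclidean_space"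
  assumes f: "\<And>n. f n \<in> Lp p" and g: "g \<in> Lp p" and p: "p \<ge> 1"
    and lim: "(\<lambda>n. Lp_power p (\<lambda>x. f n x - g x)) \<longlonglongrightarrow> 0"
  shows "(\<lambda>n. Lp_power p (f n)) \<longlonglongrightarrow> Lp_power p g"
proof -
  have d: "(\<lambda>x. f n x - g x) \<in> Lp p" for n using p by (intro Lp_diff f g) auto
  have "((\<lambda>n. Lp_norm p (\<lambda>x. f n x - g x)) \<longlongrightarrow> 0 powr (1 / p)) sequentially"
    unfolding Lp_norm_eq using p Lp_power_nonneg by (intro tendsto_powr' lim tendsto_const) (auto intro!: always_eventually Lp_power_nonneg)
  then have n0: "(\<lambda>n. Lp_norm p (\<lambda>x. f n x - g x)) \<longlonglongrightarrow> 0" by simp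
  have "\<bar>Lp_norm p (f n) - Lp_norm p g\<bar> \<le> Lp_norm p (\<lambda>x. f n x - g x)" for n
  proof -
    have 1: "Lp_norm p (f n) \<le> Lp_norm p g + Lp_norm p (\<lambda>x. f n x - g x)"
      using Lp_norm_triangle[OF g d[of n] p] by simp
    have "Lp_norm p (\<lambda>x. - (f n x - g x)) = Lp_norm p (\<lambda>x. f n x - g x)"
      unfolding Lp_norm_def by (simp add: norm_minus_commute)
    then have 2: "Lp_norm p g \<le> Lp_norm p (f n) + Lp_norm p (\<lambda>x. f n x - g x)"
      using Lp_norm_triangle[OF f[of n] Lp_scale(1)[OF d[of n], of "-1"] p] by simp
    from 1 2 show ?thesis by linarith
  qed
  then have "(\<lambda>n. Lp_norm p (f n) - Lp_norm p g) \<longlonglongrightarrow> 0"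
    by (intro Lim_null_comparison[OF _ n0] always_eventually) auto
  then have "(\<lambda>n. Lp_norm p (f n)) \<longlonglongrightarrow> Lp_norm p g" by (simp add: LIM_zero_iff)
  then have "((\<lambda>n. Lp_norm p (f n) powr p) \<longlongrightarrow> Lp_norm p g powr p) sequentially"
    using p Lp_norm_nonneg by (intro tendsto_powr' tendsto_const) (auto intro!: always_eventually Lp_norm_nonneg)
  then show ?thesis using p by (simp add: Lp_norm_powr)
qed

section \<open>Uniform convexity\<close>

text \<open>
  With the midpoint \<open>m\<close> fixed, \<open>t powr p + (2 m - t) powr p\<close> is strictly increasing in \<open>t \<ge> m\<close>.
\<close>

lemma powr_midpoint_less:
  fixes x y :: real
  assumes "0 \<le> y" "y < x" "p > 1"
  shows "((x + y) / 2) powr p < (x powr p + y powr p) / 2"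
proof -
  define m where "m = (x + y) / 2"
  have m: "m > 0" "m < x" "2 * m - x = y" using assms by (auto simp: m_def field_simps)
  define h where "h t = t powr p + (2 * m - t) powr p" for t
  have "h m < h x"
  proof (rule DERIV_pos_imp_increasing_open[OF m(2)])
    fix t assume t: "m < t" "t < x"
    then have t0: "t > 0" "2 * m - t > 0" "2 * m - t < t" using m assms by auto
    have "(h has_real_derivative p * t powr (p - 1) - p * (2 * m - t) powr (p - 1)) (at t)"
      unfolding h_def using t0 by (auto intro!: derivative_eq_intros)
    moreover have "p * (2 * m - t) powr (p - 1) < p * t powr (p - 1)"
      using t0 assms(3) by (intro mult_strict_left_mono powr_less_mono2) auto
    ultimately show "\<exists>y. (h has_real_derivative y) (at t) \<and> 0 < y" by (intro exI conjI) auto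
  next
    show "continuous_on {m..x} h" unfolding h_def
      using m assms by (intro continuous_intros continuous_on_powr') auto
  qed
  moreover have "h m = 2 * m powr p" "h x = x powr p + y powr p" by (simp_all add: h_def m)
  ultimately show ?thesis by (simp add: m_def)
qed

lemma powr_midpoint_le:
  fixes x y :: real
  assumes "0 \<le> x" "0 \<le> y" "p > 1"
  shows "((x + y) / 2) powr p \<le> (x powr p + y powr p) / 2"
  using powr_midpoint_less[of y x p] powr_midpoint_less[of x y p] assms
  by (cases x y rule: linorder_cases) (auto simp: add.commute)

definition midpoint_defect :: "real \<Rightarrow> 'b::real_inner \<Rightarrow> 'b \<Rightarrow> real" where
  "midpoint_defect p a b = (norm a powr p + norm b powr p) / 2 - norm ((1/2) *\<^sub>R (a + b)) powr p"

lemma midpoint_norm_le: "norm ((1/2) *\<^sub>R (a + b)) \<le> (norm a + norm b) / 2"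
  using norm_triangle_ineq[of a b] by simp

lemma midpoint_defect_nonneg: "p > 1 \<Longrightarrow> midpoint_defect p a b \<ge> 0"
  unfolding midpoint_defect_def
  using order_trans[OF powr_mono2[OF _ _ midpoint_norm_le, of p a b] powr_midpoint_le[of "norm a" "norm b" p]]
  by simp

text \<open>
  Equality forces equal norms by strict convexity of the power function, and then equality in the
  triangle inequality, hence equal directions.
\<close>

lemma midpoint_defect_eq_0:
  fixes a b :: "'b::real_inner"
  assumes "midpoint_defect p a b = 0" "p > 1"
  shows "a = b"
proof -
  have le: "norm ((1/2) *\<^sub>R (a + b)) powr p \<le> ((norm a + norm b) / 2) powr p"
    by (rule powr_mono2) (use midpoint_norm_le[of a b] assms in auto)
  have eq: "norm a = norm b"
  proof (rule ccontr)
    assume "norm a \<noteq> norm b"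
    then have "((norm a + norm b) / 2) powr p < (norm a powr p + norm b powr p) / 2"
      using powr_midpoint_less[of "norm a" "norm b" p] powr_midpoint_less[of "norm b" "norm a" p] assms(2)
      by (cases "norm a" "norm b" rule: linorder_cases) (auto simp: add.commute)
    with le assms(1) show False by (simp add: midpoint_defect_def)
  qed
  then have "norm ((1/2) *\<^sub>R (a + b)) powr p = norm a powr p" using assms(1) by (simp add: midpoint_defect_def)
  then have "(norm ((1/2) *\<^sub>R (a + b)) powr p) powr (1 / p) = (norm a powr p) powr (1 / p)" by simp
  then have "norm (a + b) = norm a + norm b" using assms(2) eq by (simp add: powr_powr)
  then have "norm a *\<^sub>R b = norm b *\<^sub>R a" by (simp add: norm_triangle_eq)
  then show ?thesis using eq by (cases "norm a = 0") auto
qed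

lemma midpoint_defect_scale:
  fixes a b :: "'a::real_inner"
  shows "c \<ge> 0 \<Longrightarrow> midpoint_defect p (c *\<^sub>R a) (c *\<^sub>R b) = c powr p * midpoint_defect p a b"
proof -
  assume c: "c \<ge> 0"
  have "norm ((1/2) *\<^sub>R (c *\<^sub>R a + c *\<^sub>R b)) = c * norm ((1/2) *\<^sub>R (a + b))"
    using c by (simp flip: scaleR_add_right)
  then have "norm ((1/2) *\<^sub>R (c *\<^sub>R a + c *\<^sub>R b)) powr p = c powr p * norm ((1/2) *\<^sub>R (a + b)) powr p"
    using c by (simp only: powr_mult)
  moreover have "norm (c *\<^sub>R a) powr p = c powr p * norm a powr p" for a :: 'a using c by (simp add: powr_mult)
  ultimately show ?thesis unfolding midpoint_defect_def by (simp only: algebra_simps add_divide_distrib times_divide_eq_right)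
qed

text \<open>
  A pointwise form of uniform convexity that works for all \<open>p > 1\<close> alike.
  Both sides are homogeneous of degree \<open>p\<close>, so it suffices to consider pairs
  with \<open>\<parallel>a\<parallel>^p + \<parallel>b\<parallel>^p = 1\<close>. Those with \<open>\<parallel>a - b\<parallel>^p \<ge> \<eta>\<close> form a compact set on which the defect is positive,
  hence bounded below by some \<open>\<delta>\<close>.
\<close>

lemma norm_diff_powr_le_defect:
  assumes p: "p > 1" and \<eta>: "\<eta> > 0"
  shows "\<exists>C>0. \<forall>a b::'b::euclidean_space.
    norm (a - b) powr p \<le> \<eta> * (norm a powr p + norm b powr p) + C * midpoint_defect p a b"
proof -
  define S where "S = {(a::'b, b::'b). norm a powr p + norm b powr p = 1 \<and> norm (a - b) powr p \<ge> \<eta>}"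
  have cont: "continuous_on UNIV (\<lambda>z. norm (f z) powr p)" if "continuous_on UNIV f" for f :: "'b \<times> 'b \<Rightarrow> 'b"
    using p that by (intro continuous_on_powr' continuous_intros) auto
  have S_eq: "S = {z. norm (fst z) powr p + norm (snd z) powr p = 1} \<inter> {z. norm (fst z - snd z) powr p \<ge> \<eta>}"
    by (auto simp: S_def)
  have "closed S" unfolding S_eq
    by (intro closed_Int closed_Collect_eq closed_Collect_le continuous_on_add cont continuous_intros)
  moreover have "S \<subseteq> cball 0 1 \<times> cball 0 1"
  proof
    fix z assume z: "z \<in> S"
    have "norm y \<le> 1" if "norm y powr p \<le> 1" for y :: 'b
    proof -
      have "(norm y powr p) powr (1 / p) \<le> 1 powr (1 / p)" using that p by (intro powr_mono2) auto
      then show ?thesis using p by (simp add: powr_powr)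
    qed
    moreover have "norm (fst z) powr p \<le> 1" "norm (snd z) powr p \<le> 1"
      using z powr_ge_zero[of "norm (fst z)" p] powr_ge_zero[of "norm (snd z)" p] by (auto simp: S_eq simp del: powr_ge_zero)
    ultimately show "z \<in> cball 0 1 \<times> cball 0 1" by (cases z) auto
  qed
  ultimately have "compact S"
    using bounded_subset[OF bounded_Times[OF bounded_cball bounded_cball]] compact_eq_bounded_closed by blast
  have c: "continuous_on UNIV (\<lambda>z::'b \<times> 'b. norm (fst z) powr p)" "continuous_on UNIV (\<lambda>z::'b \<times> 'b. norm (snd z) powr p)"
    "continuous_on UNIV (\<lambda>z::'b \<times> 'b. norm ((1/2) *\<^sub>R (fst z + snd z)) powr p)"
    by (intro cont continuous_intros)+
  have "continuous_on UNIV (\<lambda>z::'b \<times> 'b. midpoint_defect p (fst z) (snd z))"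
    unfolding midpoint_defect_def
    by (intro continuous_on_diff continuous_on_divide continuous_on_add c continuous_on_const) simp
  then have "continuous_on S (\<lambda>z. midpoint_defect p (fst z) (snd z))"
    by (rule continuous_on_subset) simp
  obtain \<delta> where \<delta>: "\<delta> > 0" "\<And>a b. (a, b) \<in> S \<Longrightarrow> midpoint_defect p a b \<ge> \<delta>"
  proof (cases "S = {}")
    case True
    then show ?thesis using that[of 1] by simp
  next
    case False
    obtain z where z: "z \<in> S" "\<And>y. y \<in> S \<Longrightarrow> midpoint_defect p (fst z) (snd z) \<le> midpoint_defect p (fst y) (snd y)"
      using continuous_attains_inf[OF \<open>compact S\<close> False \<open>continuous_on S _\<close>] by blast
    have "fst z \<noteq> snd z" using z(1) \<eta> by (auto simp: S_eq)
    then have "midpoint_defect p (fst z) (snd z) > 0"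
      using midpoint_defect_eq_0[of p "fst z" "snd z"] midpoint_defect_nonneg[OF p, of "fst z" "snd z"] p by fastforce
    with z(2) show ?thesis using that[of "midpoint_defect p (fst z) (snd z)"] by fastforce
  qed
  have "norm (a - b) powr p \<le> \<eta> * (norm a powr p + norm b powr p) + 2 powr p / \<delta> * midpoint_defect p a b" for a b :: 'b
  proof (cases "norm (a - b) powr p \<le> \<eta> * (norm a powr p + norm b powr p)")
    case True
    then show ?thesis using \<delta>(1) midpoint_defect_nonneg[OF p, of a b]
      by (meson add_increasing2 divide_nonneg_pos mult_nonneg_nonneg powr_ge_zero)
  next
    case False
    define N where "N = norm a powr p + norm b powr p"
    have N0: "N \<ge> 0" by (simp add: N_def)
    have N: "N > 0"
    proof (rule ccontr)
      assume "\<not> N > 0"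
      then have "norm a powr p = 0" "norm b powr p = 0"
        unfolding N_def using powr_ge_zero[of "norm a" p] powr_ge_zero[of "norm b" p] by linarith+
      then show False using False by simp
    qed
    \<comment> \<open>The normalizing factor: \<open>c powr p = 1 / N\<close>.\<close>
    define c where "c = N powr (- (1 / p))"
    have "c powr p = N powr (- (1 / p) * p)" by (simp only: c_def powr_powr)
    also have "- (1 / p) * p = - 1" using p by simp
    finally have c: "c > 0" "c powr p = 1 / N" using N by (auto simp: c_def powr_minus_divide)
    have "norm (c *\<^sub>R a) powr p + norm (c *\<^sub>R b) powr p = 1"
      using c N by (simp add: powr_mult N_def flip: add_divide_distrib)
    moreover have "norm (c *\<^sub>R a - c *\<^sub>R b) powr p = norm (a - b) powr p / N"
      using c by (simp add: powr_mult flip: scaleR_diff_right)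
    moreover have "norm (a - b) powr p / N \<ge> \<eta>" using False N by (simp add: N_def field_simps)
    ultimately have "(c *\<^sub>R a, c *\<^sub>R b) \<in> S" by (simp add: S_def)
    then have "\<delta> \<le> c powr p * midpoint_defect p a b"
      using \<delta>(2) c(1) by (metis less_imp_le midpoint_defect_scale)
    then have "N \<le> midpoint_defect p a b / \<delta>" using N \<delta>(1) c by (simp add: field_simps)
    have "norm (a - b) powr p \<le> 2 powr p * N"
      unfolding N_def
      by (rule order_trans[OF powr_mono2[OF _ _ norm_triangle_ineq4] powr_add_le]) (use p in auto)
    also have "\<dots> \<le> 2 powr p * (midpoint_defect p a b / \<delta>)"
      by (intro mult_left_mono \<open>N \<le> _\<close>) auto
    finally show ?thesis using \<eta> N0 unfolding N_def by (simp add: add_increasing)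
  qed
  moreover have "2 powr p / \<delta> > 0" using \<delta> by simp
  ultimately show ?thesis by blast
qed

lemma Lp_midpoint:
  fixes f g :: "'a::euclidean_space \<Rightarrow> 'b::euclidean_space"
  assumes "f \<in> Lp p" "g \<in> Lp p" "p > 1"
  shows "integrable lebesgue (\<lambda>x. midpoint_defect p (f x) (g x))"
    "(LINT x|lebesgue. midpoint_defect p (f x) (g x)) =
      (Lp_power p f + Lp_power p g) / 2 - Lp_power p (\<lambda>x. (1/2) *\<^sub>R (f x + g x))"
    "Lp_power p (\<lambda>x. (1/2) *\<^sub>R (f x + g x)) \<le> (Lp_power p f + Lp_power p g) / 2"
proof -
  have i: "integrable lebesgue (\<lambda>x. (norm (f x) powr p + norm (g x) powr p) / 2)"
    by (intro integrable_divide Bochner_Integration.integrable_add Lp_integrable assms)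
  have j: "integrable lebesgue (\<lambda>x. norm ((1/2) *\<^sub>R (f x + g x)) powr p)"
    by (intro Lp_integrable Lp_scale Lp_add assms) (use assms in auto)
  show "integrable lebesgue (\<lambda>x. midpoint_defect p (f x) (g x))"
    unfolding midpoint_defect_def by (intro Bochner_Integration.integrable_diff i j)
  show eq: "(LINT x|lebesgue. midpoint_defect p (f x) (g x)) =
      (Lp_power p f + Lp_power p g) / 2 - Lp_power p (\<lambda>x. (1/2) *\<^sub>R (f x + g x))"
    unfolding midpoint_defect_def Bochner_Integration.integral_diff[OF i j] 
    using Lp_integrable[OF assms(1)] Lp_integrable[OF assms(2)] by (simp add: Lp_power_def del: norm_scaleR)
  have "(LINT x|lebesgue. midpoint_defect p (f x) (g x)) \<ge> 0"
    by (intro Bochner_Integration.integral_nonneg midpoint_defect_nonneg assms)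
  with eq show "Lp_power p (\<lambda>x. (1/2) *\<^sub>R (f x + g x)) \<le> (Lp_power p f + Lp_power p g) / 2" by simp
qed

lemma Lp_uniform_convexity:
  assumes p: "p > 1" and \<eta>: "\<eta> > 0"
  shows "\<exists>C>0. \<forall>f\<in>Lp p. \<forall>g\<in>Lp p. Lp_power p (\<lambda>x. f x - g x :: 'b::euclidean_space) \<le>
    \<eta> * (Lp_power p f + Lp_power p g) +
    C * ((Lp_power p f + Lp_power p g) / 2 - Lp_power p (\<lambda>x::'a::euclidean_space. (1/2) *\<^sub>R (f x + g x)))"
proof -
  obtain C where C: "C > 0" "\<And>a b::'b. norm (a - b) powr p \<le> \<eta> * (norm a powr p + norm b powr p) + C * midpoint_defect p a b"
    using norm_diff_powr_le_defect[OF p \<eta>, where 'b = 'b] by blast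
  show ?thesis
  proof (intro exI[of _ C] conjI C ballI)
    fix f g :: "'a \<Rightarrow> 'b" assume f: "f \<in> Lp p" and g: "g \<in> Lp p"
    note M = Lp_midpoint[OF f g p]
    have "Lp_power p (\<lambda>x. f x - g x) \<le>
      (LINT x|lebesgue. \<eta> * (norm (f x) powr p + norm (g x) powr p) + C * midpoint_defect p (f x) (g x))"
      unfolding Lp_power_def
      by (intro integral_mono Lp_integrable Lp_diff f g Bochner_Integration.integrable_add integrable_mult_right M C) 
        (use p in auto)
    also have "\<dots> = \<eta> * (Lp_power p f + Lp_power p g) + C * (LINT x|lebesgue. midpoint_defect p (f x) (g x))"
      using Lp_integrable[OF f] Lp_integrable[OF g] M(1) by (simp add: Lp_power_def)
    finally show "Lp_power p (\<lambda>x. f x - g x) \<le> \<eta> * (Lp_power p f + Lp_power p g) +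
        C * ((Lp_power p f + Lp_power p g) / 2 - Lp_power p (\<lambda>x. (1/2) *\<^sub>R (f x + g x)))"
      unfolding M(2) .
  qed
qed

section \<open>Completeness\<close>

text \<open>
  A subsequence is chosen so fast that the weighted sum of the \<open>p\<close>-th powers of its increments, with
  weights \<open>2 powr (j p)\<close>, is integrable. It is then finite almost everywhere, so increments decay
  geometrically and the subsequence converges pointwise. Fatou's lemma turns the Cauchy
  property into convergence to this limit.
\<close>

lemma Lp_complete:
  fixes f :: "nat \<Rightarrow> 'a::euclidean_space \<Rightarrow> 'b::euclidean_space"
  assumes f: "\<And>n. f n \<in> Lp p" and p: "p \<ge> 1"
    and Cauchy: "\<And>e. e > 0 \<Longrightarrow> \<exists>N. \<forall>m\<ge>N. \<forall>n\<ge>N. Lp_power p (\<lambda>x. f m x - f n x) < e"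
  shows "\<exists>g\<in>Lp p. (\<lambda>n. Lp_power p (\<lambda>x. f n x - g x)) \<longlonglongrightarrow> 0"
proof -
  note [measurable] = Lp_measurable[OF f]
  have d: "(\<lambda>x. f m x - f n x) \<in> Lp p" for m n using p by (intro Lp_diff f) auto
  \<comment> \<open>The second factor compensates the weight in \<open>a\<close>, the first one makes the sum finite.\<close>
  define e :: "nat \<Rightarrow> real" where "e j = (1/2) ^ j * ((1/2) ^ j) powr p" for j
  have e: "e j > 0" for j by (simp add: e_def)
  obtain N where N: "\<And>j m n. m \<ge> N j \<Longrightarrow> n \<ge> N j \<Longrightarrow> Lp_power p (\<lambda>x. f m x - f n x) < e j"
    using Cauchy[OF e] by metis
  \<comment> \<open>Adding \<open>j\<close> makes the indices tend to infinity; the sum dominates each threshold \<open>N i\<close>.\<close>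
  define k where "k j = j + (\<Sum>i\<le>j. N i)" for j
  have k: "k j \<ge> N j" "k (Suc j) \<ge> N j" "k j \<ge> j" for j
    unfolding k_def using member_le_sum[of j "{..j}" N] by auto
  define a where "a j x = (2 ^ j) powr p * norm (f (k (Suc j)) x - f (k j) x) powr p" for j x
  have a_int: "integrable lebesgue (a j)" for j
    unfolding a_def by (intro integrable_mult_right Lp_integrable d)
  have a_le: "(LINT x|lebesgue. a j x) \<le> (1/2) ^ j" for j
  proof -
    have "(LINT x|lebesgue. a j x) = (2 ^ j) powr p * Lp_power p (\<lambda>x. f (k (Suc j)) x - f (k j) x)"
      by (simp add: a_def Lp_power_def)
    also have "\<dots> \<le> (2 ^ j) powr p * e j"
      by (intro mult_left_mono less_imp_le[OF N] k) auto
    also have "\<dots> = (1/2) ^ j" by (simp add: e_def power_one_over powr_divide)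
    finally show ?thesis .
  qed
  have "(\<integral>\<^sup>+x. (\<Sum>j. ennreal (a j x)) \<partial>lebesgue) = (\<Sum>j. \<integral>\<^sup>+x. ennreal (a j x) \<partial>lebesgue)"
    by (rule nn_integral_suminf) (simp add: a_def)
  also have "\<dots> \<le> (\<Sum>j. ennreal ((1/2) ^ j))"
  proof (rule suminf_le)
    fix j
    have "(\<integral>\<^sup>+x. ennreal (a j x) \<partial>lebesgue) = ennreal (LINT x|lebesgue. a j x)"
      by (rule nn_integral_eq_integral[OF a_int]) (simp add: a_def)
    also have "\<dots> \<le> ennreal ((1/2) ^ j)" by (rule ennreal_leI[OF a_le])
    finally show "(\<integral>\<^sup>+x. ennreal (a j x) \<partial>lebesgue) \<le> ennreal ((1/2) ^ j)" .
  qed auto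
  also have "\<dots> = ennreal (\<Sum>j. (1/2) ^ j)" by (rule suminf_ennreal2) (auto intro: summable_geometric)
  finally have "(\<integral>\<^sup>+x. (\<Sum>j. ennreal (a j x)) \<partial>lebesgue) \<noteq> \<infinity>"
    by (metis ennreal_neq_top infinity_ennreal_def neq_top_trans)
  then have fin: "AE x in lebesgue. (\<Sum>j. ennreal (a j x)) \<noteq> \<infinity>"
    by (intro nn_integral_PInf_AE) (simp_all add: a_def)
  have convergent: "convergent (\<lambda>j. f (k j) x)" if fin: "(\<Sum>j. ennreal (a j x)) \<noteq> \<infinity>" for x
  proof -
    have "summable (\<lambda>j. a j x)"
      using fin by (intro summable_suminf_not_top) (auto simp: a_def)
    then obtain B where B: "\<And>j. a j x \<le> B" "B \<ge> 0"
      using summable_imp_bounded[of "\<lambda>j. a j x"] unfolding bounded_iff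
      by (metis abs_ge_self abs_ge_zero order_trans rangeI real_norm_def)
    have bound: "norm (f (k (Suc j)) x - f (k j) x) \<le> B powr (1 / p) * (1/2) ^ j" for j
    proof -
      have "(2 ^ j * norm (f (k (Suc j)) x - f (k j) x)) powr p \<le> B"
        using B(1)[of j] by (simp add: a_def powr_mult)
      then have "((2 ^ j * norm (f (k (Suc j)) x - f (k j) x)) powr p) powr (1 / p) \<le> B powr (1 / p)"
        using p by (intro powr_mono2) auto
      then have "2 ^ j * norm (f (k (Suc j)) x - f (k j) x) \<le> B powr (1 / p)" using p by (simp add: powr_powr)
      then show ?thesis by (simp add: field_simps power_one_over)
    qed
    have "summable (\<lambda>j. B powr (1 / p) * (1/2) ^ j)"
      by (rule summable_mult) (simp add: summable_geometric)
    then have "summable (\<lambda>j. f (k (Suc j)) x - f (k j) x)"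
      by (rule summable_comparison_test'[where N = 0]) (rule bound)
    then have "convergent (\<lambda>n. \<Sum>j<n. f (k (Suc j)) x - f (k j) x)"
      by (simp only: summable_iff_convergent)
    then have "convergent (\<lambda>n. f (k n) x - f (k 0) x)"
      by (simp only: sum_lessThan_telescope[of "\<lambda>j. f (k j) x"])
    then have "convergent (\<lambda>n. (f (k n) x - f (k 0) x) + f (k 0) x)"
      by (intro convergent_add convergent_const)
    then show ?thesis by simp
  qed
  have conv: "AE x in lebesgue. (\<lambda>j. f (k j) x) \<longlonglongrightarrow> lim (\<lambda>j. f (k j) x)"
    using fin by (rule AE_mp) (rule AE_I2, blast intro: convergent convergent_LIMSEQ_iff[THEN iffD1])
  define g where "g x = lim (\<lambda>j. f (k j) x)" for x
  have [measurable]: "g \<in> borel_measurable lebesgue" unfolding g_def by measurable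
  have main: "(\<lambda>x. f m x - g x) \<in> Lp p \<and> Lp_power p (\<lambda>x. f m x - g x) \<le> \<epsilon>"
    if \<epsilon>: "\<epsilon> > 0" and M: "\<And>m n. m \<ge> M \<Longrightarrow> n \<ge> M \<Longrightarrow> Lp_power p (\<lambda>x. f m x - f n x) < \<epsilon>" and m: "m \<ge> M" for m M \<epsilon>
  proof -
    have le: "(\<integral>\<^sup>+x. ennreal (norm (f m x - g x) powr p) \<partial>lebesgue) \<le> ennreal \<epsilon>"
    proof -
      have "(\<integral>\<^sup>+x. ennreal (norm (f m x - g x) powr p) \<partial>lebesgue)
        = (\<integral>\<^sup>+x. liminf (\<lambda>j. ennreal (norm (f m x - f (k j) x) powr p)) \<partial>lebesgue)"
      proof (rule nn_integral_cong_AE, use conv in \<open>rule AE_mp\<close>, rule AE_I2, rule impI)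
        fix x assume "(\<lambda>j. f (k j) x) \<longlonglongrightarrow> lim (\<lambda>j. f (k j) x)"
        then have "(\<lambda>j. f (k j) x) \<longlonglongrightarrow> g x" by (simp add: g_def)
        then have "(\<lambda>j. norm (f m x - f (k j) x) powr p) \<longlonglongrightarrow> norm (f m x - g x) powr p"
          using p by (intro tendsto_powr' tendsto_intros) auto
        then have "(\<lambda>j. ennreal (norm (f m x - f (k j) x) powr p)) \<longlonglongrightarrow> ennreal (norm (f m x - g x) powr p)"
          by (rule tendsto_ennrealI)
        then show "ennreal (norm (f m x - g x) powr p) = liminf (\<lambda>j. ennreal (norm (f m x - f (k j) x) powr p))"
          by (metis lim_imp_Liminf sequentially_bot)
      qed
      also have "\<dots> \<le> liminf (\<lambda>j. \<integral>\<^sup>+x. ennreal (norm (f m x - f (k j) x) powr p) \<partial>lebesgue)"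
        by (rule nn_integral_liminf) measurable
      also have "\<dots> \<le> limsup (\<lambda>j. \<integral>\<^sup>+x. ennreal (norm (f m x - f (k j) x) powr p) \<partial>lebesgue)"
        by (rule Liminf_le_Limsup) simp
      also have "\<dots> \<le> ennreal \<epsilon>"
      proof (rule Limsup_bounded, rule eventually_sequentiallyI)
        fix j assume "M \<le> j"
        then have "Lp_power p (\<lambda>x. f m x - f (k j) x) < \<epsilon>" using M m k(3)[of j] by simp
        then show "(\<integral>\<^sup>+x. ennreal (norm (f m x - f (k j) x) powr p) \<partial>lebesgue) \<le> ennreal \<epsilon>"
          unfolding Lp_power_def by (subst nn_integral_eq_integral[OF Lp_integrable[OF d]]) (auto intro!: ennreal_leI)
      qed
      finally show ?thesis .
    qed
    have "integrable lebesgue (\<lambda>x. norm (f m x - g x) powr p)"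
      by (rule integrableI_nonneg) (use le in \<open>auto intro: order_le_less_trans\<close>)
    then have mem: "(\<lambda>x. f m x - g x) \<in> Lp p" by (simp add: Lp_def)
    moreover have "ennreal (Lp_power p (\<lambda>x. f m x - g x)) \<le> ennreal \<epsilon>"
      using le nn_integral_eq_integral[OF Lp_integrable[OF mem]] by (simp add: Lp_power_def)
    ultimately show ?thesis using \<epsilon> mem by (simp add: ennreal_le_iff)
  qed
  obtain M where M: "\<And>m n. m \<ge> M \<Longrightarrow> n \<ge> M \<Longrightarrow> Lp_power p (\<lambda>x. f m x - f n x) < 1" using Cauchy[of 1] by auto
  have "(\<lambda>x. f M x - g x) \<in> Lp p" using main[of 1 M M] M by simp
  then have "(\<lambda>x. f M x - (f M x - g x)) \<in> Lp p" by (rule Lp_diff[OF f]) (use p in simp)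
  then have "g \<in> Lp p" by simp
  moreover have "(\<lambda>n. Lp_power p (\<lambda>x. f n x - g x)) \<longlonglongrightarrow> 0"
  proof (rule LIMSEQ_I)
    fix r :: real assume "r > 0"
    then obtain M where M: "\<And>m n. m \<ge> M \<Longrightarrow> n \<ge> M \<Longrightarrow> Lp_power p (\<lambda>x. f m x - f n x) < r / 2"
      using Cauchy[of "r / 2"] by auto
    have "norm (Lp_power p (\<lambda>x. f n x - g x) - 0) < r" if "n \<ge> M" for n
    proof -
      have "Lp_power p (\<lambda>x. f n x - g x) \<le> r / 2" using main[of "r / 2" M n] M that \<open>r > 0\<close> by simp
      then show ?thesis using Lp_power_nonneg[of p "\<lambda>x. f n x - g x"] \<open>r > 0\<close> by simp
    qed
    then show "\<exists>no. \<forall>n\<ge>no. norm (Lp_power p (\<lambda>x. f n x - g x) - 0) < r" by blast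
  qed
  ultimately show ?thesis by blast
qed

section \<open>Sobolev spaces\<close>

lemma W1pI:
  assumes "u \<in> Lp p" "g \<in> Lp p" "is_weak_gradient u g"
  shows "u \<in> W1p p" "weak_grad u \<in> Lp p" "Lp_power p (weak_grad u) = Lp_power p g" "is_weak_gradient u (weak_grad u)"
proof -
  show "u \<in> W1p p" using assms by (auto simp: W1p_def)
  show w: "is_weak_gradient u (weak_grad u)" 
    unfolding weak_grad_def using someI_ex[of "is_weak_gradient u"] assms(3) by blast
  have "weak_grad u \<in> borel_measurable lebesgue"
    by (intro locally_integrable_measurable is_weak_gradientD(2)[OF w])
  then show "weak_grad u \<in> Lp p" "Lp_power p (weak_grad u) = Lp_power p g"
    using Lp_cong_AE[OF assms(2) _ weak_grad_AE_eq[OF assms(3)]] by auto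
qed

lemma W1pD:
  assumes "u \<in> W1p p"
  shows "u \<in> Lp p" "weak_grad u \<in> Lp p" "is_weak_gradient u (weak_grad u)"
proof -
  obtain g where "u \<in> Lp p" "g \<in> Lp p" "is_weak_gradient u g" using assms by (auto simp: W1p_def)
  from this W1pI[OF this] show "u \<in> Lp p" "weak_grad u \<in> Lp p" "is_weak_gradient u (weak_grad u)" by auto
qed

text \<open>
  Both sides of the integration by parts formula are continuous in \<open>L\<^sup>p\<close> for a fixed test function.
\<close>

lemma is_weak_gradient_limit:
  fixes u :: "nat \<Rightarrow> 'a::euclidean_space \<Rightarrow> real"
  assumes w: "\<And>n. is_weak_gradient (u n) (g n)" and p: "p \<ge> 1"
    and u: "\<And>n. u n \<in> Lp p" and g: "\<And>n. g n \<in> Lp p" and u0: "u0 \<in> Lp p" and g0: "g0 \<in> Lp p"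
    and ulim: "(\<lambda>n. Lp_power p (\<lambda>x. u n x - u0 x)) \<longlonglongrightarrow> 0"
    and glim: "(\<lambda>n. Lp_power p (\<lambda>x. g n x - g0 x)) \<longlonglongrightarrow> 0"
  shows "is_weak_gradient u0 g0"
proof -
  have limit: "(\<lambda>n. LINT x|lebesgue. (f n x \<bullet> i) * \<phi> x) \<longlonglongrightarrow> (LINT x|lebesgue. (f0 x \<bullet> i) * \<phi> x)"
    if f: "\<And>n. f n \<in> Lp p" and f0: "f0 \<in> Lp p" and \<phi>: "test_function \<phi>" and i: "i \<in> Basis"
      and lim: "(\<lambda>n. Lp_power p (\<lambda>x. f n x - f0 x)) \<longlonglongrightarrow> 0"
    for f :: "nat \<Rightarrow> 'a \<Rightarrow> 'c::euclidean_space" and f0 \<phi> i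
  proof -
    obtain C where C: "\<And>x. \<bar>\<phi> x\<bar> \<le> C" using test_function_bounded[OF \<phi>] by metis
    define B where "B = max C (LINT x|lebesgue. \<bar>\<phi> x\<bar>)"
    have d: "(\<lambda>x. f n x - f0 x) \<in> Lp p" for n using p by (intro Lp_diff f f0) auto
    have B: "\<bar>\<phi> x\<bar> \<le> B" "(LINT x|lebesgue. \<bar>\<phi> x\<bar>) \<le> B" for x using C[of x] by (auto simp: B_def)
    note H = Hoelder_bounded[OF d p test_function_integrable[OF \<phi>] B]
    have "(\<lambda>n. (LINT x|lebesgue. (f n x \<bullet> i) * \<phi> x) - (LINT x|lebesgue. (f0 x \<bullet> i) * \<phi> x)) \<longlonglongrightarrow> 0"
    proof (rule Lim_null_comparison)
      show "\<forall>\<^sub>F n in sequentially. norm ((LINT x|lebesgue. (f n x \<bullet> i) * \<phi> x) - (LINT x|lebesgue. (f0 x \<bullet> i) * \<phi> x))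
          \<le> 2 * B * Lp_norm p (\<lambda>x. f n x - f0 x)"
      proof (rule always_eventually, rule allI)
        fix n
        have fi: "integrable lebesgue (\<lambda>x. (f n x \<bullet> i) * \<phi> x)" "integrable lebesgue (\<lambda>x. (f0 x \<bullet> i) * \<phi> x)"
          by (intro integrable_test_inner Lp_locally_integrable[OF _ p] f f0 \<phi>)+
        have "(LINT x|lebesgue. (f n x \<bullet> i) * \<phi> x) - (LINT x|lebesgue. (f0 x \<bullet> i) * \<phi> x)
          = (LINT x|lebesgue. (f n x \<bullet> i) * \<phi> x - (f0 x \<bullet> i) * \<phi> x)"
          by (rule Bochner_Integration.integral_diff[OF fi, symmetric])
        also have "norm \<dots> \<le> (LINT x|lebesgue. norm (f n x - f0 x) * \<bar>\<phi> x\<bar>)"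
        proof (rule Bochner_Integration.integral_norm_bound_integral)
          fix x
          have "(f n x \<bullet> i) * \<phi> x - (f0 x \<bullet> i) * \<phi> x = ((f n x - f0 x) \<bullet> i) * \<phi> x" by (simp add: inner_diff_left left_diff_distrib)
          then show "norm ((f n x \<bullet> i) * \<phi> x - (f0 x \<bullet> i) * \<phi> x) \<le> norm (f n x - f0 x) * \<bar>\<phi> x\<bar>"
            using Basis_le_norm[OF i, of "f n x - f0 x"] by (simp add: abs_mult mult_right_mono)
        qed (intro H(1) Bochner_Integration.integrable_diff fi)+
        also have "\<dots> \<le> 2 * B * Lp_norm p (\<lambda>x. f n x - f0 x)" by (rule H(2))
        finally show "norm ((LINT x|lebesgue. (f n x \<bullet> i) * \<phi> x) - (LINT x|lebesgue. (f0 x \<bullet> i) * \<phi> x)) \<le> \<dots>" .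
      qed
      have "((\<lambda>n. Lp_norm p (\<lambda>x. f n x - f0 x)) \<longlongrightarrow> 0 powr (1 / p)) sequentially"
        unfolding Lp_norm_eq using p by (intro tendsto_powr' lim tendsto_const) (auto intro!: always_eventually Lp_power_nonneg)
      then have "((\<lambda>n. 2 * B * Lp_norm p (\<lambda>x. f n x - f0 x)) \<longlongrightarrow> 2 * B * 0) sequentially"
        by (intro tendsto_mult tendsto_const) simp
      then show "(\<lambda>n. 2 * B * Lp_norm p (\<lambda>x. f n x - f0 x)) \<longlonglongrightarrow> 0" by simp
    qed
    then show ?thesis by (simp add: LIM_zero_iff)
  qed
  show ?thesis unfolding is_weak_gradient_def
  proof (intro conjI allI impI ballI)
    show "locally_integrable u0" "locally_integrable g0"
      by (rule Lp_locally_integrable[OF u0 p] Lp_locally_integrable[OF g0 p])+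
    fix \<phi> :: "'a \<Rightarrow> real" and i :: 'a assume \<phi>: "test_function \<phi>" and i: "i \<in> Basis"
    have "(\<lambda>n. LINT x|lebesgue. u n x * frechet_derivative \<phi> (at x) i) \<longlonglongrightarrow> (LINT x|lebesgue. u0 x * frechet_derivative \<phi> (at x) i)"
      using limit[OF u u0 test_function_partial[OF \<phi> i], of 1, OF _ ulim] by simp
    moreover have "(\<lambda>n. - (LINT x|lebesgue. (g n x \<bullet> i) * \<phi> x)) \<longlonglongrightarrow> - (LINT x|lebesgue. (g0 x \<bullet> i) * \<phi> x)"
      by (intro tendsto_minus limit[OF g g0 \<phi> i glim])
    ultimately show "(LINT x|lebesgue. u0 x * frechet_derivative \<phi> (at x) i) = - (LINT x|lebesgue. (g0 x \<bullet> i) * \<phi> x)"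
      using is_weak_gradientD(3)[OF w \<phi> i] by (auto intro: LIMSEQ_unique)
  qed
qed

section \<open>Test functions are Sobolev functions\<close>

lemma test_function_ball:
  assumes "test_function \<phi>"
  obtains R where "R > 0" "\<And>x. norm x > R \<Longrightarrow> \<phi> x = 0"
proof -
  obtain K where K: "compact K" "\<And>x. x \<notin> K \<Longrightarrow> \<phi> x = 0" using test_function_obtain[OF assms] by metis
  obtain R where "R > 0" "\<And>x. x \<in> K \<Longrightarrow> norm x \<le> R"
    using compact_imp_bounded[OF K(1)] by (auto simp: bounded_pos)
  then show ?thesis using that[of R] K(2) by fastforce
qed

lemma integrable_const_cball: "integrable lebesgue (\<lambda>x::'a::euclidean_space. C * indicat_real (cball 0 R) x)"
  using lmeasurable_compact[OF compact_cball[of "0::'a" R]]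
  by (intro integrable_mult_right) (simp add: lmeasurable_iff_integrable)

text \<open>
  Difference quotients have integral 0 by translation invariance and converge boundedly, with
  supports in a fixed ball.
\<close>

lemma integral_partial_derivative_eq_0:
  fixes \<zeta> :: "'a::euclidean_space \<Rightarrow> real"
  assumes \<zeta>: "test_function \<zeta>" and i: "i \<in> Basis"
  shows "(LINT x|lebesgue. frechet_derivative \<zeta> (at x) i) = 0"
proof -
  obtain R where R: "R > 0" "\<And>x. norm x > R \<Longrightarrow> \<zeta> x = 0" using test_function_ball[OF \<zeta>] by metis
  obtain L where L: "L > 0" "\<And>x y. \<bar>\<zeta> x - \<zeta> y\<bar> \<le> L * norm (x - y)" using test_function_lipschitz[OF \<zeta>] by metis
  define h where "h n = inverse (real (Suc n))" for n
  have h: "h n > 0" "h n \<le> 1" for n by (auto simp: h_def inverse_le_1_iff)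
  have h0: "h \<longlonglongrightarrow> 0" unfolding h_def by (rule LIMSEQ_inverse_real_of_nat)
  define q where "q n x = (\<zeta> (h n *\<^sub>R i + 1 *\<^sub>R x) - \<zeta> x) / h n" for n x
  have [measurable]: "\<zeta> \<in> borel_measurable lebesgue" by (rule test_function_measurable_lebesgue[OF \<zeta>])
  have "(\<lambda>n. LINT x|lebesgue. q n x) \<longlonglongrightarrow> (LINT x|lebesgue. frechet_derivative \<zeta> (at x) i)"
  proof (rule integral_dominated_convergence)
    show "integrable lebesgue (\<lambda>x. L * indicat_real (cball 0 (R + 1)) x)" by (rule integrable_const_cball)
    show "(\<lambda>x. frechet_derivative \<zeta> (at x) i) \<in> borel_measurable lebesgue"
      by (rule test_function_measurable_lebesgue[OF test_function_partial[OF \<zeta> i]])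
    show "q n \<in> borel_measurable lebesgue" for n
      unfolding q_def
      by (rule borel_measurable_divide[OF borel_measurable_diff[OF borel_measurable_affine]])
        (simp_all add: test_function_measurable_lebesgue[OF \<zeta>])
    show "AE x in lebesgue. (\<lambda>n. q n x) \<longlonglongrightarrow> frechet_derivative \<zeta> (at x) i"
    proof (rule AE_I2)
      fix x
      have "((\<lambda>t. x + t *\<^sub>R i) has_derivative (\<lambda>t. t *\<^sub>R i)) (at 0)"
        by (auto intro!: derivative_eq_intros)
      then have "((\<lambda>t. \<zeta> (x + t *\<^sub>R i)) has_derivative (\<lambda>t. frechet_derivative \<zeta> (at x) (t *\<^sub>R i))) (at 0)"
        by (rule has_derivative_compose) (simp add: test_function_has_derivative[OF \<zeta>])
      moreover have "(\<lambda>t. frechet_derivative \<zeta> (at x) (t *\<^sub>R i)) = (*) (frechet_derivative \<zeta> (at x) i)"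
        using has_derivative_linear[OF test_function_has_derivative[OF \<zeta>, of x]] by (simp add: linear_scale fun_eq_iff mult.commute)
      ultimately have "((\<lambda>t. \<zeta> (x + t *\<^sub>R i)) has_field_derivative frechet_derivative \<zeta> (at x) i) (at 0)"
        by (simp add: has_field_derivative_def)
      then have "((\<lambda>t. (\<zeta> (x + t *\<^sub>R i) - \<zeta> x) / t) \<longlongrightarrow> frechet_derivative \<zeta> (at x) i) (at 0)"
        by (simp add: has_field_derivative_iff)
      moreover have "filterlim h (at 0) sequentially"
        using h0 h(1) by (auto simp: filterlim_at intro!: always_eventually) (metis less_irrefl)
      ultimately have "((\<lambda>n. (\<zeta> (x + h n *\<^sub>R i) - \<zeta> x) / h n) \<longlongrightarrow> frechet_derivative \<zeta> (at x) i) sequentially"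
        by (rule filterlim_compose)
      then show "(\<lambda>n. q n x) \<longlonglongrightarrow> frechet_derivative \<zeta> (at x) i" by (simp add: q_def add.commute)
    qed
    show "AE x in lebesgue. norm (q n x) \<le> L * indicat_real (cball 0 (R + 1)) x" for n
    proof (rule AE_I2)
      fix x :: 'a
      show "norm (q n x) \<le> L * indicat_real (cball 0 (R + 1)) x"
      proof (cases "x \<in> cball 0 (R + 1)")
        case True
        have "\<bar>\<zeta> (h n *\<^sub>R i + 1 *\<^sub>R x) - \<zeta> x\<bar> \<le> L * h n"
          using L(2)[of "h n *\<^sub>R i + 1 *\<^sub>R x" x] h(1)[of n] i by simp
        then show ?thesis using True h(1)[of n] by (simp add: q_def field_simps)
      next
        case False
        have "norm x \<le> norm (h n *\<^sub>R i + x) + norm (h n *\<^sub>R i)"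
          using norm_triangle_ineq4[of "h n *\<^sub>R i + x" "h n *\<^sub>R i"] by simp
        also have "norm (h n *\<^sub>R i) \<le> 1" using h[of n] i by simp
        finally have "norm (h n *\<^sub>R i + x) > R" using False by (simp add: dist_norm)
        then show ?thesis using False R by (simp add: q_def dist_norm)
      qed
    qed
  qed
  moreover have "(LINT x|lebesgue. q n x) = 0" for n
  proof -
    have i: "integrable lebesgue (\<lambda>x. \<zeta> (h n *\<^sub>R i + 1 *\<^sub>R x))"
      using test_function_integrable[OF \<zeta>] by (subst integrable_affine_iff) auto
    have "(LINT x|lebesgue. \<zeta> (h n *\<^sub>R i + 1 *\<^sub>R x) - \<zeta> x) = 0"
      using integral_affine[of 1 \<zeta> "h n *\<^sub>R i"]
      by (subst Bochner_Integration.integral_diff[OF i test_function_integrable[OF \<zeta>]]) simp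
    then show ?thesis by (simp add: q_def)
  qed
  ultimately show ?thesis by (simp add: LIMSEQ_const_iff)
qed

lemma test_function_locally_integrable: "test_function \<phi> \<Longrightarrow> locally_integrable \<phi>"
  unfolding locally_integrable_def set_integrable_def
  by (auto intro!: integrable_real_mult_indicator[of _ lebesgue \<phi>, simplified mult.commute[of "indicator _ _"]]
      integrable_mult_indicator simp: lmeasurable_compact fmeasurableD test_function_integrable
      simp del: real_scaleR_def)

definition gradient :: "('a::euclidean_space \<Rightarrow> real) \<Rightarrow> 'a \<Rightarrow> 'a" where
  "gradient f x = (\<Sum>i\<in>Basis. frechet_derivative f (at x) i *\<^sub>R i)"

text \<open>
  Integration by parts is \<open>integral_partial_derivative_eq_0\<close> for the product of two test functions.
\<close>

lemma test_function_gradient: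
  fixes \<phi> :: "'a::euclidean_space \<Rightarrow> real"
  assumes \<phi>: "test_function \<phi>"
  shows "continuous_on UNIV (gradient \<phi>)" "\<exists>K. compact K \<and> (\<forall>x. x \<notin> K \<longrightarrow> gradient \<phi> x = 0)"
    "is_weak_gradient \<phi> (gradient \<phi>)"
proof -
  show cont: "continuous_on UNIV (gradient \<phi>)" unfolding gradient_def
    by (intro continuous_on_sum continuous_on_scaleR continuous_on_const test_function_continuous test_function_partial \<phi>)
  obtain K where K: "compact K" "\<And>x. x \<notin> K \<Longrightarrow> \<phi> x = 0" using test_function_obtain[OF \<phi>] by metis
  have K0: "x \<notin> K \<Longrightarrow> gradient \<phi> x = 0" for x
    using frechet_derivative_zero_outside[OF K] by (simp add: gradient_def)
  with K show "\<exists>K. compact K \<and> (\<forall>x. x \<notin> K \<longrightarrow> gradient \<phi> x = 0)" by blast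
  have li: "locally_integrable (gradient \<phi>)"
    unfolding locally_integrable_def set_integrable_def
  proof (intro allI impI)
    fix A :: "'a set" assume "compact A"
    then have "A \<in> sets lebesgue" by (simp add: lmeasurable_compact fmeasurableD)
    then show "integrable lebesgue (\<lambda>x. indicat_real A x *\<^sub>R gradient \<phi> x)"
      by (rule integrable_mult_indicator) (rule integrable_continuous_compact_support[OF cont K(1) K0])
  qed
  show "is_weak_gradient \<phi> (gradient \<phi>)"
    unfolding is_weak_gradient_def
  proof (intro conjI allI impI ballI li test_function_locally_integrable \<phi>)
    fix \<psi> :: "'a \<Rightarrow> real" and i :: 'a assume \<psi>: "test_function \<psi>" and i: "i \<in> Basis"
    have t: "test_function (\<lambda>x. \<phi> x * \<psi> x)" by (rule test_function_mult[OF \<psi> test_function_Ck[OF \<phi>]])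
    have "frechet_derivative (\<lambda>x. \<phi> x * \<psi> x) (at x) i =
        \<phi> x * frechet_derivative \<psi> (at x) i + (gradient \<phi> x \<bullet> i) * \<psi> x" for x
    proof -
      have "frechet_derivative (\<lambda>x. \<phi> x * \<psi> x) (at x) =
          (\<lambda>h. \<phi> x * frechet_derivative \<psi> (at x) h + frechet_derivative \<phi> (at x) h * \<psi> x)"
        by (intro frechet_derivativeI has_derivative_mult test_function_has_derivative \<phi> \<psi>)
      moreover have "gradient \<phi> x \<bullet> i = frechet_derivative \<phi> (at x) i"
        unfolding gradient_def using i by (rule inner_sum_left_Basis)
      ultimately show ?thesis by simp
    qed
    then have "0 = (LINT x|lebesgue. \<phi> x * frechet_derivative \<psi> (at x) i + (gradient \<phi> x \<bullet> i) * \<psi> x)"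
      using integral_partial_derivative_eq_0[OF t i] by simp
    also have "\<dots> = (LINT x|lebesgue. \<phi> x * frechet_derivative \<psi> (at x) i) + (LINT x|lebesgue. (gradient \<phi> x \<bullet> i) * \<psi> x)"
      by (intro Bochner_Integration.integral_add integrable_test_mult integrable_test_inner li 
          test_function_locally_integrable test_function_partial \<phi> \<psi> i)
    finally show "(LINT x|lebesgue. \<phi> x * frechet_derivative \<psi> (at x) i) = - (LINT x|lebesgue. (gradient \<phi> x \<bullet> i) * \<psi> x)"
      by linarith
  qed
qed

lemma continuous_compact_support_Lp:
  fixes f :: "'a::euclidean_space \<Rightarrow> 'b::euclidean_space"
  assumes f: "continuous_on UNIV f" "compact K" "\<And>x. x \<notin> K \<Longrightarrow> f x = 0" and p: "p > 0"
  shows "f \<in> Lp p"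
proof -
  have "integrable lebesgue (\<lambda>x. norm (f x) powr p)"
  proof (rule integrable_continuous_compact_support[OF _ f(2)])
    show "continuous_on UNIV (\<lambda>x. norm (f x) powr p)"
      using p f(1) by (intro continuous_on_powr' continuous_intros) auto
  qed (simp add: f(3))
  moreover have "f \<in> borel_measurable lebesgue"
    using borel_measurable_integrable[OF integrable_continuous_compact_support[OF f(1-3)]] .
  ultimately show ?thesis by (simp add: Lp_def)
qed

lemma test_function_W1p:
  assumes "test_function \<phi>" "p > 0"
  shows "\<phi> \<in> W1p p"
proof -
  obtain K where K: "compact K" "\<And>x. x \<notin> K \<Longrightarrow> \<phi> x = 0" using test_function_obtain[OF assms(1)] by metis
  obtain K' where K': "compact K'" "\<And>x. x \<notin> K' \<Longrightarrow> gradient \<phi> x = 0" using test_function_gradient(2)[OF assms(1)] by metis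
  show ?thesis
    using W1pI(1)[OF continuous_compact_support_Lp[OF test_function_continuous[OF assms(1)] K assms(2)]
        continuous_compact_support_Lp[OF test_function_gradient(1)[OF assms(1)] K' assms(2)] test_function_gradient(3)[OF assms(1)]] .
qed

lemma bump_function_exists:
  obtains \<phi> :: "'a::euclidean_space \<Rightarrow> real" where "test_function \<phi>" "\<phi> 0 > 0" "(LINT x|lebesgue. \<phi> x) = 1"
proof -
  define \<phi>0 :: "'a \<Rightarrow> real" where "\<phi>0 = box_bump (- One) One 1"
  have t: "test_function \<phi>0" unfolding \<phi>0_def by (rule test_function_box_bump) simp
  have "0 \<in> box (- One) (One :: 'a)" by (simp add: mem_box)
  then have pos: "\<phi>0 0 > 0"
    using box_bump_eq_0_iff[of 1 "- One" "One :: 'a" 0] box_bump_bounds(1)[of "- One" "One :: 'a" 1 0] by (simp add: \<phi>0_def)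
  have "(LINT x|lebesgue. \<phi>0 x) \<noteq> 0"
  proof
    assume "(LINT x|lebesgue. \<phi>0 x) = 0"
    then have "AE x in lebesgue. \<phi>0 x = 0"
      by (subst (asm) integral_nonneg_eq_0_iff_AE[OF test_function_integrable[OF t]]) (auto simp: \<phi>0_def box_bump_bounds)
    then have "AE x in lebesgue. x \<in> {x. \<phi>0 x = 0}" by simp
    moreover have "closed {x. \<phi>0 x = 0}"
      by (intro closed_Collect_eq test_function_continuous t continuous_on_const)
    ultimately have "0 \<in> {x. \<phi>0 x = 0}" using mem_closed_if_AE_lebesgue by blast
    with pos show False by simp
  qed
  moreover have "(LINT x|lebesgue. \<phi>0 x) \<ge> 0" by (intro Bochner_Integration.integral_nonneg) (simp add: \<phi>0_def box_bump_bounds)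
  ultimately have c: "(LINT x|lebesgue. \<phi>0 x) > 0" by simp
  show ?thesis
  proof
    show "test_function (\<lambda>x. (1 / (LINT x|lebesgue. \<phi>0 x)) * \<phi>0 x)" by (intro test_function_mult t Ck_const)
  qed (use c pos in auto)
qed

section \<open>Averages against a test function\<close>

text \<open>
  The parameter \<open>t\<close> is a radius: for \<open>\<integral> \<phi> = 1\<close> this is a weighted mean of \<open>u\<close> over a neighbourhood of \<open>x\<close> of
  size \<open>t\<close>.
\<close>

definition mollify :: "('a::euclidean_space \<Rightarrow> real) \<Rightarrow> ('a \<Rightarrow> real) \<Rightarrow> real \<Rightarrow> 'a \<Rightarrow> real" where
  "mollify \<phi> u t x = (LINT y|lebesgue. u (x + t *\<^sub>R y) * \<phi> y)"

text \<open>
  One constant for all the kernels to which Hoelder's inequality is applied: \<open>\<phi>\<close> itself for the size of an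
  average, \<open>norm x * \<phi> x\<close> for its radial derivative, and the increments of \<open>\<phi>\<close> for its
  dependence on the centre.
\<close>

lemma kernel_bounds:
  fixes \<phi> :: "'a::euclidean_space \<Rightarrow> real"
  assumes \<phi>: "test_function \<phi>"
  obtains B where "B > 0" "\<And>x. \<bar>\<phi> x\<bar> \<le> B" "(LINT x|lebesgue. \<bar>\<phi> x\<bar>) \<le> B"
    "\<And>x. \<bar>norm x * \<phi> x\<bar> \<le> B" "(LINT x|lebesgue. \<bar>norm x * \<phi> x\<bar>) \<le> B"
    "\<And>e x. norm e \<le> 1 \<Longrightarrow> \<bar>\<phi> (x - e) - \<phi> x\<bar> \<le> B * norm e"
    "\<And>e. norm e \<le> 1 \<Longrightarrow> (LINT x|lebesgue. \<bar>\<phi> (x - e) - \<phi> x\<bar>) \<le> B * norm e"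
proof -
  obtain R where R: "R > 0" "\<And>x. norm x > R \<Longrightarrow> \<phi> x = 0" using test_function_ball[OF \<phi>] by metis
  obtain L where L: "L > 0" "\<And>x y. \<bar>\<phi> x - \<phi> y\<bar> \<le> L * norm (x - y)" using test_function_lipschitz[OF \<phi>] by metis
  obtain C where C: "C > 0" "\<And>x. \<bar>\<phi> x\<bar> \<le> C" using test_function_bounded[OF \<phi>] by metis
  define v where "v = (LINT x|lebesgue. indicat_real (cball (0::'a) (R + 1)) x)"
  have v: "v \<ge> 0" by (simp add: v_def)
  define I where "I = (LINT x|lebesgue. \<bar>\<phi> x\<bar>)"
  have I: "I \<ge> 0" by (simp add: I_def)
  define B where "B = C + I + R * C + (LINT x|lebesgue. \<bar>norm x * \<phi> x\<bar>) + L + L * v"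
  have nn: "0 \<le> R * C" "0 \<le> L * v" "0 \<le> (LINT x|lebesgue. \<bar>norm x * \<phi> x\<bar>)" using R C L v by auto
  have sup: "\<bar>\<phi> (x - e) - \<phi> x\<bar> \<le> L * norm e" for e x using L(2)[of "x - e" x] by simp
  show ?thesis
  proof
    show "B > 0" using C L I nn unfolding B_def by linarith
    show "\<bar>\<phi> x\<bar> \<le> B" for x using C(2)[of x] L I nn unfolding B_def by linarith
    show "(LINT x|lebesgue. \<bar>\<phi> x\<bar>) \<le> B" using C L I nn unfolding B_def I_def[symmetric] by linarith
    show "\<bar>norm x * \<phi> x\<bar> \<le> B" for x
    proof -
      have "\<bar>norm x * \<phi> x\<bar> \<le> R * C"
      proof (cases "norm x > R")
        case False
        then show ?thesis using C(2)[of x] C(1) R(1) by (simp add: abs_mult mult_mono)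
      qed (use R C in simp)
      then show ?thesis using C L I nn unfolding B_def by linarith
    qed
    show "(LINT x|lebesgue. \<bar>norm x * \<phi> x\<bar>) \<le> B" using C L I nn unfolding B_def by linarith
    show "\<bar>\<phi> (x - e) - \<phi> x\<bar> \<le> B * norm e" for e x
    proof -
      have "L * norm e \<le> B * norm e" using C L I nn by (intro mult_right_mono) (auto simp: B_def)
      then show ?thesis using sup[of x e] by linarith
    qed
    show "(LINT x|lebesgue. \<bar>\<phi> (x - e) - \<phi> x\<bar>) \<le> B * norm e" if e: "norm e \<le> 1" for e
    proof -
      have i: "integrable lebesgue (\<lambda>x. \<phi> (x - e))"
        using integrable_affine_iff[of 1 \<phi> "- e"] test_function_integrable[OF \<phi>] test_function_measurable_lebesgue[OF \<phi>] by simp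
      have "(LINT x|lebesgue. \<bar>\<phi> (x - e) - \<phi> x\<bar>) \<le> (LINT x|lebesgue. (L * norm e) * indicat_real (cball (0::'a) (R + 1)) x)"
      proof (rule integral_mono)
        show "integrable lebesgue (\<lambda>x. \<bar>\<phi> (x - e) - \<phi> x\<bar>)"
          by (intro integrable_abs Bochner_Integration.integrable_diff i test_function_integrable \<phi>)
        show "integrable lebesgue (\<lambda>x. (L * norm e) * indicat_real (cball (0::'a) (R + 1)) x)"
          by (rule integrable_const_cball)
        fix x :: 'a
        show "\<bar>\<phi> (x - e) - \<phi> x\<bar> \<le> (L * norm e) * indicat_real (cball (0::'a) (R + 1)) x"
        proof (cases "x \<in> cball 0 (R + 1)")
          case False
          then have "norm x > R" "norm (x - e) > R" using e norm_triangle_ineq2[of x e] by (auto simp: dist_norm)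
          then show ?thesis using R L(1) by simp
        qed (use sup in simp)
      qed
      also have "\<dots> = (L * v) * norm e" by (simp add: v_def)
      also have "\<dots> \<le> B * norm e" using C L I nn by (intro mult_right_mono) (auto simp: B_def)
      finally show ?thesis .
    qed
  qed
qed

text \<open>
  Moving the centre of an average amounts to moving the kernel.
\<close>

lemma mollify_translate:
  fixes u :: "'a::euclidean_space \<Rightarrow> real"
  assumes "u \<in> borel_measurable lebesgue" "test_function \<phi>" "t > 0"
  shows "mollify \<phi> u t (x + t *\<^sub>R e) = (LINT y|lebesgue. u (x + t *\<^sub>R y) * \<phi> (y - e))"
proof -
  have "(\<lambda>y. u (x + t *\<^sub>R y) * \<phi> (- e + 1 *\<^sub>R y)) \<in> borel_measurable lebesgue"
    by (rule borel_measurable_times[OF borel_measurable_affine[OF _ assms(1)] borel_measurable_affine]) (use assms test_function_measurable_lebesgue[OF assms(2)] in auto)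
  then have "(LINT y|lebesgue. u (x + t *\<^sub>R (e + 1 *\<^sub>R y)) * \<phi> (- e + 1 *\<^sub>R (e + 1 *\<^sub>R y)))
      = (LINT y|lebesgue. u (x + t *\<^sub>R y) * \<phi> (- e + 1 *\<^sub>R y))"
    using integral_affine[of 1 "\<lambda>y. u (x + t *\<^sub>R y) * \<phi> (- e + 1 *\<^sub>R y)" e] by simp
  then show ?thesis by (simp add: mollify_def algebra_simps)
qed

lemma Lp_norm_affine:
  fixes f :: "'a::euclidean_space \<Rightarrow> 'b::euclidean_space"
  assumes "f \<in> Lp p" "t > 0" "p > 0"
  shows "Lp_norm p (\<lambda>y. f (x + t *\<^sub>R y)) = t powr (- (real DIM('a) / p)) * Lp_norm p f"
proof -
  have "Lp_norm p (\<lambda>y. f (x + t *\<^sub>R y)) = (Lp_power p f * t powr (- real DIM('a))) powr (1 / p)"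
    using assms(2) by (simp add: Lp_norm_eq Lp_affine(2)[OF assms(1)] powr_minus powr_realpow divide_inverse)
  also have "\<dots> = Lp_power p f powr (1 / p) * (t powr (- real DIM('a))) powr (1 / p)"
    using Lp_power_nonneg by (simp add: powr_mult)
  also have "(t powr (- real DIM('a))) powr (1 / p) = t powr (- (real DIM('a) / p))"
    by (simp add: powr_powr)
  finally show ?thesis by (simp add: Lp_norm_eq mult.commute)
qed

lemma Hoelder_affine:
  fixes f :: "'a::euclidean_space \<Rightarrow> 'b::euclidean_space"
  assumes f: "f \<in> Lp p" and p: "p \<ge> 1" and t: "t > 0"
    and \<phi>: "integrable lebesgue \<phi>" "\<And>x. \<bar>\<phi> x\<bar> \<le> B" "(LINT x|lebesgue. \<bar>\<phi> x\<bar>) \<le> B"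
  shows "integrable lebesgue (\<lambda>y. norm (f (x + t *\<^sub>R y)) * \<bar>\<phi> y\<bar>)"
    and "(LINT y|lebesgue. norm (f (x + t *\<^sub>R y)) * \<bar>\<phi> y\<bar>) \<le> 2 * B * (t powr (- (real DIM('a) / p)) * Lp_norm p f)"
proof -
  have "(\<lambda>y. f (x + t *\<^sub>R y)) \<in> Lp p" using t by (intro Lp_affine f) auto
  from Hoelder_bounded[OF this p \<phi>] Lp_norm_affine[OF f t, of x]
  show "integrable lebesgue (\<lambda>y. norm (f (x + t *\<^sub>R y)) * \<bar>\<phi> y\<bar>)"
    "(LINT y|lebesgue. norm (f (x + t *\<^sub>R y)) * \<bar>\<phi> y\<bar>) \<le> 2 * B * (t powr (- (real DIM('a) / p)) * Lp_norm p f)"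
    using p by auto
qed

lemma mollify_integrable:
  fixes u :: "'a::euclidean_space \<Rightarrow> real"
  assumes "u \<in> Lp p" "p \<ge> 1" "t > 0" "test_function \<phi>"
  shows "integrable lebesgue (\<lambda>y. u (x + t *\<^sub>R y) * \<phi> y)"
  by (rule integrable_test_mult[OF locally_integrable_affine[OF Lp_locally_integrable]]) (use assms in auto)

lemma mollify_bound:
  fixes u :: "'a::euclidean_space \<Rightarrow> real"
  assumes "u \<in> Lp p" "p \<ge> 1" "t > 0" "test_function \<phi>"
    and B: "\<And>x. \<bar>\<phi> x\<bar> \<le> B" "(LINT x|lebesgue. \<bar>\<phi> x\<bar>) \<le> B"
  shows "\<bar>mollify \<phi> u t x\<bar> \<le> 2 * B * (t powr (- (real DIM('a) / p)) * Lp_norm p u)"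
proof -
  have "\<bar>mollify \<phi> u t x\<bar> \<le> (LINT y|lebesgue. \<bar>u (x + t *\<^sub>R y) * \<phi> y\<bar>)"
    unfolding mollify_def by (rule integral_abs_bound)
  also have "\<dots> \<le> 2 * B * (t powr (- (real DIM('a) / p)) * Lp_norm p u)"
    using Hoelder_affine(2)[OF assms(1-3) test_function_integrable[OF assms(4)] B, of x] by (simp add: abs_mult)
  finally show ?thesis .
qed

lemma mollify_lipschitz:
  fixes u :: "'a::euclidean_space \<Rightarrow> real"
  assumes u: "u \<in> Lp p" and p: "p \<ge> 1" and t: "t > 0" and \<phi>: "test_function \<phi>"
    and B: "B > 0" "\<And>e x. norm e \<le> 1 \<Longrightarrow> \<bar>\<phi> (x - e) - \<phi> x\<bar> \<le> B * norm e"
      "\<And>e. norm e \<le> 1 \<Longrightarrow> (LINT x|lebesgue. \<bar>\<phi> (x - e) - \<phi> x\<bar>) \<le> B * norm e"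
    and le: "norm (z - x) \<le> t"
  shows "\<bar>mollify \<phi> u t z - mollify \<phi> u t x\<bar> \<le> 2 * B * (norm (z - x) / t) * (t powr (- (real DIM('a) / p)) * Lp_norm p u)"
proof -
  define e where "e = (1 / t) *\<^sub>R (z - x)"
  have z: "z = x + t *\<^sub>R e" using t by (simp add: e_def)
  have "norm e = norm (z - x) / t" unfolding e_def using t by simp
  then have e: "norm e \<le> 1" "norm e = norm (z - x) / t" using t le by auto
  have t': "test_function (\<lambda>y. \<phi> (- e + 1 *\<^sub>R y))" by (rule test_function_affine[OF \<phi>]) simp
  have "mollify \<phi> u t z - mollify \<phi> u t x = (LINT y|lebesgue. u (x + t *\<^sub>R y) * \<phi> (y - e)) - (LINT y|lebesgue. u (x + t *\<^sub>R y) * \<phi> y)"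
    unfolding z mollify_translate[OF Lp_measurable[OF u] \<phi> t] by (simp add: mollify_def)
  also have "\<dots> = (LINT y|lebesgue. u (x + t *\<^sub>R y) * (\<phi> (y - e) - \<phi> y))"
    using mollify_integrable[OF u p t \<phi>, of x] mollify_integrable[OF u p t t', of x]
    by (simp add: right_diff_distrib)
  also have "\<bar>\<dots>\<bar> \<le> (LINT y|lebesgue. \<bar>u (x + t *\<^sub>R y) * (\<phi> (y - e) - \<phi> y)\<bar>)" by (rule integral_abs_bound)
  also have "\<dots> \<le> 2 * (B * norm e) * (t powr (- (real DIM('a) / p)) * Lp_norm p u)"
    using Hoelder_affine(2)[OF u p t, of "\<lambda>y. \<phi> (y - e) - \<phi> y" "B * norm e" x] B(2)[OF e(1)] B(3)[OF e(1)]
      test_function_integrable[OF \<phi>] test_function_integrable[OF t']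
    by (simp add: abs_mult)
  finally show ?thesis by (simp add: e(2) mult_ac)
qed

text \<open>
  The factor multiplying \<open>u\<close> is the divergence of the vector field \<open>\<phi>(z) z\<close>, so this is the
  definition of the weak gradient, summed over the components of that field.
\<close>

lemma radial_divergence:
  fixes u :: "'a::euclidean_space \<Rightarrow> real"
  assumes w: "is_weak_gradient u g" and \<phi>: "test_function \<phi>"
  shows "(LINT z|lebesgue. u z * (real DIM('a) * \<phi> z + frechet_derivative \<phi> (at z) z)) =
    - (LINT z|lebesgue. (g z \<bullet> z) * \<phi> z)"
proof -
  note W = is_weak_gradientD[OF w]
  define \<psi> where "\<psi> i z = (z \<bullet> i) * \<phi> z" for i z :: 'a
  have \<psi>: "test_function (\<psi> i)" for i unfolding \<psi>_def by (intro test_function_mult \<phi> Ck_inner)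
  have d\<psi>: "frechet_derivative (\<psi> i) (at z) i = \<phi> z + (z \<bullet> i) * frechet_derivative \<phi> (at z) i"
    if i: "i \<in> Basis" for i z
  proof -
    have "((\<lambda>z. z \<bullet> i) has_derivative (\<lambda>h. h \<bullet> i)) (at z)" by (auto intro!: derivative_eq_intros)
    from frechet_derivativeI[OF has_derivative_mult[OF this test_function_has_derivative[OF \<phi>]]]
    show ?thesis using i by (simp add: \<psi>_def[abs_def])
  qed
  have lin: "frechet_derivative \<phi> (at z) z = (\<Sum>i\<in>Basis. (z \<bullet> i) * frechet_derivative \<phi> (at z) i)" for z
  proof -
    have l: "linear (frechet_derivative \<phi> (at z))" by (rule has_derivative_linear[OF test_function_has_derivative[OF \<phi>]])
    have "frechet_derivative \<phi> (at z) (\<Sum>i\<in>Basis. (z \<bullet> i) *\<^sub>R i) = (\<Sum>i\<in>Basis. (z \<bullet> i) * frechet_derivative \<phi> (at z) i)"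
      using l by (simp add: linear_sum linear_scale)
    then show ?thesis by (simp add: euclidean_representation)
  qed
  have "(LINT z|lebesgue. u z * (real DIM('a) * \<phi> z + frechet_derivative \<phi> (at z) z))
      = (LINT z|lebesgue. (\<Sum>i\<in>Basis. u z * frechet_derivative (\<psi> i) (at z) i))"
    by (intro Bochner_Integration.integral_cong refl) (simp add: d\<psi> lin sum.distrib flip: sum_distrib_left)
  also have "\<dots> = (\<Sum>i\<in>Basis. (LINT z|lebesgue. u z * frechet_derivative (\<psi> i) (at z) i))"
    by (intro Bochner_Integration.integral_sum integrable_test_mult W test_function_partial \<psi>)
  also have "\<dots> = (\<Sum>i\<in>Basis. - (LINT z|lebesgue. (g z \<bullet> i) * \<psi> i z))"
    by (intro sum.cong refl W(3) \<psi>)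
  also have "\<dots> = - (\<Sum>i\<in>Basis. (LINT z|lebesgue. (g z \<bullet> i) * \<psi> i z))" by (rule sum_negf)
  also have "(\<Sum>i\<in>Basis. (LINT z|lebesgue. (g z \<bullet> i) * \<psi> i z)) = (LINT z|lebesgue. (\<Sum>i\<in>Basis. (g z \<bullet> i) * \<psi> i z))"
    by (intro Bochner_Integration.integral_sum[symmetric] integrable_test_inner W \<psi>)
  also have "\<dots> = (LINT z|lebesgue. (g z \<bullet> z) * \<phi> z)"
  proof (intro Bochner_Integration.integral_cong refl)
    fix z
    have "(g z \<bullet> z) * \<phi> z = (\<Sum>i\<in>Basis. (g z \<bullet> i) * (z \<bullet> i)) * \<phi> z" by (subst euclidean_inner) (rule refl)
    then show "(\<Sum>i\<in>Basis. (g z \<bullet> i) * \<psi> i z) = (g z \<bullet> z) * \<phi> z"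
      by (simp only: \<psi>_def sum_distrib_right mult.assoc)
  qed
  finally show ?thesis .
qed

text \<open>
  Differentiation under the integral sign: for \<open>s\<close> near 1 the difference quotients of the kernel are
  bounded and supported in a fixed ball, where \<open>u\<close> is integrable.
\<close>

lemma dilated_integral_DERIV:
  fixes u :: "'a::euclidean_space \<Rightarrow> real"
  assumes u: "locally_integrable u" and \<phi>: "test_function \<phi>"
  shows "((\<lambda>s. LINT z|lebesgue. u z * (s ^ DIM('a) * \<phi> (s *\<^sub>R z))) has_real_derivative
    (LINT z|lebesgue. u z * (real DIM('a) * \<phi> z + frechet_derivative \<phi> (at z) z))) (at 1)"
proof -
  obtain R where R: "R > 0" "\<And>x. norm x > R \<Longrightarrow> \<phi> x = 0" using test_function_ball[OF \<phi>] by metis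
  obtain L where L: "L > 0" "\<And>x y. \<bar>\<phi> x - \<phi> y\<bar> \<le> L * norm (x - y)" using test_function_lipschitz[OF \<phi>] by metis
  obtain M where M: "M > 0" "\<And>x. \<bar>\<phi> x\<bar> \<le> M" using test_function_bounded[OF \<phi>] by metis
  define k where "k s z = s ^ DIM('a) * \<phi> (s *\<^sub>R z)" for s and z :: 'a
  \<comment> \<open>A Lipschitz constant of \<open>s ^ DIM('a)\<close> at 1 for \<open>\<bar>s\<bar> \<le> 2\<close>.\<close>
  define D :: real where "D = (\<Sum>i<DIM('a). 2 ^ i)"
  define C where "C = D * M + L * (2 * R)"
  have D: "D \<ge> 0" unfolding D_def by (intro sum_nonneg) simp
  have C: "C \<ge> 0" using D M L R by (simp add: C_def)
  have bound: "\<bar>k s z - k 1 z\<bar> \<le> C * \<bar>s - 1\<bar> * indicat_real (cball 0 (2 * R)) z" if s: "\<bar>s - 1\<bar> \<le> 1/2" for s z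
  proof (cases "z \<in> cball 0 (2 * R)")
    case False
    then have z: "norm z > 2 * R" by (simp add: dist_norm)
    \<comment> \<open>Outside the ball of radius \<open>2 * R\<close> both kernels vanish, since \<open>norm (s *\<^sub>R z) \<ge> norm z / 2 > R\<close>.\<close>
    have "1/2 \<le> \<bar>s\<bar>" using s by linarith
    then have "norm z * (1/2) \<le> norm z * \<bar>s\<bar>" by (intro mult_left_mono) auto
    then have "norm (s *\<^sub>R z) > R" "norm z > R" using z R by (auto simp: mult.commute)
    then show ?thesis using R C False by (simp add: k_def)
  next
    case True
    have "\<bar>s ^ DIM('a) - 1\<bar> \<le> D * \<bar>s - 1\<bar>"
    proof -
      have "s ^ DIM('a) - 1 = (s - 1) * (\<Sum>i<DIM('a). s ^ i)" by (rule power_diff_1_eq)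
      moreover have "\<bar>\<Sum>i<DIM('a). s ^ i\<bar> \<le> D" unfolding D_def
      proof (intro order_trans[OF sum_abs] sum_mono)
        have "\<bar>s\<bar> \<le> 2" using s by linarith
        then show "\<bar>s ^ i\<bar> \<le> 2 ^ i" for i unfolding power_abs by (intro power_mono) auto
      qed
      ultimately show ?thesis by (simp add: abs_mult mult.commute[of D] mult_left_mono)
    qed
    then have "\<bar>s ^ DIM('a) - 1\<bar> * \<bar>\<phi> (s *\<^sub>R z)\<bar> \<le> (D * \<bar>s - 1\<bar>) * M"
      by (intro mult_mono M) (use D in auto)
    moreover have "\<bar>\<phi> (s *\<^sub>R z) - \<phi> z\<bar> \<le> L * (\<bar>s - 1\<bar> * (2 * R))"
    proof -
      have "s *\<^sub>R z - z = (s - 1) *\<^sub>R z" by (simp add: scaleR_diff_left)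
      then have "norm (s *\<^sub>R z - z) \<le> \<bar>s - 1\<bar> * (2 * R)" using True by (simp add: mult_left_mono)
      then have "L * norm (s *\<^sub>R z - z) \<le> L * (\<bar>s - 1\<bar> * (2 * R))" using L(1) by (intro mult_left_mono) auto
      then show ?thesis using L(2)[of "s *\<^sub>R z" z] by linarith
    qed
    moreover have "k s z - k 1 z = (s ^ DIM('a) - 1) * \<phi> (s *\<^sub>R z) + (\<phi> (s *\<^sub>R z) - \<phi> z)"
      by (simp add: k_def algebra_simps)
    ultimately have "\<bar>k s z - k 1 z\<bar> \<le> (D * \<bar>s - 1\<bar>) * M + L * (\<bar>s - 1\<bar> * (2 * R))"
      using abs_triangle_ineq[of "(s ^ DIM('a) - 1) * \<phi> (s *\<^sub>R z)" "\<phi> (s *\<^sub>R z) - \<phi> z"] by (simp add: abs_mult)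
    then show ?thesis using True by (simp add: C_def algebra_simps)
  qed
  have k': "((\<lambda>s. k s z) has_real_derivative (real DIM('a) * \<phi> z + frechet_derivative \<phi> (at z) z)) (at 1)" for z
  proof -
    have "((\<lambda>s. s *\<^sub>R z) has_derivative (\<lambda>h. h *\<^sub>R z)) (at 1)" by (auto intro!: derivative_eq_intros)
    then have "((\<lambda>s. \<phi> (s *\<^sub>R z)) has_derivative (\<lambda>h. frechet_derivative \<phi> (at z) (h *\<^sub>R z))) (at 1)"
      by (rule has_derivative_compose) (simp add: test_function_has_derivative[OF \<phi>])
    moreover have "(\<lambda>h. frechet_derivative \<phi> (at z) (h *\<^sub>R z)) = (*) (frechet_derivative \<phi> (at z) z)"
      using has_derivative_linear[OF test_function_has_derivative[OF \<phi>, of z]] by (simp add: linear_scale fun_eq_iff mult.commute)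
    ultimately have 1: "((\<lambda>s. \<phi> (s *\<^sub>R z)) has_real_derivative frechet_derivative \<phi> (at z) z) (at 1)"
      by (simp add: has_field_derivative_def)
    show ?thesis unfolding k_def by (rule derivative_eq_intros refl 1 | simp)+
  qed
  have tk: "test_function (k s)" if "s > 0" for s
    unfolding k_def using test_function_affine[OF \<phi>, of s 0] that by (intro test_function_mult Ck_const) auto
  have ki: "integrable lebesgue (\<lambda>z. u z * k s z)" if "s > 0" for s
    by (intro integrable_test_mult u tk that)
  note um = locally_integrable_measurable[OF u]
  show ?thesis unfolding has_field_derivative_iff k_def[symmetric]
  proof (subst tendsto_at_iff_sequentially, intro allI impI, unfold comp_def)
    fix X assume X: "\<forall>i. X i \<in> UNIV - {1}" "X \<longlonglongrightarrow> (1::real)"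
    obtain N where N: "\<And>n. n \<ge> N \<Longrightarrow> \<bar>X n - 1\<bar> < 1/2"
      using LIMSEQ_D[OF X(2), of "1/2"] by auto
    define Y where "Y n = X (n + N)" for n
    have Y: "\<bar>Y n - 1\<bar> \<le> 1/2" "Y n > 0" "Y n \<noteq> 1" for n
      using N[of "n + N"] X(1) by (auto simp: Y_def abs_if split: if_splits)
    have Y1: "Y \<longlonglongrightarrow> 1" unfolding Y_def by (rule LIMSEQ_ignore_initial_segment[OF X(2)])
    have Y_at: "filterlim Y (at 1) sequentially"
      using Y1 Y(3) by (auto simp: filterlim_at intro!: always_eventually)
    define q where "q n z = u z * ((k (Y n) z - k 1 z) / (Y n - 1))" for n z
    have "(\<lambda>n. LINT z|lebesgue. q n z) \<longlonglongrightarrow> (LINT z|lebesgue. u z * (real DIM('a) * \<phi> z + frechet_derivative \<phi> (at z) z))"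
    proof (rule integral_dominated_convergence)
      have "integrable lebesgue (\<lambda>z. C * norm (indicat_real (cball 0 (2 * R)) z *\<^sub>R u z))"
        using u by (intro integrable_mult_right integrable_norm) (simp add: locally_integrable_def set_integrable_def)
      then show "integrable lebesgue (\<lambda>z. C * \<bar>indicat_real (cball 0 (2 * R)) z * u z\<bar>)" by simp
      have qm: "q n \<in> borel_measurable lebesgue" for n
        unfolding q_def
        by (intro borel_measurable_times borel_measurable_divide borel_measurable_diff um borel_measurable_const
            test_function_measurable_lebesgue[OF tk] Y) simp
      then show "q n \<in> borel_measurable lebesgue" for n .
      have lim: "(\<lambda>n. q n z) \<longlonglongrightarrow> u z * (real DIM('a) * \<phi> z + frechet_derivative \<phi> (at z) z)" for z
        unfolding q_def
        by (intro tendsto_mult tendsto_const filterlim_compose[OF _ Y_at]) (use k'[of z] in \<open>simp add: has_field_derivative_iff\<close>)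
      then show "AE z in lebesgue. (\<lambda>n. q n z) \<longlonglongrightarrow> u z * (real DIM('a) * \<phi> z + frechet_derivative \<phi> (at z) z)" by simp
      show "(\<lambda>z. u z * (real DIM('a) * \<phi> z + frechet_derivative \<phi> (at z) z)) \<in> borel_measurable lebesgue"
        by (rule borel_measurable_LIMSEQ_metric[OF qm lim])
      show "AE z in lebesgue. norm (q n z) \<le> C * \<bar>indicat_real (cball 0 (2 * R)) z * u z\<bar>" for n
      proof (rule AE_I2)
        fix z
        have "\<bar>k (Y n) z - k 1 z\<bar> / \<bar>Y n - 1\<bar> \<le> C * indicat_real (cball 0 (2 * R)) z"
          using bound[OF Y(1)[of n], of z] Y(3)[of n] by (simp add: field_simps)
        then have "\<bar>u z\<bar> * (\<bar>k (Y n) z - k 1 z\<bar> / \<bar>Y n - 1\<bar>) \<le> \<bar>u z\<bar> * (C * indicat_real (cball 0 (2 * R)) z)"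
          by (intro mult_left_mono) auto
        then show "norm (q n z) \<le> C * \<bar>indicat_real (cball 0 (2 * R)) z * u z\<bar>"
          by (simp add: q_def abs_mult abs_divide mult_ac)
      qed
    qed
    moreover have "(LINT z|lebesgue. q n z) = ((LINT z|lebesgue. u z * k (Y n) z) - (LINT z|lebesgue. u z * k 1 z)) / (Y n - 1)" for n
    proof -
      have "(LINT z|lebesgue. u z * k (Y n) z) - (LINT z|lebesgue. u z * k 1 z) = (LINT z|lebesgue. u z * k (Y n) z - u z * k 1 z)"
        by (rule Bochner_Integration.integral_diff[OF ki[OF Y(2)] ki[OF zero_less_one], symmetric])
      moreover have "q n = (\<lambda>z. (u z * k (Y n) z - u z * k 1 z) / (Y n - 1))"
        by (simp add: q_def fun_eq_iff right_diff_distrib)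
      ultimately show ?thesis by (simp only: integral_divide_zero)
    qed
    ultimately have "(\<lambda>n. ((LINT z|lebesgue. u z * k (X (n + N)) z) - (LINT z|lebesgue. u z * k 1 z)) / (X (n + N) - 1))
        \<longlonglongrightarrow> (LINT z|lebesgue. u z * (real DIM('a) * \<phi> z + frechet_derivative \<phi> (at z) z))"
      by (simp only: Y_def)
    then show "(\<lambda>n. ((LINT z|lebesgue. u z * k (X n) z) - (LINT z|lebesgue. u z * k 1 z)) / (X n - 1))
        \<longlonglongrightarrow> (LINT z|lebesgue. u z * (real DIM('a) * \<phi> z + frechet_derivative \<phi> (at z) z))"
      by (rule LIMSEQ_offset)
  qed
qed

text \<open>
  Replacing \<open>u\<close> by \<open>z \<mapsto> u (x + r z)\<close> reduces the derivative at radius \<open>r\<close> to the one at dilation factor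
  1; the substitution \<open>s = r / t\<close> puts the dilation onto the kernel.
\<close>

lemma mollify_DERIV:
  fixes u :: "'a::euclidean_space \<Rightarrow> real"
  assumes w: "is_weak_gradient u g" and \<phi>: "test_function \<phi>" and r: "r > 0"
  shows "((\<lambda>t. mollify \<phi> u t x) has_real_derivative (LINT z|lebesgue. (g (x + r *\<^sub>R z) \<bullet> z) * \<phi> z)) (at r)"
proof -
  define U where "U z = u (x + r *\<^sub>R z)" for z
  have wU: "is_weak_gradient U (\<lambda>z. r *\<^sub>R g (x + r *\<^sub>R z))"
    unfolding U_def by (rule is_weak_gradient_affine[OF w]) (use r in simp)
  note U = is_weak_gradientD(1)[OF wU]
  define F where "F s = (LINT z|lebesgue. U z * (s ^ DIM('a) * \<phi> (s *\<^sub>R z)))" for s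
  define F' where "F' = (LINT z|lebesgue. U z * (real DIM('a) * \<phi> z + frechet_derivative \<phi> (at z) z))"
  have F': "F' = - (r * (LINT z|lebesgue. (g (x + r *\<^sub>R z) \<bullet> z) * \<phi> z))"
    using radial_divergence[OF wU \<phi>] by (simp add: F'_def mult.assoc)
  have "(F has_real_derivative F') (at 1)" unfolding F_def F'_def by (rule dilated_integral_DERIV[OF U \<phi>])
  then have F: "(F has_real_derivative F') (at (r / r))" using r by simp
  have rr: "((\<lambda>t. r / t) has_real_derivative - (1 / r)) (at r)"
    using r by (auto intro!: derivative_eq_intros simp: field_simps power2_eq_square)
  have "((\<lambda>t. F (r / t)) has_real_derivative F' * - (1 / r)) (at r)"
    by (rule DERIV_chain2[OF F rr])
  then have "((\<lambda>t. mollify \<phi> u t x) has_real_derivative F' * - (1 / r)) (at r)"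
  proof (rule has_field_derivative_transform_within_open[of _ _ _ "{0<..}"])
    fix t assume "t \<in> {0::real<..}"
    then have t: "t > 0" by simp
    define s where "s = r / t"
    have s: "s > 0" "s \<noteq> 0" using r t by (auto simp: s_def)
    define H where "H z = U z * (s ^ DIM('a) * \<phi> (s *\<^sub>R z))" for z
    have "test_function (\<lambda>z. s ^ DIM('a) * \<phi> (s *\<^sub>R z))"
      using test_function_affine[OF \<phi>, of s 0] s by (intro test_function_mult Ck_const) auto
    then have "H \<in> borel_measurable lebesgue"
      unfolding H_def by (intro borel_measurable_integrable integrable_test_mult U)
    then have "(LINT y|lebesgue. H (0 + (1 / s) *\<^sub>R y)) = (LINT z|lebesgue. H z) /\<^sub>R \<bar>1 / s\<bar> ^ DIM('a)"
      using s by (intro integral_affine) auto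
    also have "\<dots> = s ^ DIM('a) * F s" using s by (simp add: H_def F_def power_one_over)
    also have "(LINT y|lebesgue. H (0 + (1 / s) *\<^sub>R y)) = (LINT y|lebesgue. s ^ DIM('a) * (u (x + t *\<^sub>R y) * \<phi> y))"
    proof (intro Bochner_Integration.integral_cong refl)
      fix y
      have "r * (1 / s) = t" using r t by (simp add: s_def)
      then show "H (0 + (1 / s) *\<^sub>R y) = s ^ DIM('a) * (u (x + t *\<^sub>R y) * \<phi> y)"
        using s by (simp add: H_def U_def)
    qed
    finally show "F (r / t) = mollify \<phi> u t x" using s by (simp add: mollify_def s_def)
  qed (use r in auto)
  moreover have "F' * - (1 / r) = (LINT z|lebesgue. (g (x + r *\<^sub>R z) \<bullet> z) * \<phi> z)" using r by (simp add: F')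
  ultimately show ?thesis by simp
qed

text \<open>
  The derivative in \<open>t\<close> is in absolute value at most \<open>K\<close> times the derivative of \<open>t powr \<gamma>\<close>, so the sum and the
  difference of \<open>K * t powr \<gamma>\<close> and the average are both nondecreasing. Here \<open>p > d\<close> enters through
  \<open>\<gamma> > 0\<close>.
\<close>

lemma mollify_radial_increment:
  fixes u :: "'a::euclidean_space \<Rightarrow> real"
  assumes w: "is_weak_gradient u g" and g: "g \<in> Lp p" and \<phi>: "test_function \<phi>" and p: "p > real DIM('a)"
    and B: "\<And>x. \<bar>norm x * \<phi> x\<bar> \<le> B" "(LINT x|lebesgue. \<bar>norm x * \<phi> x\<bar>) \<le> B"
    and st: "0 < s" "s \<le> t"
  shows "\<bar>mollify \<phi> u t x - mollify \<phi> u s x\<bar> \<le> 2 * B / (1 - real DIM('a) / p) * Lp_norm p g * t powr (1 - real DIM('a) / p)"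
proof -
  define \<gamma> where "\<gamma> = 1 - real DIM('a) / p"
  have "real DIM('a) \<ge> 1" using DIM_positive[where 'a = 'a] by linarith
  then have p1: "p \<ge> 1" using p by linarith
  have \<gamma>: "\<gamma> > 0" using p p1 by (simp add: \<gamma>_def)
  have B0: "B \<ge> 0" using B(1)[of 0] by simp
  define K where "K = 2 * B / \<gamma> * Lp_norm p g"
  have K: "K \<ge> 0" using B0 \<gamma> Lp_norm_nonneg[of p g] by (simp add: K_def)
  define m' where "m' r = (LINT z|lebesgue. (g (x + r *\<^sub>R z) \<bullet> z) * \<phi> z)" for r
  have i: "integrable lebesgue (\<lambda>z. norm z * \<phi> z)"
  proof -
    obtain R where R: "R > 0" "\<And>x. norm x > R \<Longrightarrow> \<phi> x = 0" using test_function_ball[OF \<phi>] by metis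
    show ?thesis
      by (rule integrable_continuous_compact_support[of _ "cball 0 R"])
        (auto intro!: continuous_on_mult continuous_on_norm continuous_on_id test_function_continuous[OF \<phi>] R(2))
  qed
  have m'_le: "\<bar>m' r\<bar> \<le> K * (\<gamma> * r powr (\<gamma> - 1))" if r: "r > 0" for r
  proof -
    have "\<bar>m' r\<bar> \<le> (LINT z|lebesgue. \<bar>(g (x + r *\<^sub>R z) \<bullet> z) * \<phi> z\<bar>)"
      unfolding m'_def by (rule integral_abs_bound)
    also have "\<dots> \<le> (LINT z|lebesgue. norm (g (x + r *\<^sub>R z)) * \<bar>norm z * \<phi> z\<bar>)"
    proof (rule integral_mono')
      show "integrable lebesgue (\<lambda>z. norm (g (x + r *\<^sub>R z)) * \<bar>norm z * \<phi> z\<bar>)"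
        by (rule Hoelder_affine(1)[OF g p1 r i B])
      show "\<bar>(g (x + r *\<^sub>R z) \<bullet> z) * \<phi> z\<bar> \<le> norm (g (x + r *\<^sub>R z)) * \<bar>norm z * \<phi> z\<bar>" for z
        using mult_right_mono[OF Cauchy_Schwarz_ineq2[of "g (x + r *\<^sub>R z)" z], of "\<bar>\<phi> z\<bar>"] by (simp add: abs_mult mult.assoc)
    qed simp
    also have "\<dots> \<le> 2 * B * (r powr (- (real DIM('a) / p)) * Lp_norm p g)"
      by (rule Hoelder_affine(2)[OF g p1 r i B])
    also have "\<dots> = (K * \<gamma>) * r powr (\<gamma> - 1)"
    proof -
      have "- (real DIM('a) / p) = \<gamma> - 1" by (simp add: \<gamma>_def)
      moreover have "K * \<gamma> = 2 * B * Lp_norm p g" using \<gamma> by (simp add: K_def)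
      ultimately show ?thesis by simp
    qed
    also have "\<dots> = K * (\<gamma> * r powr (\<gamma> - 1))" by simp
    finally show ?thesis .
  qed
  have D: "((\<lambda>t. mollify \<phi> u t x) has_real_derivative m' r) (at r)" if "r > 0" for r
    unfolding m'_def by (rule mollify_DERIV[OF w \<phi> that])
  have P: "((\<lambda>t. K * t powr \<gamma>) has_real_derivative K * (\<gamma> * r powr (\<gamma> - 1))) (at r)" if "r > 0" for r
    using that by (auto intro!: derivative_eq_intros)
  have "K * s powr \<gamma> + mollify \<phi> u s x \<le> K * t powr \<gamma> + mollify \<phi> u t x"
  proof (rule DERIV_nonneg_imp_nondecreasing[OF st(2)])
    fix r assume "s \<le> r" "r \<le> t"
    then have r: "r > 0" using st by simp
    show "\<exists>y. ((\<lambda>t. K * t powr \<gamma> + mollify \<phi> u t x) has_real_derivative y) (at r) \<and> 0 \<le> y"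
      using DERIV_add[OF P[OF r] D[OF r]] m'_le[OF r] by (intro exI conjI) auto
  qed
  moreover have "K * s powr \<gamma> - mollify \<phi> u s x \<le> K * t powr \<gamma> - mollify \<phi> u t x"
  proof (rule DERIV_nonneg_imp_nondecreasing[OF st(2)])
    fix r assume "s \<le> r" "r \<le> t"
    then have r: "r > 0" using st by simp
    show "\<exists>y. ((\<lambda>t. K * t powr \<gamma> - mollify \<phi> u t x) has_real_derivative y) (at r) \<and> 0 \<le> y"
      using DERIV_diff[OF P[OF r] D[OF r]] m'_le[OF r] by (intro exI conjI) auto
  qed
  moreover have "K * s powr \<gamma> \<ge> 0" using K by simp
  ultimately show ?thesis unfolding K_def[symmetric] \<gamma>_def[symmetric] by linarith
qed

text \<open>
  By Fubini's theorem the integral equals \<open>\<integral> \<phi>(y) (\<integral> u(z) \<psi>(z - t y) dz) dy\<close>, and the inner integral is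
  Lipschitz continuous for small shifts \<open>t y\<close>. Product measurability requires a Borel representative of
  \<open>u\<close>.
\<close>

lemma mollify_weak_limit:
  fixes u :: "'a::euclidean_space \<Rightarrow> real"
  assumes u: "u \<in> Lp p" and p: "p \<ge> 1" and \<phi>: "test_function \<phi>" and \<psi>: "test_function \<psi>"
  shows "((\<lambda>t. LINT x|lebesgue. mollify \<phi> u t x * \<psi> x) \<longlongrightarrow>
    (LINT x|lebesgue. \<phi> x) * (LINT x|lebesgue. u x * \<psi> x)) (at_right 0)"
proof -
  obtain R where R: "R > 0" "\<And>x. norm x > R \<Longrightarrow> \<phi> x = 0" using test_function_ball[OF \<phi>] by metis
  obtain B where B: "B > 0" "\<And>x. \<bar>\<phi> x\<bar> \<le> B" "(LINT x|lebesgue. \<bar>\<phi> x\<bar>) \<le> B"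
    by (rule kernel_bounds[OF \<phi>]) (erule that, blast+)
  obtain B' where B': "B' > 0" "\<And>e x. norm e \<le> 1 \<Longrightarrow> \<bar>\<psi> (x - e) - \<psi> x\<bar> \<le> B' * norm e"
    "\<And>e. norm e \<le> 1 \<Longrightarrow> (LINT x|lebesgue. \<bar>\<psi> (x - e) - \<psi> x\<bar>) \<le> B' * norm e"
    by (rule kernel_bounds[OF \<psi>]) (erule that, blast+)
  have \<phi>m[measurable]: "\<phi> \<in> borel_measurable borel" and \<psi>m[measurable]: "\<psi> \<in> borel_measurable borel"
    using \<phi> \<psi> by (auto intro: test_function_measurable)
  obtain v where v[measurable]: "v \<in> borel_measurable borel" and uv: "AE x in lborel. u x = v x"
    using completion_ex_borel_measurable_real[OF Lp_measurable[OF u]] by auto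
  have vm: "v \<in> borel_measurable lebesgue" by (intro measurable_completion) simp
  have vu: "AE x in lebesgue. v x = u x" using AE_completion[OF uv] by (rule AE_mp) simp
  have vL: "v \<in> Lp p" by (rule Lp_cong_AE(1)[OF u vm vu])
  define J where "J = (LINT x|lebesgue. v x * \<psi> x)"
  have J: "J = (LINT x|lebesgue. u x * \<psi> x)"
    unfolding J_def using vm Lp_measurable[OF u] test_function_measurable_lebesgue[OF \<psi>]
    by (intro integral_cong_AE borel_measurable_times) (use vu in auto)
  have mv: "mollify \<phi> u t x = mollify \<phi> v t x" if "t > 0" for t x
    unfolding mollify_def
  proof (rule integral_cong_AE)
    show "(\<lambda>y. u (x + t *\<^sub>R y) * \<phi> y) \<in> borel_measurable lebesgue" "(\<lambda>y. v (x + t *\<^sub>R y) * \<phi> y) \<in> borel_measurable lebesgue"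
      by (rule borel_measurable_integrable mollify_integrable[OF u p that \<phi>] mollify_integrable[OF vL p that \<phi>])+
    show "AE y in lebesgue. u (x + t *\<^sub>R y) * \<phi> y = v (x + t *\<^sub>R y) * \<phi> y"
      by (rule AE_mp[OF AE_affine[OF _ vu, of t x]]) (use that in auto)
  qed
  have step: "\<bar>(LINT x|lebesgue. mollify \<phi> u t x * \<psi> x) - (LINT x|lebesgue. \<phi> x) * J\<bar> \<le> 2 * B' * R * Lp_norm p v * B * t"
    if t: "t > 0" "t * R \<le> 1" for t
  proof -
    let ?H = "\<lambda>x y. v (x + t *\<^sub>R y) * \<phi> y * \<psi> x"
    have inner_int: "integrable lborel (\<lambda>y. v (x + t *\<^sub>R y) * \<phi> y)" for x
      using mollify_integrable[OF vL p t(1) \<phi>, of x] by (subst (asm) integrable_completion) auto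
    have H: "integrable (lborel \<Otimes>\<^sub>M lborel) (\<lambda>(x, y). ?H x y)"
    proof (rule lborel_pair.Fubini_integrable)
      show "(\<lambda>(x, y). ?H x y) \<in> borel_measurable (lborel \<Otimes>\<^sub>M lborel)" by measurable
      show "AE x in lborel. integrable lborel (\<lambda>y. (\<lambda>(x, y). ?H x y) (x, y))"
        by (rule AE_I2) (use inner_int in auto)
      define A where "A = 2 * B * (t powr (- (real DIM('a) / p)) * Lp_norm p v)"
      have le: "(LINT y|lborel. norm (?H x y)) \<le> A * \<bar>\<psi> x\<bar>" for x
      proof -
        have "(LINT y|lborel. norm (?H x y)) = (LINT y|lborel. norm (v (x + t *\<^sub>R y)) * \<bar>\<phi> y\<bar>) * \<bar>\<psi> x\<bar>"
          by (simp add: abs_mult)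
        also have "(LINT y|lborel. norm (v (x + t *\<^sub>R y)) * \<bar>\<phi> y\<bar>) = (LINT y|lebesgue. norm (v (x + t *\<^sub>R y)) * \<bar>\<phi> y\<bar>)"
          by (rule integral_completion[symmetric]) measurable
        also have "\<dots> \<le> A" unfolding A_def
          by (rule Hoelder_affine(2)[OF vL p t(1) test_function_integrable[OF \<phi>] B(2,3)])
        finally show ?thesis by (simp add: mult_right_mono)
      qed
      show "integrable lborel (\<lambda>x. LINT y|lborel. norm ((\<lambda>(x, y). ?H x y) (x, y)))"
      proof (rule Bochner_Integration.integrable_bound)
        show "integrable lborel (\<lambda>x. A * \<bar>\<psi> x\<bar>)"
          using test_function_integrable[OF \<psi>] by (intro integrable_mult_right integrable_abs) (simp add: integrable_completion)
        show "AE x in lborel. norm (LINT y|lborel. norm ((\<lambda>(x, y). ?H x y) (x, y))) \<le> norm (A * \<bar>\<psi> x\<bar>)"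
        proof (rule AE_I2)
          fix x
          have "0 \<le> (LINT y|lborel. norm (?H x y))" by simp
          then show "norm (LINT y|lborel. norm ((\<lambda>(x, y). ?H x y) (x, y))) \<le> norm (A * \<bar>\<psi> x\<bar>)"
            using le[of x] by simp
        qed
      qed measurable
    qed
    have Fub: "(LINT x|lborel. LINT y|lborel. ?H x y) = (LINT y|lborel. LINT x|lborel. ?H x y)"
      by (rule lborel_pair.Fubini_integral[symmetric, OF H])
    \<comment> \<open>The inner integral is itself an average, of radius 1 and with kernel \<open>\<psi>\<close>, so its shifts are controlled by \<open>mollify_lipschitz\<close>.\<close>
    define S where "S y = (LINT x|lebesgue. v x * \<psi> (x - t *\<^sub>R y))" for y
    have S_close: "\<bar>S y - J\<bar> \<le> 2 * B' * (t * norm y) * Lp_norm p v" if y: "norm y \<le> R" for y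
    proof -
      have ty: "norm (t *\<^sub>R y) = t * norm y" "t * norm y \<le> 1"
        using t order_trans[OF mult_left_mono[OF y, of t]] by auto
      have "\<bar>mollify \<psi> v 1 (t *\<^sub>R y) - mollify \<psi> v 1 0\<bar> \<le> 2 * B' * (norm (t *\<^sub>R y - 0) / 1) * (1 powr (- (real DIM('a) / p)) * Lp_norm p v)"
        by (rule mollify_lipschitz[OF vL p _ \<psi> B']) (use ty in auto)
      moreover have "mollify \<psi> v 1 (t *\<^sub>R y) = S y"
        using mollify_translate[OF vm \<psi>, of 1 0 "t *\<^sub>R y"] by (simp add: S_def)
      moreover have "mollify \<psi> v 1 0 = J" by (simp add: mollify_def J_def)
      ultimately show ?thesis using ty t by simp
    qed
    have inner: "(LINT x|lborel. ?H x y) = \<phi> y * S y" for y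
    proof -
      have m: "(\<lambda>x. v x * \<psi> (x - t *\<^sub>R y)) \<in> borel_measurable lebesgue"
        by (intro measurable_completion) measurable
      have "(LINT x|lborel. ?H x y) = (LINT x|lebesgue. ?H x y)"
        by (rule integral_completion[symmetric]) measurable
      also have "\<dots> = \<phi> y * (LINT x|lebesgue. v (x + t *\<^sub>R y) * \<psi> x)" by (simp add: mult_ac flip: integral_mult_right_zero)
      also have "(LINT x|lebesgue. v (x + t *\<^sub>R y) * \<psi> x) = S y"
        using integral_affine[OF _ m, of 1 "t *\<^sub>R y"] by (simp add: S_def add.commute)
      finally show ?thesis .
    qed
    have Sm: "S \<in> borel_measurable lborel"
    proof -
      have "(\<lambda>y. LINT x|lborel. v x * \<psi> (x - t *\<^sub>R y)) \<in> borel_measurable lborel" by measurable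
      moreover have "S y = (LINT x|lborel. v x * \<psi> (x - t *\<^sub>R y))" for y
        unfolding S_def by (rule integral_completion) measurable
      ultimately show ?thesis by (simp add: S_def[abs_def])
    qed
    have "(LINT x|lebesgue. mollify \<phi> u t x * \<psi> x) = (LINT x|lebesgue. (LINT y|lborel. ?H x y))"
    proof (intro Bochner_Integration.integral_cong refl)
      fix x
      have "mollify \<phi> u t x = (LINT y|lborel. v (x + t *\<^sub>R y) * \<phi> y)"
        unfolding mv[OF t(1)] unfolding mollify_def by (rule integral_completion) measurable
      then show "mollify \<phi> u t x * \<psi> x = (LINT y|lborel. ?H x y)" by simp
    qed
    also have "\<dots> = (LINT x|lborel. LINT y|lborel. ?H x y)"
      by (rule integral_completion) measurable
    also have "\<dots> = (LINT y|lborel. \<phi> y * S y)" unfolding Fub inner ..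
    finally have eq: "(LINT x|lebesgue. mollify \<phi> u t x * \<psi> x) = (LINT y|lborel. \<phi> y * S y)" .
    have \<phi>i: "integrable lborel \<phi>" using test_function_integrable[OF \<phi>] by (simp add: integrable_completion)
    have eq2: "(LINT x|lebesgue. \<phi> x) * J = (LINT y|lborel. \<phi> y * J)"
      by (simp add: integral_completion)
    define E where "E = 2 * B' * (t * R) * Lp_norm p v"
    have E0: "E \<ge> 0" using B'(1) t R(1) Lp_norm_nonneg[of p v] by (simp add: E_def)
    have b: "\<bar>\<phi> y * S y - \<phi> y * J\<bar> \<le> E * \<bar>\<phi> y\<bar>" for y
    proof (cases "norm y \<le> R")
      case True
      have "\<bar>S y - J\<bar> \<le> 2 * B' * (t * norm y) * Lp_norm p v" by (rule S_close[OF True])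
      also have "\<dots> \<le> E" unfolding E_def using True B' t Lp_norm_nonneg by (intro mult_right_mono mult_left_mono) auto
      finally have "\<bar>\<phi> y\<bar> * \<bar>S y - J\<bar> \<le> \<bar>\<phi> y\<bar> * E" by (intro mult_left_mono) auto
      then show ?thesis by (simp add: mult.commute[of E] flip: right_diff_distrib abs_mult)
    qed (use R E0 in simp)
    have Ei: "integrable lborel (\<lambda>y. E * \<bar>\<phi> y\<bar>)" using \<phi>i by simp
    have di: "integrable lborel (\<lambda>y. \<phi> y * S y - \<phi> y * J)"
      by (rule Bochner_Integration.integrable_bound[OF Ei]) (use b Sm E0 in \<open>auto intro!: AE_I2\<close>)
    have Ji: "integrable lborel (\<lambda>y. \<phi> y * J)" using \<phi>i by simp
    have "(LINT y|lborel. \<phi> y * S y) = (LINT y|lborel. (\<phi> y * S y - \<phi> y * J) + \<phi> y * J)" by simp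
    also have "\<dots> = (LINT y|lborel. \<phi> y * S y - \<phi> y * J) + (LINT y|lborel. \<phi> y * J)"
      by (rule Bochner_Integration.integral_add[OF di Ji])
    finally have "(LINT x|lebesgue. mollify \<phi> u t x * \<psi> x) - (LINT x|lebesgue. \<phi> x) * J = (LINT y|lborel. \<phi> y * S y - \<phi> y * J)"
      unfolding eq eq2 by simp
    also have "\<bar>\<dots>\<bar> \<le> (LINT y|lborel. E * \<bar>\<phi> y\<bar>)"
      using Bochner_Integration.integral_norm_bound_integral[OF di Ei] b by simp
    also have "\<dots> = E * (LINT y|lebesgue. \<bar>\<phi> y\<bar>)" by (simp add: integral_completion)
    also have "\<dots> \<le> E * B" by (intro mult_left_mono B E0)
    finally show ?thesis by (simp add: E_def mult_ac)
  qed
  have "((\<lambda>t. (LINT x|lebesgue. mollify \<phi> u t x * \<psi> x) - (LINT x|lebesgue. \<phi> x) * J) \<longlongrightarrow> 0) (at_right 0)"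
  proof (rule Lim_null_comparison)
    show "\<forall>\<^sub>F t in at_right 0. norm ((LINT x|lebesgue. mollify \<phi> u t x * \<psi> x) - (LINT x|lebesgue. \<phi> x) * J) \<le> 2 * B' * R * Lp_norm p v * B * t"
      unfolding eventually_at_right_field
    proof (intro exI[of _ "1 / R"] conjI allI impI)
      show "0 < 1 / R" using R by simp
      fix t assume "0 < t" "t < 1 / R"
      then show "norm ((LINT x|lebesgue. mollify \<phi> u t x * \<psi> x) - (LINT x|lebesgue. \<phi> x) * J) \<le> 2 * B' * R * Lp_norm p v * B * t"
        using step[of t] R by (simp add: field_simps)
    qed
    have "((\<lambda>t. 2 * B' * R * Lp_norm p v * B * t) \<longlongrightarrow> 2 * B' * R * Lp_norm p v * B * 0) (at_right 0)"
      by (intro tendsto_intros)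
    then show "((\<lambda>t. 2 * B' * R * Lp_norm p v * B * t) \<longlongrightarrow> 0) (at_right 0)" by simp
  qed
  then show ?thesis unfolding J by (simp add: LIM_zero_iff)
qed

lemma continuous_locally_integrable:
  fixes f :: "'a::euclidean_space \<Rightarrow> real"
  assumes "continuous_on UNIV f"
  shows "locally_integrable f"
  unfolding locally_integrable_def set_integrable_def
proof (intro allI impI)
  fix K :: "'a set" assume "compact K"
  then have "integrable lborel (\<lambda>x. indicator K x *\<^sub>R f x)"
    using continuous_on_subset[OF assms subset_UNIV] by (rule borel_integrable_compact)
  then show "integrable lebesgue (\<lambda>x. indicat_real K x *\<^sub>R f x)"
    by (simp add: integrable_completion borel_measurable_integrable)
qed

lemma continuous_on_if_locally_lipschitz:
  fixes f :: "'a::euclidean_space \<Rightarrow> real"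
  assumes "t > 0" "\<And>x z. norm (z - x) \<le> t \<Longrightarrow> \<bar>f z - f x\<bar> \<le> c * norm (z - x)"
  shows "continuous_on UNIV f"
  unfolding continuous_on_eq_continuous_at[OF open_UNIV] isCont_def
proof
  fix x
  have "((\<lambda>z. f z - f x) \<longlongrightarrow> 0) (at x)"
  proof (rule Lim_null_comparison)
    have "\<forall>\<^sub>F z in at x. z \<in> ball x t"
      using assms(1) by (intro eventually_at_in_open') auto
    then show "\<forall>\<^sub>F z in at x. norm (f z - f x) \<le> c * norm (z - x)"
      by (rule eventually_mono) (use assms(2) in \<open>auto simp: dist_norm norm_minus_commute\<close>)
    have "((\<lambda>z. c * norm (z - x)) \<longlongrightarrow> c * norm (x - x)) (at x)" by (intro tendsto_intros)
    then show "((\<lambda>z. c * norm (z - x)) \<longlongrightarrow> 0) (at x)" by simp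
  qed
  then show "(f \<longlongrightarrow> f x) (at x)" by (simp add: LIM_zero_iff)
qed

lemma continuous_AE_eq_imp_eq:
  fixes v w :: "'a::euclidean_space \<Rightarrow> real"
  assumes "continuous_on UNIV v" "continuous_on UNIV w" "AE x in lebesgue. v x = w x"
  shows "v = w"
proof
  fix x
  have "closed {x. v x = w x}" by (intro closed_Collect_eq assms)
  moreover have "AE x in lebesgue. x \<in> {x. v x = w x}" using assms(3) by simp
  ultimately have "x \<in> {x. v x = w x}" using mem_closed_if_AE_lebesgue by blast
  then show "v x = w x" by simp
qed

lemma continuous_rep_eqI:
  fixes u :: "'a::euclidean_space \<Rightarrow> real"
  assumes "continuous_on UNIV w" "AE x in lebesgue. u x = w x"
  shows "continuous_rep u = w"
  unfolding continuous_rep_def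
proof (rule the_equality)
  fix v assume v: "continuous_on UNIV v \<and> (AE x in lebesgue. u x = v x)"
  have "AE x in lebesgue. v x = w x" using assms(2) conjunct2[OF v] by eventually_elim simp
  then show "v = w" using v assms(1) by (intro continuous_AE_eq_imp_eq) auto
qed (use assms in simp)

section \<open>Morrey's inequality\<close>

text \<open>
  The first estimate bounds the continuous representative, the second its modulus of continuity;
  the radius \<open>t\<close> is free in both. As \<open>t\<close> decreases, the gradient terms become small and the
  remaining terms large. The representative is the uniform limit of averages, and each estimate
  splits off the distance to the average of radius \<open>t\<close>.
\<close>

lemma Morrey:
  assumes p: "p > real DIM('a::euclidean_space)"
  shows "\<exists>C>0. \<forall>u\<in>W1p p. continuous_on UNIV (continuous_rep u) \<and> (AE x in lebesgue. u x = continuous_rep u x) \<and>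
    (\<forall>t>0. \<forall>x. \<bar>continuous_rep u x\<bar> \<le> C * (t powr (- (real DIM('a) / p)) * Lp_norm p u +
      t powr (1 - real DIM('a) / p) * Lp_norm p (weak_grad u))) \<and>
    (\<forall>t>0. \<forall>x z::'a. norm (z - x) \<le> t \<longrightarrow> \<bar>continuous_rep u z - continuous_rep u x\<bar> \<le>
      C * (norm (z - x) / t * (t powr (- (real DIM('a) / p)) * Lp_norm p u) +
      t powr (1 - real DIM('a) / p) * Lp_norm p (weak_grad u)))"
proof -
  define \<gamma> where "\<gamma> = 1 - real DIM('a) / p"
  have "real DIM('a) \<ge> 1" using DIM_positive[where 'a = 'a] by linarith
  then have p1: "p \<ge> 1" using p by linarith
  have \<gamma>: "\<gamma> > 0" using p p1 by (simp add: \<gamma>_def)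
  obtain \<phi> :: "'a \<Rightarrow> real" where \<phi>: "test_function \<phi>" and one: "(LINT x|lebesgue. \<phi> x) = 1"
    using bump_function_exists by metis
  obtain B where B: "B > 0" "\<And>x. \<bar>\<phi> x\<bar> \<le> B" "(LINT x|lebesgue. \<bar>\<phi> x\<bar>) \<le> B"
    "\<And>x. \<bar>norm x * \<phi> x\<bar> \<le> B" "(LINT x|lebesgue. \<bar>norm x * \<phi> x\<bar>) \<le> B"
    "\<And>e x. norm e \<le> 1 \<Longrightarrow> \<bar>\<phi> (x - e) - \<phi> x\<bar> \<le> B * norm e"
    "\<And>e. norm e \<le> 1 \<Longrightarrow> (LINT x|lebesgue. \<bar>\<phi> (x - e) - \<phi> x\<bar>) \<le> B * norm e"
    by (rule kernel_bounds[OF \<phi>]) (erule that, blast+)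
  define C where "C = 2 * B + 2 * (2 * B / \<gamma>)"
  have C0: "2 * B \<le> C" "2 * B / \<gamma> \<le> C" "2 * (2 * B / \<gamma>) \<le> C" "C > 0"
  proof -
    have "2 * B / \<gamma> \<ge> 0" using B(1) \<gamma> by simp
    then show "2 * B \<le> C" "2 * B / \<gamma> \<le> C" "2 * (2 * B / \<gamma>) \<le> C" "C > 0"
      unfolding C_def using B(1) by linarith+
  qed
  define h where "h n = inverse (real (Suc n))" for n
  have h: "h n > 0" for n by (auto simp: h_def)
  have h0: "h \<longlonglongrightarrow> 0" unfolding h_def by (rule LIMSEQ_inverse_real_of_nat)
  have h_mono: "h n \<le> h m" if "m \<le> n" for m n using that by (simp add: h_def le_imp_inverse_le)
  have hr: "filterlim h (at_right 0) sequentially"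
    using h0 h less_imp_neq[OF h] by (auto simp: filterlim_at intro!: always_eventually)
  have h\<gamma>: "(\<lambda>n. K * h n powr \<gamma>) \<longlonglongrightarrow> 0" for K
  proof -
    have "(\<lambda>n. h n powr \<gamma>) \<longlonglongrightarrow> 0 powr \<gamma>"
      using \<gamma> h by (intro tendsto_powr' h0 tendsto_const) (auto intro!: always_eventually less_imp_le)
    then have "(\<lambda>n. K * h n powr \<gamma>) \<longlonglongrightarrow> K * 0" by (intro tendsto_mult tendsto_const) simp
    then show ?thesis by simp
  qed
  have main: "continuous_on UNIV (continuous_rep u) \<and> (AE x in lebesgue. u x = continuous_rep u x) \<and>
    (\<forall>t>0. \<forall>x. \<bar>continuous_rep u x\<bar> \<le> C * (t powr (- (real DIM('a) / p)) * Lp_norm p u + t powr \<gamma> * Lp_norm p (weak_grad u))) \<and>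
    (\<forall>t>0. \<forall>x z::'a. norm (z - x) \<le> t \<longrightarrow> \<bar>continuous_rep u z - continuous_rep u x\<bar> \<le>
      C * (norm (z - x) / t * (t powr (- (real DIM('a) / p)) * Lp_norm p u) + t powr \<gamma> * Lp_norm p (weak_grad u)))"
    if "u \<in> W1p p" for u
  proof -
    note u = W1pD[OF that]
    define G where "G = Lp_norm p (weak_grad u)"
    define U where "U = Lp_norm p u"
    have G: "G \<ge> 0" and U: "U \<ge> 0" by (auto simp: G_def U_def Lp_norm_nonneg)
    define K where "K = 2 * B / \<gamma> * G"
    have K: "K \<ge> 0" using B(1) \<gamma> G by (simp add: K_def)
    have rad: "\<bar>mollify \<phi> u t x - mollify \<phi> u s x\<bar> \<le> K * t powr \<gamma>" if "0 < s" "s \<le> t" for s t x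
      using mollify_radial_increment[OF u(3,2) \<phi> p B(4,5) that, of x] by (simp add: K_def G_def \<gamma>_def)
    have lip: "\<bar>mollify \<phi> u t z - mollify \<phi> u t x\<bar> \<le> 2 * B * (norm (z - x) / t) * (t powr (- (real DIM('a) / p)) * U)"
      if "t > 0" "norm (z - x) \<le> t" for t x z
      using mollify_lipschitz[OF u(1) p1 that(1) \<phi> B(1,6,7) that(2)] by (simp add: U_def)
    have bd: "\<bar>mollify \<phi> u t x\<bar> \<le> 2 * B * (t powr (- (real DIM('a) / p)) * U)" if "t > 0" for t x
      using mollify_bound[OF u(1) p1 that \<phi> B(2,3)] by (simp add: U_def)
    define w where "w x = lim (\<lambda>n. mollify \<phi> u (h n) x)" for x
    have lim: "(\<lambda>n. mollify \<phi> u (h n) x) \<longlonglongrightarrow> w x" for x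
    proof -
      have "Cauchy (\<lambda>n. mollify \<phi> u (h n) x)"
      proof (rule metric_CauchyI)
        fix e :: real assume "e > 0"
        then obtain N where N: "K * h N powr \<gamma> < e / 2"
          using order_tendstoD(2)[OF h\<gamma>[of K], of "e / 2"] by (auto simp: eventually_sequentially)
        have "dist (mollify \<phi> u (h m) x) (mollify \<phi> u (h n) x) < e" if "m \<ge> N" "n \<ge> N" for m n
          using rad[OF h h_mono[OF that(1)], of x] rad[OF h h_mono[OF that(2)], of x] N by (simp add: dist_real_def abs_if split: if_splits)
        then show "\<exists>M. \<forall>m\<ge>M. \<forall>n\<ge>M. dist (mollify \<phi> u (h m) x) (mollify \<phi> u (h n) x) < e" by blast
      qed
      then show ?thesis unfolding w_def by (simp add: Cauchy_convergent_iff convergent_LIMSEQ_iff)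
    qed
    have mw: "\<bar>mollify \<phi> u t x - w x\<bar> \<le> K * t powr \<gamma>" if "t > 0" for t x
    proof (rule tendsto_upperbound)
      show "(\<lambda>n. \<bar>mollify \<phi> u t x - mollify \<phi> u (h n) x\<bar>) \<longlonglongrightarrow> \<bar>mollify \<phi> u t x - w x\<bar>"
        by (intro tendsto_intros lim)
      have "\<forall>\<^sub>F n in sequentially. h n < t" using order_tendstoD(2)[OF h0 that] .
      then show "\<forall>\<^sub>F n in sequentially. \<bar>mollify \<phi> u t x - mollify \<phi> u (h n) x\<bar> \<le> K * t powr \<gamma>"
        by (rule eventually_mono) (use rad[OF h] in auto)
    qed simp
    have mc: "continuous_on UNIV (mollify \<phi> u t)" if "t > 0" for t
      by (rule continuous_on_if_locally_lipschitz[OF that, of _ "2 * B / t * (t powr (- (real DIM('a) / p)) * U)"])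
        (use lip[OF that] in \<open>simp add: mult_ac\<close>)
    have wc: "continuous_on UNIV w"
    proof (rule uniform_limit_theorem)
      show "\<forall>\<^sub>F n in sequentially. continuous_on UNIV (mollify \<phi> u (h n))" using mc[OF h] by simp
      show "uniform_limit UNIV (\<lambda>n. mollify \<phi> u (h n)) w sequentially"
        unfolding uniform_limit_iff
      proof (intro allI impI)
        fix e :: real assume "e > 0"
        then have "\<forall>\<^sub>F n in sequentially. K * h n powr \<gamma> < e" by (rule order_tendstoD(2)[OF h\<gamma>[of K]])
        then show "\<forall>\<^sub>F n in sequentially. \<forall>x\<in>UNIV. dist (mollify \<phi> u (h n) x) (w x) < e"
          by (rule eventually_mono) (use mw[OF h] in \<open>auto simp: dist_real_def intro: order_le_less_trans\<close>)
      qed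
    qed simp
    have wi: "locally_integrable w" by (rule continuous_locally_integrable[OF wc])
    have ui: "locally_integrable u" by (rule Lp_locally_integrable[OF u(1) p1])
    have "AE x in lebesgue. 1 *\<^sub>R w x + (-1) *\<^sub>R u x = 0"
    proof (rule fundamental_lemma)
      show "locally_integrable (\<lambda>x. 1 *\<^sub>R w x + (-1) *\<^sub>R u x)" by (intro locally_integrable_lincomb wi ui)
      fix \<psi> :: "'a \<Rightarrow> real" assume \<psi>: "test_function \<psi>"
      have mi: "integrable lebesgue (\<lambda>x. mollify \<phi> u (h n) x * \<psi> x)" for n
        by (intro integrable_test_mult continuous_locally_integrable mc h \<psi>)
      have 1: "(\<lambda>n. LINT x|lebesgue. mollify \<phi> u (h n) x * \<psi> x) \<longlonglongrightarrow> (LINT x|lebesgue. u x * \<psi> x)"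
        using filterlim_compose[OF mollify_weak_limit[OF u(1) p1 \<phi> \<psi>] hr] by (simp add: one)
      have "(\<lambda>n. (LINT x|lebesgue. mollify \<phi> u (h n) x * \<psi> x) - (LINT x|lebesgue. w x * \<psi> x)) \<longlonglongrightarrow> 0"
      proof (rule Lim_null_comparison[OF always_eventually, OF allI])
        fix n
        have "(LINT x|lebesgue. mollify \<phi> u (h n) x * \<psi> x) - (LINT x|lebesgue. w x * \<psi> x)
          = (LINT x|lebesgue. mollify \<phi> u (h n) x * \<psi> x - w x * \<psi> x)"
          by (rule Bochner_Integration.integral_diff[symmetric, OF mi integrable_test_mult[OF wi \<psi>]])
        also have "norm \<dots> \<le> (LINT x|lebesgue. (K * h n powr \<gamma>) * \<bar>\<psi> x\<bar>)"
        proof (rule Bochner_Integration.integral_norm_bound_integral)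
          show "integrable lebesgue (\<lambda>x. mollify \<phi> u (h n) x * \<psi> x - w x * \<psi> x)"
            by (rule Bochner_Integration.integrable_diff[OF mi integrable_test_mult[OF wi \<psi>]])
          show "integrable lebesgue (\<lambda>x. (K * h n powr \<gamma>) * \<bar>\<psi> x\<bar>)"
            by (intro integrable_mult_right integrable_abs test_function_integrable \<psi>)
          show "norm (mollify \<phi> u (h n) x * \<psi> x - w x * \<psi> x) \<le> (K * h n powr \<gamma>) * \<bar>\<psi> x\<bar>" for x
            using mult_right_mono[OF mw[OF h[of n], of x], of "\<bar>\<psi> x\<bar>"] by (simp add: abs_mult flip: left_diff_distrib)
        qed
        also have "\<dots> = (K * (LINT x|lebesgue. \<bar>\<psi> x\<bar>)) * h n powr \<gamma>" by simp
        finally show "norm ((LINT x|lebesgue. mollify \<phi> u (h n) x * \<psi> x) - (LINT x|lebesgue. w x * \<psi> x)) \<le> \<dots>" .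
      qed (rule h\<gamma>)
      then have 2: "(\<lambda>n. LINT x|lebesgue. mollify \<phi> u (h n) x * \<psi> x) \<longlonglongrightarrow> (LINT x|lebesgue. w x * \<psi> x)"
        by (simp add: LIM_zero_iff)
      have "(LINT x|lebesgue. (1 *\<^sub>R w x + (-1) *\<^sub>R u x) * \<psi> x) = (LINT x|lebesgue. w x * \<psi> x - u x * \<psi> x)"
        by (simp add: left_diff_distrib)
      also have "\<dots> = (LINT x|lebesgue. w x * \<psi> x) - (LINT x|lebesgue. u x * \<psi> x)"
        by (rule Bochner_Integration.integral_diff[OF integrable_test_mult[OF wi \<psi>] integrable_test_mult[OF ui \<psi>]])
      also have "\<dots> = 0" using LIMSEQ_unique[OF 1 2] by simp
      finally show "(LINT x|lebesgue. (1 *\<^sub>R w x + (-1) *\<^sub>R u x) * \<psi> x) = 0" .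
    qed
    then have AE: "AE x in lebesgue. u x = w x" by (rule AE_mp) simp
    have rep: "continuous_rep u = w" by (rule continuous_rep_eqI[OF wc AE])
    have KC: "K \<le> C * G" "2 * K \<le> C * G"
      using mult_right_mono[OF C0(2) G] mult_right_mono[OF C0(3) G] by (auto simp: K_def)
    have 1: "\<bar>w x\<bar> \<le> C * (t powr (- (real DIM('a) / p)) * U + t powr \<gamma> * G)" if "t > 0" for t x
    proof -
      have "\<bar>w x\<bar> \<le> 2 * B * (t powr (- (real DIM('a) / p)) * U) + K * t powr \<gamma>"
        using bd[OF that, of x] mw[OF that, of x] by linarith
      also have "\<dots> \<le> C * (t powr (- (real DIM('a) / p)) * U) + (C * G) * t powr \<gamma>"
        using C0 KC U by (intro add_mono mult_right_mono) auto
      finally show ?thesis by (simp add: algebra_simps)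
    qed
    have 2: "\<bar>w z - w x\<bar> \<le> C * (norm (z - x) / t * (t powr (- (real DIM('a) / p)) * U) + t powr \<gamma> * G)"
      if "t > 0" "norm (z - x) \<le> t" for t x z
    proof -
      have "\<bar>w z - w x\<bar> \<le> 2 * B * (norm (z - x) / t) * (t powr (- (real DIM('a) / p)) * U) + (2 * K) * t powr \<gamma>"
        using lip[OF that] mw[OF that(1), of x] mw[OF that(1), of z] by linarith
      also have "\<dots> \<le> C * (norm (z - x) / t) * (t powr (- (real DIM('a) / p)) * U) + (C * G) * t powr \<gamma>"
        using C0 KC U that by (intro add_mono mult_right_mono) auto
      finally show ?thesis by (simp add: algebra_simps)
    qed
    show ?thesis unfolding rep U_def[symmetric] G_def[symmetric] using wc AE 1 2 by blast
  qed
  then show ?thesis using C0(4) unfolding \<gamma>_def by blast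
qed

section \<open>Operations on Sobolev functions\<close>

lemma W1p_lincomb:
  fixes u v :: "'a::euclidean_space \<Rightarrow> real"
  assumes u: "u \<in> W1p p" and v: "v \<in> W1p p" and p: "p \<ge> 0"
  shows "(\<lambda>x. a * u x + b * v x) \<in> W1p p"
    "Lp_power p (weak_grad (\<lambda>x. a * u x + b * v x)) = Lp_power p (\<lambda>x. a *\<^sub>R weak_grad u x + b *\<^sub>R weak_grad v x)"
proof -
  note U = W1pD[OF u] and V = W1pD[OF v]
  have L: "(\<lambda>x. a * u x + b * v x) \<in> Lp p" using Lp_lincomb[OF U(1) V(1) p, of a b] by simp
  note * = W1pI[OF L Lp_lincomb[OF U(2) V(2) p] is_weak_gradient_lincomb[OF U(3) V(3)]]
  show "(\<lambda>x. a * u x + b * v x) \<in> W1p p" by (rule *)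
  show "Lp_power p (weak_grad (\<lambda>x. a * u x + b * v x)) = Lp_power p (\<lambda>x. a *\<^sub>R weak_grad u x + b *\<^sub>R weak_grad v x)" by (rule *)
qed

lemma continuous_rep_lincomb:
  fixes u v :: "'a::euclidean_space \<Rightarrow> real"
  assumes u: "u \<in> W1p p" and v: "v \<in> W1p p" and p: "p > real DIM('a)"
  shows "continuous_rep (\<lambda>x. a * u x + b * v x) = (\<lambda>x. a * continuous_rep u x + b * continuous_rep v x)"
proof (rule continuous_rep_eqI)
  have U: "continuous_on UNIV (continuous_rep u)" "AE x in lebesgue. u x = continuous_rep u x"
    and V: "continuous_on UNIV (continuous_rep v)" "AE x in lebesgue. v x = continuous_rep v x"
    using Morrey[OF p] u v by blast+
  show "continuous_on UNIV (\<lambda>x. a * continuous_rep u x + b * continuous_rep v x)" by (intro continuous_intros U V)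
  show "AE x in lebesgue. a * u x + b * v x = a * continuous_rep u x + b * continuous_rep v x"
    using U(2) V(2) by eventually_elim simp
qed

lemma W1p_rescale:
  fixes u :: "'a::euclidean_space \<Rightarrow> real" and c s :: real
  assumes u: "u \<in> W1p p" and s: "s > 0" and p: "p > real DIM('a)"
  defines "w \<equiv> \<lambda>x. c * u (s *\<^sub>R x)"
  shows "w \<in> W1p p" "Lp_power p w = \<bar>c\<bar> powr p * Lp_power p u / s ^ DIM('a)"
    "Lp_power p (weak_grad w) = \<bar>c\<bar> powr p * s powr p * Lp_power p (weak_grad u) / s ^ DIM('a)"
    "continuous_rep w = (\<lambda>x. c * continuous_rep u (s *\<^sub>R x))"
proof -
  note U = W1pD[OF u]
  have p0: "p \<ge> 0" using p by simp
  have s0: "s \<noteq> 0" using s by simp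
  note A = Lp_affine[OF U(1) s0, of 0] and G = Lp_affine[OF U(2) s0, of 0]
  have L: "w \<in> Lp p" "Lp_power p w = \<bar>c\<bar> powr p * Lp_power p u / s ^ DIM('a)"
    using Lp_scale[OF A(1), of c] A(2) s unfolding w_def by (auto simp: abs_of_pos)
  have Lg: "(\<lambda>x. (c * s) *\<^sub>R weak_grad u (s *\<^sub>R x)) \<in> Lp p"
    "Lp_power p (\<lambda>x. (c * s) *\<^sub>R weak_grad u (s *\<^sub>R x)) = \<bar>c\<bar> powr p * s powr p * Lp_power p (weak_grad u) / s ^ DIM('a)"
    using Lp_scale[OF G(1), of "c * s"] G(2) s by (auto simp: abs_mult powr_mult)
  have W: "is_weak_gradient w (\<lambda>x. (c * s) *\<^sub>R weak_grad u (s *\<^sub>R x))"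
    using is_weak_gradient_lincomb[OF is_weak_gradient_affine[OF U(3) s0, of 0] is_weak_gradient_affine[OF U(3) s0, of 0], of c 0]
    unfolding w_def by simp
  show "w \<in> W1p p" by (rule W1pI(1)[OF L(1) Lg(1) W])
  show "Lp_power p w = \<bar>c\<bar> powr p * Lp_power p u / s ^ DIM('a)" by (rule L)
  show "Lp_power p (weak_grad w) = \<bar>c\<bar> powr p * s powr p * Lp_power p (weak_grad u) / s ^ DIM('a)"
    using W1pI(3)[OF L(1) Lg(1) W] Lg(2) by simp
  have R: "continuous_on UNIV (continuous_rep u)" "AE x in lebesgue. u x = continuous_rep u x"
    using Morrey[OF p] u by blast+
  show "continuous_rep w = (\<lambda>x. c * continuous_rep u (s *\<^sub>R x))"
  proof (rule continuous_rep_eqI)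
    show "continuous_on UNIV (\<lambda>x. c * continuous_rep u (s *\<^sub>R x))"
      by (intro continuous_intros continuous_on_compose2[OF R(1)]) auto
    show "AE x in lebesgue. w x = c * continuous_rep u (s *\<^sub>R x)"
      using AE_affine[OF s0 R(2), of 0] unfolding w_def by (rule AE_mp) simp
  qed
qed

section \<open>The rescaled energy\<close>

text \<open>
  The functional minimized by the rescaled ground states. The value \<open>\<epsilon> = 0\<close> is the limit functional, with the
  integral of \<open>V\<close> as coupling constant, so a single definition covers the sequence and its limit.
\<close>

definition scaled_energy :: "real \<Rightarrow> ('a::euclidean_space \<Rightarrow> real) \<Rightarrow> real \<Rightarrow> ('a \<Rightarrow> real) \<Rightarrow> real" where
  "scaled_energy p V \<epsilon> u = Lp_power p (weak_grad u) - (LINT y|lebesgue. V y * \<bar>continuous_rep u (\<epsilon> *\<^sub>R y)\<bar> powr p)"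

lemma scaled_energy_0:
  "p > 0 \<Longrightarrow> scaled_energy p V 0 u = Lp_power p (weak_grad u) - (LINT y|lebesgue. V y) * \<bar>continuous_rep u 0\<bar> powr p"
  by (simp add: scaled_energy_def)

lemma delta_functional_eq:
  "p > 0 \<Longrightarrow> delta_functional p (LINT y|lebesgue. V y) u = scaled_energy p V 0 u"
  by (simp add: scaled_energy_0 delta_functional_def Lp_norm_powr)

lemma Lp_norm_eq_1_iff: "p > 0 \<Longrightarrow> Lp_norm p f = 1 \<longleftrightarrow> Lp_power p f = 1"
  using Lp_norm_powr[of p f] Lp_norm_eq[of p f] by auto

lemma potential_integrable:
  fixes V w :: "'a::euclidean_space \<Rightarrow> real"
  assumes V: "integrable lebesgue V" and w: "continuous_on UNIV w" "\<And>x. \<bar>w x\<bar> \<le> S" and p: "p > 0"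
  shows "integrable lebesgue (\<lambda>y. V y * \<bar>w (\<epsilon> *\<^sub>R y)\<bar> powr p)"
    and "\<bar>LINT y|lebesgue. V y * \<bar>w (\<epsilon> *\<^sub>R y)\<bar> powr p\<bar> \<le> (LINT y|lebesgue. \<bar>V y\<bar>) * S powr p"
proof -
  have "continuous_on UNIV (\<lambda>y. \<bar>w (\<epsilon> *\<^sub>R y)\<bar> powr p)"
    using p by (intro continuous_on_powr' continuous_intros continuous_on_compose2[OF w(1)]) auto
  then have wm: "(\<lambda>y. \<bar>w (\<epsilon> *\<^sub>R y)\<bar> powr p) \<in> borel_measurable lebesgue"
    by (intro locally_integrable_measurable continuous_locally_integrable)
  have le: "norm (V y * \<bar>w (\<epsilon> *\<^sub>R y)\<bar> powr p) \<le> \<bar>V y\<bar> * S powr p" for y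
  proof -
    have "\<bar>w (\<epsilon> *\<^sub>R y)\<bar> powr p \<le> S powr p" using p w(2) by (intro powr_mono2) auto
    then show ?thesis by (simp add: abs_mult mult_left_mono)
  qed
  have i: "integrable lebesgue (\<lambda>y. \<bar>V y\<bar> * S powr p)" using V by (intro integrable_mult_left integrable_abs)
  show j: "integrable lebesgue (\<lambda>y. V y * \<bar>w (\<epsilon> *\<^sub>R y)\<bar> powr p)"
    by (rule Bochner_Integration.integrable_bound[OF i borel_measurable_times[OF borel_measurable_integrable[OF V] wm]])
      (use le in \<open>auto intro!: AE_I2 intro: order_trans\<close>)
  have "norm (LINT y|lebesgue. V y * \<bar>w (\<epsilon> *\<^sub>R y)\<bar> powr p) \<le> (LINT y|lebesgue. \<bar>V y\<bar> * S powr p)"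
    by (rule Bochner_Integration.integral_norm_bound_integral[OF j i le])
  then show "\<bar>LINT y|lebesgue. V y * \<bar>w (\<epsilon> *\<^sub>R y)\<bar> powr p\<bar> \<le> (LINT y|lebesgue. \<bar>V y\<bar>) * S powr p" by simp
qed

text \<open>
  The \<open>p\<close>-th power of Morrey's bound. As \<open>p > d\<close>, the coefficient of the gradient term can be made
  arbitrarily small by the choice of \<open>t\<close>.
\<close>

lemma W1p_sup_bound:
  assumes p: "p > real DIM('a::euclidean_space)"
  shows "\<exists>C>0. \<forall>t>0. \<forall>u\<in>W1p p. \<forall>x::'a. \<bar>continuous_rep u x\<bar> powr p \<le>
    C * (t powr (- real DIM('a)) * Lp_power p u + t powr (p - real DIM('a)) * Lp_power p (weak_grad u))"
proof -
  obtain C where C: "C > 0" "\<And>u t x. u \<in> W1p p \<Longrightarrow> t > 0 \<Longrightarrow> \<bar>continuous_rep u (x::'a)\<bar> \<le> C * (t powr (- (real DIM('a) / p)) * Lp_norm p u +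
      t powr (1 - real DIM('a) / p) * Lp_norm p (weak_grad u))"
    using Morrey[OF p] by blast
  have p0: "p > 0" using p by (rule le_less_trans[rotated]) simp
  show ?thesis
  proof (intro exI[of _ "C powr p * 2 powr p"] conjI allI impI ballI)
    fix t :: real and u :: "'a \<Rightarrow> real" and x :: 'a assume t: "t > 0" and u: "u \<in> W1p p"
    define A where "A = t powr (- (real DIM('a) / p)) * Lp_norm p u"
    define B where "B = t powr (1 - real DIM('a) / p) * Lp_norm p (weak_grad u)"
    have AB: "A \<ge> 0" "B \<ge> 0" by (auto simp: A_def B_def Lp_norm_nonneg)
    have "\<bar>continuous_rep u x\<bar> powr p \<le> (C * (A + B)) powr p"
      using C(2)[OF u t, of x] p0 by (intro powr_mono2) (auto simp: A_def B_def)
    also have "\<dots> = C powr p * (A + B) powr p" using C(1) AB by (simp add: powr_mult)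
    also have "\<dots> \<le> C powr p * (2 powr p * (A powr p + B powr p))"
      using p0 AB by (intro mult_left_mono powr_add_le) auto
    also have "A powr p = t powr (- real DIM('a)) * Lp_power p u"
      using p0 Lp_norm_nonneg by (simp add: A_def powr_mult Lp_norm_powr powr_powr)
    also have "B powr p = t powr ((1 - real DIM('a) / p) * p) * Lp_power p (weak_grad u)"
      using p0 Lp_norm_nonneg by (simp add: B_def powr_mult Lp_norm_powr powr_powr)
    also have "(1 - real DIM('a) / p) * p = p - real DIM('a)" using p0 by (simp add: field_simps)
    finally show "\<bar>continuous_rep u x\<bar> powr p \<le> C powr p * 2 powr p * (t powr (- real DIM('a)) * Lp_power p u + t powr (p - real DIM('a)) * Lp_power p (weak_grad u))"
      by (simp add: mult.assoc)
  qed (use C in simp)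
qed

lemma W1p_continuous_rep:
  fixes u :: "'a::euclidean_space \<Rightarrow> real"
  assumes p: "p > real DIM('a)" and u: "u \<in> W1p p"
  shows "continuous_on UNIV (continuous_rep u)" "AE x in lebesgue. u x = continuous_rep u x"
    "\<exists>S. \<forall>x. \<bar>continuous_rep u x\<bar> \<le> S"
proof -
  show "continuous_on UNIV (continuous_rep u)" "AE x in lebesgue. u x = continuous_rep u x"
    using Morrey[OF p] u by blast+
  show "\<exists>S. \<forall>x. \<bar>continuous_rep u x\<bar> \<le> S"
    using Morrey[OF p] u zero_less_one[where 'a = real] by blast
qed

text \<open>
  The radius \<open>t\<close> in \<open>W1p_sup_bound\<close> is chosen such that the potential absorbs at most half of the
  gradient term, uniformly in \<open>\<epsilon>\<close>.
\<close>

lemma scaled_energy_lower_bound: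
  fixes V :: "'a::euclidean_space \<Rightarrow> real"
  assumes p: "p > real DIM('a)" and V: "integrable lebesgue V"
  shows "\<exists>C\<ge>0. \<forall>\<epsilon>. \<forall>u\<in>W1p p. scaled_energy p V \<epsilon> u \<ge> Lp_power p (weak_grad u) / 2 - C * Lp_power p u"
proof -
  obtain C where C: "C > 0" "\<And>u t x. u \<in> W1p p \<Longrightarrow> t > 0 \<Longrightarrow> \<bar>continuous_rep u (x::'a)\<bar> powr p \<le>
    C * (t powr (- real DIM('a)) * Lp_power p u + t powr (p - real DIM('a)) * Lp_power p (weak_grad u))"
    using W1p_sup_bound[OF p] by blast
  have p0: "p > 0" using p by (rule le_less_trans[rotated]) simp
  define N where "N = (LINT y|lebesgue. \<bar>V y\<bar>)"
  have N: "N \<ge> 0" by (simp add: N_def)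
  define b where "b = 2 * (N * C + 1)"
  have b: "b > 0" using N C by (simp add: b_def add_nonneg_pos)
  \<comment> \<open>This choice gives \<open>N * C * t powr (p - DIM('a)) < 1 / 2\<close>.\<close>
  define t where "t = (1 / b) powr (1 / (p - real DIM('a)))"
  have t: "t > 0" using b by (simp add: t_def)
  have "t powr (p - real DIM('a)) = 1 / b" using b p by (simp add: t_def powr_powr)
  then have "b * t powr (p - real DIM('a)) = 1" using b by simp
  then have "N * C * t powr (p - real DIM('a)) = 1/2 - t powr (p - real DIM('a))"
    by (simp add: b_def algebra_simps)
  then have Nt: "N * C * t powr (p - real DIM('a)) \<le> 1/2" by simp
  show ?thesis
  proof (intro exI[of _ "N * C * t powr (- real DIM('a))"] conjI allI ballI)
    show "0 \<le> N * C * t powr (- real DIM('a))" using N C by simp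
    fix \<epsilon> and u :: "'a \<Rightarrow> real" assume u: "u \<in> W1p p"
    define T where "T = C * (t powr (- real DIM('a)) * Lp_power p u + t powr (p - real DIM('a)) * Lp_power p (weak_grad u))"
    have T: "T \<ge> 0" using C by (simp add: T_def Lp_power_nonneg)
    have le: "\<bar>continuous_rep u x\<bar> \<le> T powr (1 / p)" for x
    proof -
      have "(\<bar>continuous_rep u x\<bar> powr p) powr (1 / p) \<le> T powr (1 / p)"
        using p0 C(2)[OF u t, of x] by (intro powr_mono2) (auto simp: T_def)
      then show ?thesis using p0 by (simp add: powr_powr)
    qed
    have "\<bar>LINT y|lebesgue. V y * \<bar>continuous_rep u (\<epsilon> *\<^sub>R y)\<bar> powr p\<bar> \<le> N * (T powr (1 / p)) powr p"
      unfolding N_def by (rule potential_integrable(2)[OF V W1p_continuous_rep(1)[OF p u] le p0])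
    also have "(T powr (1 / p)) powr p = T" using p0 T by (simp add: powr_powr)
    also have "N * T = N * C * t powr (- real DIM('a)) * Lp_power p u + (N * C * t powr (p - real DIM('a))) * Lp_power p (weak_grad u)"
      by (simp add: T_def algebra_simps)
    also have "\<dots> \<le> N * C * t powr (- real DIM('a)) * Lp_power p u + (1/2) * Lp_power p (weak_grad u)"
      by (intro add_left_mono mult_right_mono Nt Lp_power_nonneg)
    finally show "scaled_energy p V \<epsilon> u \<ge> Lp_power p (weak_grad u) / 2 - N * C * t powr (- real DIM('a)) * Lp_power p u"
      unfolding scaled_energy_def by (simp add: abs_le_iff)
  qed
qed

text \<open>
  Uniform continuity of the power function on a bounded interval.
\<close>

lemma powr_diff_tendsto_0:
  fixes a b :: "nat \<Rightarrow> real"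
  assumes "\<And>n. \<bar>a n\<bar> \<le> S" "\<And>n. \<bar>b n\<bar> \<le> S" "(\<lambda>n. a n - b n) \<longlonglongrightarrow> 0" "p > 0"
  shows "(\<lambda>n. \<bar>a n\<bar> powr p - \<bar>b n\<bar> powr p) \<longlonglongrightarrow> 0"
proof -
  have "uniformly_continuous_on {-S..S} (\<lambda>x. \<bar>x\<bar> powr p)"
    using assms(4) by (intro compact_uniformly_continuous continuous_on_powr' continuous_intros) auto
  moreover have "\<forall>n. a n \<in> {-S..S}" "\<forall>n. b n \<in> {-S..S}" using assms(1,2) by (auto simp: abs_le_iff minus_le_iff)
  moreover have "(\<lambda>n. dist (a n) (b n)) \<longlonglongrightarrow> 0"
    using tendsto_rabs_zero[OF assms(3)] by (simp add: dist_real_def)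
  ultimately have "(\<lambda>n. dist (\<bar>a n\<bar> powr p) (\<bar>b n\<bar> powr p)) \<longlonglongrightarrow> 0"
    unfolding uniformly_continuous_on_sequentially by blast
  then show ?thesis by (simp add: dist_real_def tendsto_rabs_zero_iff)
qed

text \<open>
  Dominated convergence: boundedness in the Sobolev space gives a common sup bound and equicontinuity
  at the origin, hence pointwise convergence of the integrands' difference. Applied to a
  constant sequence it gives convergence of the energy of a fixed competitor, and applied to the
  rescaled ground states it compares their energies with the limit energy.
\<close>

lemma scaled_energy_tendsto:
  fixes V :: "'a::euclidean_space \<Rightarrow> real"
  assumes p: "p > real DIM('a)" and V: "integrable lebesgue V"
    and u: "\<And>n. u n \<in> W1p p" "\<And>n. Lp_power p (u n) \<le> A" "\<And>n. Lp_power p (weak_grad (u n)) \<le> A"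
    and \<epsilon>: "\<epsilon> \<longlonglongrightarrow> 0"
  shows "(\<lambda>n. scaled_energy p V (\<epsilon> n) (u n) - scaled_energy p V 0 (u n)) \<longlonglongrightarrow> 0"
proof -
  obtain C where C: "C > 0" and M1: "\<And>u t x. u \<in> W1p p \<Longrightarrow> t > 0 \<Longrightarrow> \<bar>continuous_rep u (x::'a)\<bar> \<le> C * (t powr (- (real DIM('a) / p)) * Lp_norm p u +
      t powr (1 - real DIM('a) / p) * Lp_norm p (weak_grad u))"
    and M2: "\<And>u t x z. u \<in> W1p p \<Longrightarrow> t > 0 \<Longrightarrow> norm (z - x) \<le> t \<Longrightarrow> \<bar>continuous_rep u (z::'a) - continuous_rep u x\<bar> \<le>
      C * (norm (z - x) / t * (t powr (- (real DIM('a) / p)) * Lp_norm p u) + t powr (1 - real DIM('a) / p) * Lp_norm p (weak_grad u))"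
    using Morrey[OF p] by blast
  have p0: "p > 0" using p by (rule le_less_trans[rotated]) simp
  define \<gamma> where "\<gamma> = 1 - real DIM('a) / p"
  have \<gamma>: "\<gamma> > 0" using p p0 by (simp add: \<gamma>_def)
  define T where "T = A powr (1 / p)"
  have nT: "Lp_norm p (u n) \<le> T" "Lp_norm p (weak_grad (u n)) \<le> T" for n
    unfolding Lp_norm_eq T_def using u(2,3)[of n] p0 Lp_power_nonneg by (auto intro!: powr_mono2)
  have T: "T \<ge> 0" by (simp add: T_def)
  define S where "S = C * (T + T)"
  have S: "\<bar>continuous_rep (u n) x\<bar> \<le> S" for n x
  proof -
    have "\<bar>continuous_rep (u n) x\<bar> \<le> C * (Lp_norm p (u n) + Lp_norm p (weak_grad (u n)))"
      using M1[OF u(1), of 1 n x] by simp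
    also have "\<dots> \<le> S" unfolding S_def using C by (intro mult_left_mono add_mono nT) auto
    finally show ?thesis .
  qed
  have pt: "(\<lambda>n. continuous_rep (u n) (\<epsilon> n *\<^sub>R y) - continuous_rep (u n) 0) \<longlonglongrightarrow> 0" for y
  proof (rule LIMSEQ_I)
    fix e :: real assume e: "e > 0"
    \<comment> \<open>The radius \<open>t\<close> makes the gradient term smaller than \<open>e / 2\<close>; then \<open>\<epsilon> n\<close> is taken small.\<close>
    define b where "b = C * T + 1"
    have b: "b > 0" using C T by (simp add: b_def add_nonneg_pos)
    define t where "t = (e / (2 * b)) powr (1 / \<gamma>)"
    have t: "t > 0" using e b by (simp add: t_def)
    have "t powr \<gamma> = e / (2 * b)" using e b \<gamma> by (simp add: t_def powr_powr)
    then have "b * t powr \<gamma> = e / 2" using b by simp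
    then have "C * (t powr \<gamma> * T) = e / 2 - t powr \<gamma>" by (simp add: b_def algebra_simps)
    then have t1: "C * (t powr \<gamma> * T) < e / 2" using t by simp
    define c where "c = C * (t powr (- (real DIM('a) / p)) * T) / t"
    have c: "c \<ge> 0" using C T t by (simp add: c_def)
    have "(\<lambda>n. norm (\<epsilon> n *\<^sub>R y)) \<longlonglongrightarrow> norm (0 *\<^sub>R y)" by (intro tendsto_intros \<epsilon>)
    then have z0: "(\<lambda>n. norm (\<epsilon> n *\<^sub>R y)) \<longlonglongrightarrow> 0" by simp
    then have "(\<lambda>n. c * norm (\<epsilon> n *\<^sub>R y)) \<longlonglongrightarrow> c * 0" by (intro tendsto_mult tendsto_const)
    then have ev: "\<forall>\<^sub>F n in sequentially. c * norm (\<epsilon> n *\<^sub>R y) < e / 2" using e by (intro order_tendstoD(2)) auto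
    have "\<forall>\<^sub>F n in sequentially. norm (continuous_rep (u n) (\<epsilon> n *\<^sub>R y) - continuous_rep (u n) 0 - 0) < e"
      using order_tendstoD(2)[OF z0 t] ev
    proof eventually_elim
      case (elim n)
      define z where "z = \<epsilon> n *\<^sub>R y"
      have "\<bar>continuous_rep (u n) z - continuous_rep (u n) 0\<bar> \<le> C * (norm (z - 0) / t * (t powr (- (real DIM('a) / p)) * Lp_norm p (u n)) + t powr \<gamma> * Lp_norm p (weak_grad (u n)))"
        unfolding \<gamma>_def by (rule M2[OF u(1) t]) (use elim z_def in auto)
      also have "\<dots> \<le> C * (norm (z - 0) / t * (t powr (- (real DIM('a) / p)) * T) + t powr \<gamma> * T)"
        using C t nT by (intro mult_left_mono add_mono) auto
      also have "\<dots> = c * norm z + C * (t powr \<gamma> * T)" by (simp add: c_def algebra_simps)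
      also have "\<dots> < e / 2 + e / 2" using elim t1 by (intro add_strict_mono) (auto simp: z_def)
      finally show ?case by (simp add: z_def)
    qed
    then show "\<exists>no. \<forall>n\<ge>no. norm (continuous_rep (u n) (\<epsilon> n *\<^sub>R y) - continuous_rep (u n) 0 - 0) < e"
      by (simp add: eventually_sequentially)
  qed
  let ?F = "\<lambda>\<epsilon> n y. V y * \<bar>continuous_rep (u n) (\<epsilon> *\<^sub>R y)\<bar> powr p"
  have Fi: "integrable lebesgue (?F \<epsilon> n)" for \<epsilon> n
    by (rule potential_integrable(1)[OF V W1p_continuous_rep(1)[OF p u(1)] S p0])
  have "(\<lambda>n. LINT y|lebesgue. ?F (\<epsilon> n) n y - ?F 0 n y) \<longlonglongrightarrow> (LINT y|(lebesgue::'a measure). 0)"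
  proof (rule integral_dominated_convergence)
    show "integrable lebesgue (\<lambda>y. \<bar>V y\<bar> * (2 * S powr p))" using V by (intro integrable_mult_left integrable_abs)
    show "(\<lambda>y. ?F (\<epsilon> n) n y - ?F 0 n y) \<in> borel_measurable lebesgue" for n
      by (intro borel_measurable_diff borel_measurable_integrable Fi)
    show "AE y in lebesgue. (\<lambda>n. ?F (\<epsilon> n) n y - ?F 0 n y) \<longlonglongrightarrow> 0"
    proof (rule AE_I2)
      fix y
      have "(\<lambda>n. V y * (\<bar>continuous_rep (u n) (\<epsilon> n *\<^sub>R y)\<bar> powr p - \<bar>continuous_rep (u n) 0\<bar> powr p)) \<longlonglongrightarrow> V y * 0"
        by (intro tendsto_mult tendsto_const powr_diff_tendsto_0[OF S S pt p0])
      then show "(\<lambda>n. ?F (\<epsilon> n) n y - ?F 0 n y) \<longlonglongrightarrow> 0" by (simp add: right_diff_distrib)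
    qed
    show "AE y in lebesgue. norm (?F (\<epsilon> n) n y - ?F 0 n y) \<le> \<bar>V y\<bar> * (2 * S powr p)" for n
    proof (rule AE_I2)
      fix y
      have "\<bar>continuous_rep (u n) x\<bar> powr p \<le> S powr p" for x using S p0 by (intro powr_mono2) auto
      from this[of "\<epsilon> n *\<^sub>R y"] this[of 0]
      have "\<bar>\<bar>continuous_rep (u n) (\<epsilon> n *\<^sub>R y)\<bar> powr p - \<bar>continuous_rep (u n) 0\<bar> powr p\<bar> \<le> 2 * S powr p"
        using powr_ge_zero[of "\<bar>continuous_rep (u n) (\<epsilon> n *\<^sub>R y)\<bar>" p] powr_ge_zero[of "\<bar>continuous_rep (u n) 0\<bar>" p] by linarith
      then have "\<bar>V y\<bar> * \<bar>\<bar>continuous_rep (u n) (\<epsilon> n *\<^sub>R y)\<bar> powr p - \<bar>continuous_rep (u n) 0\<bar> powr p\<bar> \<le> \<bar>V y\<bar> * (2 * S powr p)"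
        by (intro mult_left_mono) auto
      then show "norm (?F (\<epsilon> n) n y - ?F 0 n y) \<le> \<bar>V y\<bar> * (2 * S powr p)"
        by (simp flip: abs_mult right_diff_distrib)
    qed
  qed simp
  then have "(\<lambda>n. (LINT y|lebesgue. ?F (\<epsilon> n) n y) - (LINT y|lebesgue. ?F 0 n y)) \<longlonglongrightarrow> 0"
    by (simp only: Bochner_Integration.integral_diff[OF Fi Fi] integral_zero)
  then have "(\<lambda>n. - ((LINT y|lebesgue. ?F (\<epsilon> n) n y) - (LINT y|lebesgue. ?F 0 n y))) \<longlonglongrightarrow> 0"
    by (rule tendsto_minus[where a = "0::real", simplified])
  then show ?thesis by (simp add: scaled_energy_def)
qed

text \<open>
  The scaling exponents preserve the norm, multiply \<open>\<parallel>\<nabla>u\<parallel>^p\<close> by \<open>\<epsilon> powr (- p)\<close>, and satisfy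
  \<open>a * \<epsilon> powr d = \<epsilon> powr p\<close>, so that both parts of the functional scale alike.
\<close>

lemma rescaled_W1p:
  fixes u :: "'a::euclidean_space \<Rightarrow> real"
  assumes p: "p > real DIM('a)" and V: "integrable lebesgue V" and a: "a > 0" and u: "u \<in> W1p p"
  defines "\<epsilon> \<equiv> a powr (1 / (p - real DIM('a)))"
  shows "rescaled p a u \<in> W1p p" "Lp_power p (rescaled p a u) = Lp_power p u"
    "Q p (\<lambda>x. a * V x) u = \<epsilon> powr p * scaled_energy p V \<epsilon> (rescaled p a u)"
proof -
  have p0: "p > 0" using p by (rule le_less_trans[rotated]) simp
  define d where "d = real DIM('a)"
  have dp: "p - d \<noteq> 0" "p \<noteq> 0" using p p0 by (auto simp: d_def)
  have \<epsilon>: "\<epsilon> > 0" using a by (simp add: \<epsilon>_def)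
  have \<epsilon>d: "\<epsilon> ^ DIM('a) = \<epsilon> powr d" using \<epsilon> by (simp add: powr_realpow d_def)
  define c where "c = \<epsilon> powr (- (d / p))"
  define s where "s = 1 / \<epsilon>"
  have c: "c > 0" and s: "s > 0" using \<epsilon> by (auto simp: c_def s_def)
  have resc: "rescaled p a u = (\<lambda>x. c * u (s *\<^sub>R x))"
  proof
    fix x
    have "a powr (- (d / (p * (p - d)))) = c"
      using dp by (simp add: c_def \<epsilon>_def powr_powr mult.commute flip: d_def)
    moreover have "a powr (- (1 / (p - d))) = s" by (simp add: s_def \<epsilon>_def powr_minus_divide flip: d_def)
    ultimately show "rescaled p a u x = c * u (s *\<^sub>R x)" by (simp add: rescaled_def flip: d_def)
  qed
  note R = W1p_rescale[OF u s p, of c, folded resc]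
  have cp: "\<bar>c\<bar> powr p = 1 / \<epsilon> powr d"
  proof -
    have "c powr p = \<epsilon> powr (- (d / p) * p)" by (simp only: c_def powr_powr)
    also have "- (d / p) * p = - d" using dp by simp
    finally show ?thesis using c by (simp add: powr_minus_divide)
  qed
  have sd: "s ^ DIM('a) = 1 / \<epsilon> powr d" by (simp add: s_def power_one_over \<epsilon>d)
  have sp: "s powr p = 1 / \<epsilon> powr p" using \<epsilon> by (simp add: s_def powr_divide)
  have ne: "\<epsilon> powr d \<noteq> 0" "\<epsilon> powr p \<noteq> 0" using \<epsilon> by auto
  show "rescaled p a u \<in> W1p p" by (rule R(1))
  show "Lp_power p (rescaled p a u) = Lp_power p u" unfolding R(2) cp sd using ne by simp
  have D: "\<epsilon> powr p * Lp_power p (weak_grad (rescaled p a u)) = Lp_power p (weak_grad u)"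
    unfolding R(3) cp sd sp using ne by simp
  define r where "r = continuous_rep u"
  obtain S where S: "\<And>x. \<bar>r x\<bar> \<le> S" using W1p_continuous_rep(3)[OF p u] by (auto simp: r_def)
  have r: "continuous_on UNIV r" "AE x in lebesgue. u x = r x" using W1p_continuous_rep[OF p u] by (auto simp: r_def)
  have aV: "integrable lebesgue (\<lambda>x. a * V x)" using V by simp
  have pi: "integrable lebesgue (\<lambda>y. a * V y * \<bar>r y\<bar> powr p)"
    using potential_integrable(1)[OF aV r(1) S p0, of 1] by simp
  note U = W1pD[OF u]
  have rm: "r \<in> borel_measurable lebesgue" by (intro locally_integrable_measurable continuous_locally_integrable r)
  have "Q p (\<lambda>x. a * V x) u = (LINT x|lebesgue. norm (weak_grad u x) powr p - a * V x * \<bar>r x\<bar> powr p)"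
    unfolding Q_def
  proof (rule integral_cong_AE)
    have [measurable]: "weak_grad u \<in> borel_measurable lebesgue" "u \<in> borel_measurable lebesgue" "V \<in> borel_measurable lebesgue"
      "r \<in> borel_measurable lebesgue"
      using U V rm by (auto simp: Lp_def)
    show "(\<lambda>x. norm (weak_grad u x) powr p - a * V x * \<bar>u x\<bar> powr p) \<in> borel_measurable lebesgue" by measurable
    show "(\<lambda>x. norm (weak_grad u x) powr p - a * V x * \<bar>r x\<bar> powr p) \<in> borel_measurable lebesgue" by measurable
    show "AE x in lebesgue. norm (weak_grad u x) powr p - a * V x * \<bar>u x\<bar> powr p = norm (weak_grad u x) powr p - a * V x * \<bar>r x\<bar> powr p"
      using r(2) by eventually_elim simp
  qed
  also have "\<dots> = Lp_power p (weak_grad u) - (LINT y|lebesgue. a * V y * \<bar>r y\<bar> powr p)"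
    unfolding Lp_power_def by (rule Bochner_Integration.integral_diff[OF Lp_integrable[OF U(2)] pi])
  also have "(LINT y|lebesgue. a * V y * \<bar>r y\<bar> powr p) = (LINT y|lebesgue. (a * \<epsilon> powr d) * (V y * \<bar>continuous_rep (rescaled p a u) (\<epsilon> *\<^sub>R y)\<bar> powr p))"
  proof (intro Bochner_Integration.integral_cong refl)
    fix y
    have "continuous_rep (rescaled p a u) (\<epsilon> *\<^sub>R y) = c * r y"
      using \<epsilon> unfolding R(4) by (simp add: r_def s_def)
    then have "\<bar>continuous_rep (rescaled p a u) (\<epsilon> *\<^sub>R y)\<bar> powr p = \<bar>r y\<bar> powr p / \<epsilon> powr d"
      using cp by (simp add: abs_mult powr_mult)
    then show "a * V y * \<bar>r y\<bar> powr p = (a * \<epsilon> powr d) * (V y * \<bar>continuous_rep (rescaled p a u) (\<epsilon> *\<^sub>R y)\<bar> powr p)"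
      using ne by simp
  qed
  also have "\<dots> = (a * \<epsilon> powr d) * (LINT y|lebesgue. V y * \<bar>continuous_rep (rescaled p a u) (\<epsilon> *\<^sub>R y)\<bar> powr p)"
    by simp
  also have "a * \<epsilon> powr d = \<epsilon> powr p"
  proof -
    have "a = \<epsilon> powr (p - d)" using dp a by (simp add: \<epsilon>_def powr_powr d_def)
    then have "a * \<epsilon> powr d = \<epsilon> powr (p - d) * \<epsilon> powr d" by simp
    also have "\<dots> = \<epsilon> powr p" by (simp flip: powr_add)
    finally show ?thesis .
  qed
  finally show "Q p (\<lambda>x. a * V x) u = \<epsilon> powr p * scaled_energy p V \<epsilon> (rescaled p a u)"
    unfolding scaled_energy_def right_diff_distrib D .
qed

text \<open>
  The rescaling is a bijection of the normalized functions, so minimality is inherited.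
\<close>

lemma rescaled_minimizer:
  fixes V :: "'a::euclidean_space \<Rightarrow> real"
  assumes p: "p > real DIM('a)" and V: "integrable lebesgue V" and a: "a > 0"
    and u: "nonneg_normalized_minimizer p (\<lambda>x. a * V x) u"
    and w: "w \<in> W1p p" "Lp_power p w = 1"
  defines "\<epsilon> \<equiv> a powr (1 / (p - real DIM('a)))"
  shows "scaled_energy p V \<epsilon> (rescaled p a u) \<le> scaled_energy p V \<epsilon> w"
proof -
  have p0: "p > 0" using p by (rule le_less_trans[rotated]) simp
  have \<epsilon>: "\<epsilon> > 0" using a by (simp add: \<epsilon>_def)
  have uW: "u \<in> W1p p" using u by (simp add: nonneg_normalized_minimizer_def)
  \<comment> \<open>The normalized function whose rescaling is \<open>w\<close>.\<close>
  define c where "c = a powr (real DIM('a) / (p * (p - real DIM('a))))"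
  define v where "v x = c * w (\<epsilon> *\<^sub>R x)" for x
  have vW: "v \<in> W1p p" unfolding v_def by (rule W1p_rescale(1)[OF w(1) \<epsilon> p])
  have rv: "rescaled p a v = w"
    using a by (simp add: fun_eq_iff rescaled_def v_def c_def \<epsilon>_def powr_minus)
  have Mv: "Lp_power p v = 1" using rescaled_W1p(2)[OF p V a vW] w(2) by (simp add: rv)
  have "\<not> (AE x in lebesgue. v x = 0)"
  proof
    assume "AE x in lebesgue. v x = 0"
    then have "AE x in lebesgue. 0 = v x" by (rule AE_mp) simp
    then have "Lp_power p (\<lambda>x::'a. 0::real) = Lp_power p v"
      by (rule Lp_cong_AE(2)[OF W1pD(1)[OF vW] borel_measurable_const])
    then show False using Mv by (simp add: Lp_power_def)
  qed
  then have "ground_energy p (\<lambda>x. a * V x) \<le> ereal (Q p (\<lambda>x. a * V x) v / (LINT x|lebesgue. \<bar>v x\<bar> powr p))"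
    unfolding ground_energy_def using vW by (intro INF_lower) simp
  moreover have "(LINT x|lebesgue. \<bar>v x\<bar> powr p) = 1" using Mv by (simp add: Lp_power_def)
  ultimately have "ereal (Q p (\<lambda>x. a * V x) u) \<le> ereal (Q p (\<lambda>x. a * V x) v)"
    using u by (simp add: nonneg_normalized_minimizer_def)
  then have "\<epsilon> powr p * scaled_energy p V \<epsilon> (rescaled p a u) \<le> \<epsilon> powr p * scaled_energy p V \<epsilon> w"
    unfolding ereal_less_eq \<epsilon>_def by (simp only: rescaled_W1p(3)[OF p V a uW] rescaled_W1p(3)[OF p V a vW] rv)
  then show ?thesis using \<epsilon> by simp
qed

section \<open>Convergence of minimizing sequences\<close>

lemma Lp_power_0_imp_continuous_rep_0:
  fixes u :: "'a::euclidean_space \<Rightarrow> real"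
  assumes p: "p > real DIM('a)" and u: "u \<in> W1p p" and 0: "Lp_power p u = 0"
  shows "continuous_rep u = (\<lambda>x. 0)"
proof -
  have "AE x in lebesgue. norm (u x) powr p = 0"
    using 0 unfolding Lp_power_def
    by (subst (asm) integral_nonneg_eq_0_iff_AE[OF Lp_integrable[OF W1pD(1)[OF u]]]) auto
  then have "AE x in lebesgue. u x = 0" by (rule AE_mp) simp
  then show ?thesis by (intro continuous_rep_eqI continuous_on_const)
qed

lemma scaled_energy_0_scale:
  fixes u :: "'a::euclidean_space \<Rightarrow> real"
  assumes p: "p > real DIM('a)" and u: "u \<in> W1p p"
  shows "(\<lambda>x. c * u x) \<in> W1p p" "Lp_power p (\<lambda>x. c * u x) = \<bar>c\<bar> powr p * Lp_power p u"
    "scaled_energy p V 0 (\<lambda>x. c * u x) = \<bar>c\<bar> powr p * scaled_energy p V 0 u"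
proof -
  have p0: "p > 0" using p by (rule le_less_trans[rotated]) simp
  note R = W1p_rescale[OF u zero_less_one p, of c, simplified]
  show "(\<lambda>x. c * u x) \<in> W1p p" "Lp_power p (\<lambda>x. c * u x) = \<bar>c\<bar> powr p * Lp_power p u"
    by (rule R)+
  show "scaled_energy p V 0 (\<lambda>x. c * u x) = \<bar>c\<bar> powr p * scaled_energy p V 0 u"
    unfolding scaled_energy_0[OF p0] R(3,4) by (simp add: abs_mult powr_mult algebra_simps)
qed

text \<open>
  The limit functional is homogeneous of degree \<open>p\<close>. Functions of norm 0 cannot be normalized, but their
  continuous representative vanishes.
\<close>

lemma delta_energy_homogeneous:
  fixes V :: "'a::euclidean_space \<Rightarrow> real"
  assumes p: "p > real DIM('a)" and E: "\<And>w. w \<in> W1p p \<Longrightarrow> Lp_power p w = 1 \<Longrightarrow> E \<le> scaled_energy p V 0 w"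
    and u: "u \<in> W1p p"
  shows "E * Lp_power p u \<le> scaled_energy p V 0 u"
proof (cases "Lp_power p u = 0")
  case True
  have p0: "p > 0" using p by (rule le_less_trans[rotated]) simp
  show ?thesis
    using True Lp_power_0_imp_continuous_rep_0[OF p u True] by (simp add: scaled_energy_0[OF p0] Lp_power_nonneg)
next
  case False
  have p0: "p > 0" using p by (rule le_less_trans[rotated]) simp
  have M: "Lp_power p u > 0" using False Lp_power_nonneg[of p u] by simp
  define c where "c = Lp_power p u powr (- (1 / p))"
  have "c powr p = Lp_power p u powr (- (1 / p) * p)" by (simp only: c_def powr_powr)
  also have "- (1 / p) * p = - 1" using p0 by simp
  finally have c: "\<bar>c\<bar> powr p = 1 / Lp_power p u" using M by (simp add: c_def powr_minus_divide)
  note S = scaled_energy_0_scale[OF p u, where c = c, unfolded c]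
  have "E \<le> 1 / Lp_power p u * scaled_energy p V 0 u"
    using E[OF S(1)] S(2,3) False by simp
  then show ?thesis using M by (simp add: field_simps)
qed

text \<open>
  Stretching a bump keeps its value at the origin, while \<open>p > d\<close> makes its gradient term tend to 0.
\<close>

lemma delta_energy_negative:
  fixes V :: "'a::euclidean_space \<Rightarrow> real"
  assumes p: "p > real DIM('a)" and V: "(LINT x|lebesgue. V x) > 0"
  shows "\<exists>w\<in>W1p p. scaled_energy p V 0 w < 0"
proof -
  have p0: "p > 0" using p by (rule le_less_trans[rotated]) simp
  obtain \<phi> :: "'a \<Rightarrow> real" where \<phi>: "test_function \<phi>" "\<phi> 0 > 0" using bump_function_exists by metis
  have W: "\<phi> \<in> W1p p" by (rule test_function_W1p[OF \<phi>(1) p0])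
  have rep: "continuous_rep \<phi> = \<phi>" by (rule continuous_rep_eqI) (auto intro: test_function_continuous \<phi>)
  define D where "D = Lp_power p (weak_grad \<phi>)"
  define v where "v = (LINT x|lebesgue. V x) * \<phi> 0 powr p"
  have v: "v > 0" using V \<phi> by (simp add: v_def)
  have D: "D \<ge> 0" by (simp add: D_def Lp_power_nonneg)
  \<comment> \<open>The gradient term of the stretched bump is \<open>s powr (p - DIM('a)) * D\<close>, and this \<open>s\<close> makes it smaller than \<open>v\<close>.\<close>
  define s where "s = (v / (D + 1)) powr (1 / (p - real DIM('a)))"
  have s: "s > 0" using v D by (simp add: s_def)
  have "s powr (p - real DIM('a)) = v / (D + 1)" using v D p by (simp add: s_def powr_powr)
  then have "s powr (p - real DIM('a)) * (D + 1) = v" using D by simp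
  moreover have "s powr (p - real DIM('a)) > 0" using s by simp
  ultimately have sD: "s powr (p - real DIM('a)) * D < v" unfolding distrib_left by linarith
  note R = W1p_rescale[OF W s p, of 1, simplified]
  have "scaled_energy p V 0 (\<lambda>x. \<phi> (s *\<^sub>R x)) = s powr p * D / s ^ DIM('a) - v"
    unfolding scaled_energy_0[OF p0] R(3,4) rep using \<phi>(2) by (simp add: D_def v_def)
  also have "s powr p * D / s ^ DIM('a) = s powr (p - real DIM('a)) * D"
    using s by (simp add: powr_diff powr_realpow)
  finally show ?thesis using R(1) sD by (intro bexI[of _ "\<lambda>x. \<phi> (s *\<^sub>R x)"]) simp
qed

text \<open>
  The lower bound on \<open>H(w) = \<parallel>\<nabla>w\<parallel>^p - E \<parallel>w\<parallel>^p\<close> at midpoints shows that the convexity defects of both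
  terms of \<open>H\<close> tend to 0 along the sequence; uniform convexity and completeness then give
  the limit.
\<close>

lemma minimizing_sequence_converges:
  fixes V :: "'a::euclidean_space \<Rightarrow> real" and g :: "nat \<Rightarrow> 'a \<Rightarrow> real"
  assumes p: "p > real DIM('a)" and V: "(LINT x|lebesgue. V x) \<ge> 0"
    and E: "E < 0" "\<And>w. w \<in> W1p p \<Longrightarrow> E * Lp_power p w \<le> scaled_energy p V 0 w"
    and g: "\<And>k. g k \<in> W1p p" "\<And>k. Lp_power p (g k) = 1"
    and c: "(\<lambda>k. continuous_rep (g k) 0) \<longlonglongrightarrow> c"
    and D: "(\<lambda>k. Lp_power p (weak_grad (g k))) \<longlonglongrightarrow> D"
    and lim: "(\<lambda>k. scaled_energy p V 0 (g k)) \<longlonglongrightarrow> E"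
  shows "\<exists>f\<in>W1p p. Lp_power p f = 1 \<and> scaled_energy p V 0 f = E \<and>
    (\<lambda>k. Lp_power p (\<lambda>x. g k x - f x)) \<longlonglongrightarrow> 0 \<and>
    (\<lambda>k. Lp_power p (weak_grad (\<lambda>x. g k x - f x))) \<longlonglongrightarrow> 0"
proof -
  have "real DIM('a) \<ge> 1" using DIM_positive[where 'a = 'a] by linarith
  then have p1: "p > 1" using p by linarith
  then have p0: "p > 0" "p \<ge> 0" "p \<ge> 1" by auto
  define v where "v = (LINT x|lebesgue. V x)"
  note gW = W1pD[OF g(1)]
  define b where "b k = continuous_rep (g k) 0" for k
  define H where "H u = Lp_power p (weak_grad u) - E * Lp_power p u" for u :: "'a \<Rightarrow> real"
  have H_ge: "v * \<bar>continuous_rep u 0\<bar> powr p \<le> H u" if "u \<in> W1p p" for u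
    using E(2)[OF that] by (simp add: H_def v_def scaled_energy_0[OF p0(1)])
  have "(\<lambda>k. Lp_power p (weak_grad (g k)) - v * \<bar>b k\<bar> powr p) \<longlonglongrightarrow> D - v * \<bar>c\<bar> powr p"
    unfolding b_def using p0 by (intro tendsto_diff D tendsto_mult tendsto_const tendsto_powr' tendsto_rabs c) auto
  then have E_eq: "E = D - v * \<bar>c\<bar> powr p"
    using lim by (intro LIMSEQ_unique[OF lim]) (simp add: scaled_energy_0[OF p0(1)] v_def b_def)
  have Hlim: "(\<lambda>k. H (g k)) \<longlonglongrightarrow> v * \<bar>c\<bar> powr p"
    using tendsto_diff[OF D tendsto_const[of E]] E_eq by (simp add: H_def g(2))
  define mid where "mid j k = (\<lambda>x. (1/2) * g j x + (1/2) * g k x)" for j k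
  have mid: "mid j k \<in> W1p p" "Lp_power p (mid j k) = Lp_power p (\<lambda>x. (1/2) *\<^sub>R (g j x + g k x))"
    "Lp_power p (weak_grad (mid j k)) = Lp_power p (\<lambda>x. (1/2) *\<^sub>R (weak_grad (g j) x + weak_grad (g k) x))"
    "continuous_rep (mid j k) 0 = (b j + b k) / 2" for j k
    using W1p_lincomb[OF g(1) g(1) p0(2), where a = "1/2" and b = "1/2"] continuous_rep_lincomb[OF g(1) g(1) p, where a = "1/2" and b = "1/2"]
    by (auto simp: mid_def b_def scaleR_add_right add_divide_distrib)
  define dM where "dM j k = (Lp_power p (g j) + Lp_power p (g k)) / 2 - Lp_power p (\<lambda>x. (1/2) *\<^sub>R (g j x + g k x))" for j k
  define dD where "dD j k = (Lp_power p (weak_grad (g j)) + Lp_power p (weak_grad (g k))) / 2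
    - Lp_power p (\<lambda>x. (1/2) *\<^sub>R (weak_grad (g j) x + weak_grad (g k) x))" for j k
  have dM0: "dM j k \<ge> 0" for j k using Lp_midpoint(3)[OF gW(1) gW(1) p1] by (simp add: dM_def)
  have dD0: "dD j k \<ge> 0" for j k using Lp_midpoint(3)[OF gW(2) gW(2) p1] by (simp add: dD_def)
  \<comment> \<open>An upper bound for the total convexity defect that involves only convergent sequences of numbers.\<close>
  define \<Delta> where "\<Delta> j k = (H (g j) + H (g k)) / 2 - v * \<bar>(b j + b k) / 2\<bar> powr p" for j k
  have sum_le: "dD j k - E * dM j k \<le> \<Delta> j k" for j k
  proof -
    have "dD j k - E * dM j k = (H (g j) + H (g k)) / 2 - H (mid j k)"
      by (simp add: dD_def dM_def H_def mid(2,3) field_simps)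
    also have "\<dots> \<le> \<Delta> j k" using H_ge[OF mid(1), of j k] by (simp add: \<Delta>_def mid(4))
    finally show ?thesis .
  qed
  have \<Delta>0: "\<exists>N. \<forall>j\<ge>N. \<forall>k\<ge>N. \<Delta> j k < e" if e: "e > 0" for e
  proof -
    have f1: "((\<lambda>q. f (fst q)) \<longlongrightarrow> l) (sequentially \<times>\<^sub>F sequentially)" if "f \<longlonglongrightarrow> l" for f :: "nat \<Rightarrow> real" and l
      by (rule filterlim_compose[OF that filterlim_fst])
    have f2: "((\<lambda>q. f (snd q)) \<longlongrightarrow> l) (sequentially \<times>\<^sub>F sequentially)" if "f \<longlonglongrightarrow> l" for f :: "nat \<Rightarrow> real" and l
      by (rule filterlim_compose[OF that filterlim_snd])
    have bl: "b \<longlonglongrightarrow> c" using c by (simp add: b_def[abs_def])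
    have "((\<lambda>q. \<Delta> (fst q) (snd q)) \<longlongrightarrow> (v * \<bar>c\<bar> powr p + v * \<bar>c\<bar> powr p) / 2 - v * \<bar>(c + c) / 2\<bar> powr p) (sequentially \<times>\<^sub>F sequentially)"
      unfolding \<Delta>_def using p0
      by (intro tendsto_diff tendsto_divide tendsto_add tendsto_mult tendsto_const tendsto_powr' tendsto_rabs f1[OF Hlim] f2[OF Hlim] f1[OF bl] f2[OF bl]) auto
    then have "((\<lambda>q. \<Delta> (fst q) (snd q)) \<longlongrightarrow> 0) (sequentially \<times>\<^sub>F sequentially)" by simp
    then have "\<forall>\<^sub>F q in sequentially \<times>\<^sub>F sequentially. \<Delta> (fst q) (snd q) < e" using e by (rule order_tendstoD(2))
    then have "\<forall>\<^sub>F (j, k) in sequentially \<times>\<^sub>F sequentially. \<Delta> j k < e" by (simp add: case_prod_beta')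
    then have "\<exists>N. \<forall>k\<ge>N. \<forall>j\<ge>N. \<Delta> j k < e" by (simp add: eventually_prod_sequentially)
    then show ?thesis by blast
  qed
  obtain A where A: "\<And>k. Lp_power p (weak_grad (g k)) \<le> A"
    using convergent_imp_Bseq[OF convergentI[OF D]] by (auto simp: Bseq_def abs_le_iff)
  have Cauchy: "\<exists>N. \<forall>j\<ge>N. \<forall>k\<ge>N. Lp_power p (\<lambda>x. h j x - h k x) < e"
    if e: "e > 0" and h: "\<And>k. h k \<in> Lp p" and B: "\<And>k. Lp_power p (h k) \<le> B" and a: "a > 0"
      and defect: "\<And>j k. a * ((Lp_power p (h j) + Lp_power p (h k)) / 2 - Lp_power p (\<lambda>x. (1/2) *\<^sub>R (h j x + h k x))) \<le> \<Delta> j k"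
    for e B a :: real and h :: "nat \<Rightarrow> 'a \<Rightarrow> 'b::euclidean_space"
  proof -
    have B0: "B \<ge> 0" using B[of 0] Lp_power_nonneg[of p "h 0"] by linarith
    \<comment> \<open>Half of \<open>e\<close> is spent on \<open>\<eta>\<close>, the other half on the defect.\<close>
    define \<eta> where "\<eta> = e / (4 * (B + 1))"
    have \<eta>: "\<eta> > 0" using e B0 by (simp add: \<eta>_def)
    obtain C where C: "C > 0" "\<And>f g :: 'a \<Rightarrow> 'b. f \<in> Lp p \<Longrightarrow> g \<in> Lp p \<Longrightarrow> Lp_power p (\<lambda>x. f x - g x) \<le>
        \<eta> * (Lp_power p f + Lp_power p g) + C * ((Lp_power p f + Lp_power p g) / 2 - Lp_power p (\<lambda>x. (1/2) *\<^sub>R (f x + g x)))"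
      using Lp_uniform_convexity[OF p1 \<eta>, where 'a = 'a and 'b = 'b] by blast
    obtain N where N: "\<And>j k. j \<ge> N \<Longrightarrow> k \<ge> N \<Longrightarrow> \<Delta> j k < a * e / (2 * C)"
      using \<Delta>0[of "a * e / (2 * C)"] a e C(1) by auto
    have "Lp_power p (\<lambda>x. h j x - h k x) < e" if "j \<ge> N" "k \<ge> N" for j k
    proof -
      define d where "d = (Lp_power p (h j) + Lp_power p (h k)) / 2 - Lp_power p (\<lambda>x. (1/2) *\<^sub>R (h j x + h k x))"
      have "a * d < a * e / (2 * C)" using defect[of j k] N[OF that] by (simp add: d_def)
      then have "C * d < e / 2" using a C(1) by (simp add: field_simps)
      moreover have "\<eta> * (Lp_power p (h j) + Lp_power p (h k)) \<le> \<eta> * (B + B)"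
        using \<eta> by (intro mult_left_mono add_mono B) auto
      moreover have "\<eta> * (B + B) \<le> e / 2" using e B0 by (simp add: \<eta>_def field_simps)
      ultimately show ?thesis using C(2)[OF h[of j] h[of k]] by (simp add: d_def)
    qed
    then show ?thesis by blast
  qed
  have dM_le: "- E * dM j k \<le> \<Delta> j k" for j k using sum_le[of j k] dD0[of j k] by simp
  have "\<exists>f\<in>Lp p. (\<lambda>n. Lp_power p (\<lambda>x. g n x - f x)) \<longlonglongrightarrow> 0"
  proof (rule Lp_complete[OF gW(1) p0(3)])
    show "\<exists>N. \<forall>m\<ge>N. \<forall>n\<ge>N. Lp_power p (\<lambda>x. g m x - g n x) < e" if "e > 0" for e
      by (rule Cauchy[OF that gW(1) eq_refl[OF g(2)] _ dM_le[unfolded dM_def]]) (use E(1) in simp)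
  qed
  then obtain f where f: "f \<in> Lp p" "(\<lambda>n. Lp_power p (\<lambda>x. g n x - f x)) \<longlonglongrightarrow> 0" by blast
  have dD_le: "1 * dD j k \<le> \<Delta> j k" for j k
    using sum_le[of j k] mult_nonpos_nonneg[OF less_imp_le[OF E(1)] dM0[of j k]] by simp
  have "\<exists>G\<in>Lp p. (\<lambda>n. Lp_power p (\<lambda>x. weak_grad (g n) x - G x)) \<longlonglongrightarrow> 0"
  proof (rule Lp_complete[OF gW(2) p0(3)])
    show "\<exists>N. \<forall>m\<ge>N. \<forall>n\<ge>N. Lp_power p (\<lambda>x. weak_grad (g m) x - weak_grad (g n) x) < e" if "e > 0" for e
      by (rule Cauchy[OF that gW(2) A zero_less_one dD_le[unfolded dD_def]])
  qed
  then obtain G where G: "G \<in> Lp p" "(\<lambda>n. Lp_power p (\<lambda>x. weak_grad (g n) x - G x)) \<longlonglongrightarrow> 0" by blast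
  have wf: "is_weak_gradient f G"
    by (rule is_weak_gradient_limit[OF gW(3) p0(3) gW(1,2) f(1) G(1) f(2) G(2)])
  note fW = W1pI[OF f(1) G(1) wf]
  have Mf: "Lp_power p f = 1"
    using Lp_power_tendsto[OF gW(1) f(1) p0(3) f(2)] by (simp add: g(2) LIMSEQ_const_iff)
  have Df: "Lp_power p (weak_grad f) = D"
    using LIMSEQ_unique[OF D Lp_power_tendsto[OF gW(2) G(1) p0(3) G(2)]] fW(3) by simp
  have grad_diff: "Lp_power p (weak_grad (\<lambda>x. g n x - f x)) = Lp_power p (\<lambda>x. weak_grad (g n) x - G x)" for n
    using W1pI(3)[OF Lp_diff[OF gW(1) f(1) p0(2)] Lp_diff[OF gW(2) G(1) p0(2)], of n n]
      is_weak_gradient_lincomb[OF gW(3)[of n] wf, of 1 "-1"] by simp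
  have dlim: "(\<lambda>k. Lp_power p (weak_grad (\<lambda>x. g k x - f x))) \<longlonglongrightarrow> 0" using G(2) by (simp add: grad_diff)
  have "b \<longlonglongrightarrow> continuous_rep f 0"
  proof -
    obtain C where C: "C > 0" "\<And>t u x. t > 0 \<Longrightarrow> u \<in> W1p p \<Longrightarrow> \<bar>continuous_rep u (x::'a)\<bar> powr p \<le>
      C * (t powr (- real DIM('a)) * Lp_power p u + t powr (p - real DIM('a)) * Lp_power p (weak_grad u))"
      using W1p_sup_bound[OF p] by blast
    have "(\<lambda>k. C * (Lp_power p (\<lambda>x. g k x - f x) + Lp_power p (weak_grad (\<lambda>x. g k x - f x)))) \<longlonglongrightarrow> C * (0 + 0)"
      by (intro tendsto_intros f(2) dlim)
    then have up: "(\<lambda>k. C * (Lp_power p (\<lambda>x. g k x - f x) + Lp_power p (weak_grad (\<lambda>x. g k x - f x)))) \<longlonglongrightarrow> 0" by simp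
    have "(\<lambda>k. \<bar>b k - continuous_rep f 0\<bar> powr p) \<longlonglongrightarrow> 0"
    proof (rule Lim_null_comparison[OF _ up], rule always_eventually, rule allI)
      fix k
      have "(\<lambda>x. g k x - f x) \<in> W1p p" using W1p_lincomb(1)[OF g(1)[of k] fW(1) p0(2), of 1 "-1"] by simp
      moreover have "continuous_rep (\<lambda>x. g k x - f x) 0 = b k - continuous_rep f 0"
        using continuous_rep_lincomb[OF g(1)[of k] fW(1) p, of 1 "-1"] by (simp add: b_def)
      ultimately show "norm (\<bar>b k - continuous_rep f 0\<bar> powr p) \<le> C * (Lp_power p (\<lambda>x. g k x - f x) + Lp_power p (weak_grad (\<lambda>x. g k x - f x)))"
        using C(2)[of 1 "\<lambda>x. g k x - f x" 0] by simp
    qed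
    then have "(\<lambda>k. (\<bar>b k - continuous_rep f 0\<bar> powr p) powr (1 / p)) \<longlonglongrightarrow> 0 powr (1 / p)"
      using p0 by (intro tendsto_powr' tendsto_const) auto
    then have "(\<lambda>k. \<bar>b k - continuous_rep f 0\<bar>) \<longlonglongrightarrow> 0" using p0 by (simp add: powr_powr)
    then show ?thesis by (simp add: tendsto_rabs_zero_iff LIM_zero_iff)
  qed
  then have "continuous_rep f 0 = c" using c LIMSEQ_unique by (auto simp: b_def[abs_def])
  then have "scaled_energy p V 0 f = E" by (simp add: scaled_energy_0[OF p0(1)] Df E_eq v_def)
  then show ?thesis using fW(1) Mf f(2) dlim by blast
qed

theorem proposition3p7:
  fixes p :: real
    and V :: "'a::euclidean_space \<Rightarrow> real"
    and u :: "real \<Rightarrow> 'a \<Rightarrow> real"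
    and \<alpha> :: "nat \<Rightarrow> real"
  assumes "p > real DIM('a)"
    and "integrable lebesgue V"
    and "(LINT x|lebesgue. V x) > 0"
    and "\<And>a. a > 0 \<Longrightarrow> nonneg_normalized_minimizer p (\<lambda>x. a * V x) (u a)"
    and "\<And>n. \<alpha> n > 0"
    and "\<alpha> \<longlonglongrightarrow> 0"
  shows "\<exists>r f0. strict_mono (r :: nat \<Rightarrow> nat) \<and> f0 \<in> W1p p \<and>
           (\<lambda>k. W1p_norm p (\<lambda>x. rescaled p (\<alpha> (r k)) (u (\<alpha> (r k))) x - f0 x)) \<longlonglongrightarrow> 0 \<and>
           delta_minimizer p (LINT x|lebesgue. V x) f0"
proof -
  note p = assms(1) and V = assms(2)
  have p0: "p > 0" using p by (rule le_less_trans[rotated]) simp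
  define \<epsilon> where "\<epsilon> n = \<alpha> n powr (1 / (p - real DIM('a)))" for n
  have "\<epsilon> \<longlonglongrightarrow> 0 powr (1 / (p - real DIM('a)))" unfolding \<epsilon>_def
    using p assms(5) by (intro tendsto_powr' assms(6) tendsto_const) (auto intro!: always_eventually less_imp_le)
  then have \<epsilon>0: "\<epsilon> \<longlonglongrightarrow> 0" by simp
  define f where "f n = rescaled p (\<alpha> n) (u (\<alpha> n))" for n
  have um: "u (\<alpha> n) \<in> W1p p" "Lp_power p (u (\<alpha> n)) = 1" for n
    using assms(4)[OF assms(5)[of n]] Lp_norm_eq_1_iff[OF p0] by (auto simp: nonneg_normalized_minimizer_def)
  have f: "f n \<in> W1p p" "Lp_power p (f n) = 1" for n
    using rescaled_W1p(1,2)[OF p V assms(5) um(1)] um(2) by (auto simp: f_def)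
  have f_min: "scaled_energy p V (\<epsilon> n) (f n) \<le> scaled_energy p V (\<epsilon> n) w" if "w \<in> W1p p" "Lp_power p w = 1" for w n
    unfolding f_def \<epsilon>_def by (rule rescaled_minimizer[OF p V assms(5) assms(4)[OF assms(5)] that])
  have w_lim: "(\<lambda>n. scaled_energy p V (\<epsilon> n) w) \<longlonglongrightarrow> scaled_energy p V 0 w" if "w \<in> W1p p" for w
  proof -
    have "(\<lambda>n. scaled_energy p V (\<epsilon> n) w - scaled_energy p V 0 w) \<longlonglongrightarrow> 0"
      by (rule scaled_energy_tendsto[OF p V that _ _ \<epsilon>0, of "max (Lp_power p w) (Lp_power p (weak_grad w))"]) auto
    then show ?thesis by (simp add: LIM_zero_iff)
  qed
  obtain C where C: "C \<ge> 0" "\<And>\<epsilon> u. u \<in> W1p p \<Longrightarrow> scaled_energy p V \<epsilon> u \<ge> Lp_power p (weak_grad u) / 2 - C * Lp_power p u"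
    using scaled_energy_lower_bound[OF p V] by blast
  obtain A where A: "A \<ge> 1" "\<And>n. Lp_power p (weak_grad (f n)) \<le> A"
  proof -
    \<comment> \<open>The first member of the sequence serves as a fixed competitor for all \<open>n\<close>.\<close>
    obtain K where K: "\<And>n. scaled_energy p V (\<epsilon> n) (f 0) \<le> K"
      using convergent_imp_Bseq[OF convergentI[OF w_lim[OF f(1)[of 0]]]] by (auto simp: Bseq_def abs_le_iff)
    have "Lp_power p (weak_grad (f n)) \<le> max 1 (2 * (K + C))" for n
      using C(2)[OF f(1)[of n], of "\<epsilon> n"] f_min[OF f(1)[of 0] f(2)[of 0], of n] K[of n] f(2)[of n] by simp
    then show ?thesis using that[of "max 1 (2 * (K + C))"] by simp
  qed
  have diff: "(\<lambda>n. scaled_energy p V (\<epsilon> n) (f n) - scaled_energy p V 0 (f n)) \<longlonglongrightarrow> 0"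
    by (rule scaled_energy_tendsto[OF p V f(1) _ A(2) \<epsilon>0]) (use f(2) A(1) in simp)
  obtain S where S: "\<And>n. \<bar>continuous_rep (f n) 0\<bar> \<le> S"
  proof -
    obtain C where C: "C > 0" "\<And>t u x. t > 0 \<Longrightarrow> u \<in> W1p p \<Longrightarrow> \<bar>continuous_rep u (x::'a)\<bar> powr p \<le>
      C * (t powr (- real DIM('a)) * Lp_power p u + t powr (p - real DIM('a)) * Lp_power p (weak_grad u))"
      using W1p_sup_bound[OF p] by blast
    have "\<bar>continuous_rep (f n) 0\<bar> \<le> (C * (1 + A)) powr (1 / p)" for n
    proof -
      have "\<bar>continuous_rep (f n) 0\<bar> powr p \<le> C * (1 + Lp_power p (weak_grad (f n)))"
        using C(2)[OF zero_less_one f(1), of n 0] f(2)[of n] by simp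
      also have "\<dots> \<le> C * (1 + A)" using C(1) A(2)[of n] by (intro mult_left_mono) auto
      finally have "(\<bar>continuous_rep (f n) 0\<bar> powr p) powr (1 / p) \<le> (C * (1 + A)) powr (1 / p)"
        using p0 by (intro powr_mono2) auto
      then show ?thesis using p0 by (simp add: powr_powr)
    qed
    then show ?thesis using that by blast
  qed
  have "compact ({-S..S} \<times> {0..A})" by (intro compact_Times) auto
  moreover have "(continuous_rep (f n) 0, Lp_power p (weak_grad (f n))) \<in> {-S..S} \<times> {0..A}" for n
    using S[of n] A(2)[of n] by (auto simp: abs_le_iff Lp_power_nonneg)
  ultimately obtain l r where r: "strict_mono (r :: nat \<Rightarrow> nat)"
    and l: "((\<lambda>n. (continuous_rep (f n) 0, Lp_power p (weak_grad (f n)))) \<circ> r) \<longlonglongrightarrow> l"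
    unfolding compact_def by meson
  define g where "g k = f (r k)" for k
  obtain c D where cD: "l = (c, D)" by (cases l)
  have c: "(\<lambda>k. continuous_rep (g k) 0) \<longlonglongrightarrow> c" and D: "(\<lambda>k. Lp_power p (weak_grad (g k))) \<longlonglongrightarrow> D"
    using tendsto_fst[OF l] tendsto_snd[OF l] by (auto simp: cD g_def comp_def)
  define E where "E = D - (LINT x|lebesgue. V x) * \<bar>c\<bar> powr p"
  have E_lim: "(\<lambda>k. scaled_energy p V 0 (g k)) \<longlonglongrightarrow> E"
    unfolding scaled_energy_0[OF p0] E_def using p0
    by (intro tendsto_diff D tendsto_mult tendsto_const tendsto_powr' tendsto_rabs c) auto
  have E_lim': "(\<lambda>k. scaled_energy p V (\<epsilon> (r k)) (g k)) \<longlonglongrightarrow> E"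
    using tendsto_add[OF LIMSEQ_subseq_LIMSEQ[OF diff r] E_lim] by (simp add: comp_def g_def)
  have E_le: "E \<le> scaled_energy p V 0 w" if w: "w \<in> W1p p" "Lp_power p w = 1" for w
    using LIMSEQ_subseq_LIMSEQ[OF w_lim[OF w(1)] r] f_min[OF w]
    by (intro LIMSEQ_le[OF E_lim']) (auto simp: comp_def g_def)
  note E_hom = delta_energy_homogeneous[OF p E_le]
  have E_neg: "E < 0"
  proof -
    obtain w where w: "w \<in> W1p p" "scaled_energy p V 0 w < 0" using delta_energy_negative[OF p assms(3)] by blast
    then have "E * Lp_power p w < 0" using E_hom[of w] by simp
    then show ?thesis using Lp_power_nonneg[of p w] by (simp add: mult_less_0_iff)
  qed
  obtain f0 where f0: "f0 \<in> W1p p" "Lp_power p f0 = 1" "scaled_energy p V 0 f0 = E"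
    "(\<lambda>k. Lp_power p (\<lambda>x. g k x - f0 x)) \<longlonglongrightarrow> 0" "(\<lambda>k. Lp_power p (weak_grad (\<lambda>x. g k x - f0 x))) \<longlonglongrightarrow> 0"
  proof -
    have "g k \<in> W1p p" "Lp_power p (g k) = 1" for k using f by (auto simp: g_def)
    from minimizing_sequence_converges[OF p less_imp_le[OF assms(3)] E_neg E_hom this c D E_lim] that
    show ?thesis by blast
  qed
  have "(\<lambda>k. W1p_norm p (\<lambda>x. g k x - f0 x)) \<longlonglongrightarrow> (0 + 0) powr (1 / p)"
    unfolding W1p_norm_def Lp_norm_powr[OF p0] using p0
    by (intro tendsto_powr' tendsto_add f0 tendsto_const) (auto intro!: always_eventually add_nonneg_nonneg Lp_power_nonneg)
  then have "(\<lambda>k. W1p_norm p (\<lambda>x. g k x - f0 x)) \<longlonglongrightarrow> 0" by simp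
  moreover have "delta_minimizer p (LINT x|lebesgue. V x) f0"
    unfolding delta_minimizer_def
  proof (intro conjI)
    show "f0 \<in> W1p p" by (rule f0)
    show "Lp_norm p f0 = 1" using f0(2) by (simp add: Lp_norm_eq_1_iff[OF p0])
    show "ereal (delta_functional p (LINT x|lebesgue. V x) f0) = delta_energy TYPE('a) p (LINT x|lebesgue. V x)"
      unfolding delta_energy_def delta_functional_eq[OF p0] f0(3)
    proof (rule antisym)
      show "ereal E \<le> (INF u\<in>{u :: 'a \<Rightarrow> real. u \<in> W1p p \<and> Lp_norm p u = 1}. ereal (scaled_energy p V 0 u))"
        using E_le by (intro INF_greatest) (auto simp: Lp_norm_eq_1_iff[OF p0])
      have "(INF u\<in>{u :: 'a \<Rightarrow> real. u \<in> W1p p \<and> Lp_norm p u = 1}. ereal (scaled_energy p V 0 u)) \<le> ereal (scaled_energy p V 0 f0)"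
        using f0(1,2) by (intro INF_lower) (simp add: Lp_norm_eq_1_iff[OF p0])
      then show "(INF u\<in>{u :: 'a \<Rightarrow> real. u \<in> W1p p \<and> Lp_norm p u = 1}. ereal (scaled_energy p V 0 u)) \<le> ereal E"
        by (simp add: f0(3))
    qed
  qed
  ultimately show ?thesis using r f0(1) unfolding g_def f_def by blast
qed


end
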